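(* Let $F=\{\sigma_1,\dots,\sigma_n\}\subset\partial\mathbb{D}$ consist of pairwise distinct points, let $\Lambda=(\lambda_1,\dots,\lambda_n)\in(-\infty,0)^n$, and let $\tau\in\partial\mathbb{D}\setminus F$. Put $\alpha_k:=|\tau-\sigma_k|^2/(2|\lambda_k|)$ and $$Z:=\Big\{\zeta:\Big|\Big(2\tau^{-1}\sum_k\alpha_k\Big)\zeta-1\Big|\le1\Big\},\qquad \ell_\zeta:=\tau/\zeta-\sum_k\alpha_k \ \ (\zeta\neq0),$$ $$f(w):=\frac{2\,\mathrm{Re}\, w}{|w|^2+2\,\mathrm{Re}\, w\sum_{k=1}^n|\lambda_k|^{-1}}.$$ Then $$V_\tau(F,\Lambda):=\{(G(0),\lambda(G))\in\mathbb{C}\times\mathbb{R}:G\in\mathsf{Gen}_\tau(F,\Lambda)\}=\{(\zeta,\omega):\zeta\in Z,\ \omega\in I_\zeta\},$$ where: (i) for $\zeta$ in the interior of $Z$, $I_\zeta=[0,\omega_\zeta]$ with $\omega_\zeta:=f\big(\ell_\zeta+i\sum_{k=1}^n|\lambda_k|^{-1}\mathrm{Im}(\overline\sigma_k\tau)\big)$; (ii) for $\zeta\in\partial Z$, $I_\zeta$ is a singleton: if $1/\overline\zeta=\sum_{k=1}^n|\lambda_k|^{-1}(\tau-\sigma_k)$ then $I_\zeta=\{(\sum_{k=1}^n|\lambda_k|^{-1})^{-1}\}$, and otherwise $I_\zeta=\{0\}$. Moreover, for each $\zeta$ in the interior of $Z$ there is a unique $G\in\mathsf{Gen}_\tau(F,\Lambda)$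 with $G(0)=\zeta$ and $\lambda(G)=\omega_\zeta$, namely $$G(z)=\frac{(\tau-z)(1-\overline\tau z)}{\frac{\sigma_\zeta+z}{\sigma_\zeta-z}\mathrm{Re}\,\ell_\zeta+i\,\mathrm{Im}\,\ell_\zeta+p_0(z;F,\Lambda)},$$ where $\sigma_\zeta\in\partial\mathbb{D}$ is uniquely determined by the condition that the denominator vanishes at $z=\tau$.
   Context: $\mathbb{D}$ is the open unit disk. A one-parameter semigroup $(\phi_t)_{t\ge0}$ of holomorphic self-maps of $\mathbb{D}$ satisfies $\phi_0=\mathrm{id}$, $\phi_s\circ\phi_t=\phi_{s+t}$, and $\phi_t\to\mathrm{id}$ pointwise as $t\to 0^+$. Its infinitesimal generator $G$ satisfies $\frac{d}{dt}\phi_t(z)=G(\phi_t(z))$. $\mathsf{Gen}_\tau$ is the set of generators with Denjoy–Wolff point $\tau$, together with $G\equiv0$. For $\tau\in\partial\mathbb{D}$, the spectral value $\lambda(G)\ge0$ is defined by $\phi_t'(\tau)=e^{-\lambda(G)t}$ (angular derivative); for $G\equiv0$, $\lambda(G)=0$. A point $\sigma\in\partial\mathbb{D}$ is a boundary regular fixed point (BRFP) if each $\phi_t$ has angular limit $\sigma$ and a finite angular derivative at $\sigma$. The spectral value there is $\lambda'$ with $\phi_t'(\sigma)=e^{-\lambda't}$, equivalently $\lambda'=\angle\lim_{z\to\sigma}G(z)/(\sigma-z)$. $\mathsf{Gen}_\tau(F,\Lambda)$ is the set of $G\in\mathsf{Gen}_\tau$ whose semigroup has BRFPs at all $\sigma_k$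 with spectral values $\lambda'_k\in[\lambda_k,0]$ (including $G\equiv0$). $p_0(z;F,\Lambda):=\sum_k\alpha_k\frac{\sigma_k+z}{\sigma_k-z}$. *)

theory Defs
  imports "HOL-Analysis.Analysis"
begin

abbreviation unit_disk :: "complex set" where
  "unit_disk \<equiv> ball 0 1"

definition stolz_region :: "complex \<Rightarrow> real \<Rightarrow> complex set" where
  "stolz_region \<sigma> M = {z. cmod z < 1 \<and> cmod (\<sigma> - z) < M * (1 - cmod z)}"

definition angular_limit :: "(complex \<Rightarrow> complex) \<Rightarrow> complex \<Rightarrow> complex \<Rightarrow> bool" where
  "angular_limit f \<sigma> L \<longleftrightarrow> (\<forall>M>1. (f \<longlongrightarrow> L) (at \<sigma> within stolz_region \<sigma> M))"

definition holo_semigroup :: "(real \<Rightarrow> complex \<Rightarrow> complex) \<Rightarrow> bool" where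
  "holo_semigroup \<phi> \<longleftrightarrow>
     (\<forall>t\<ge>0. \<phi> t holomorphic_on unit_disk \<and> \<phi> t ` unit_disk \<subseteq> unit_disk) \<and>
     (\<forall>z\<in>unit_disk. \<phi> 0 z = z) \<and>
     (\<forall>s\<ge>0. \<forall>t\<ge>0. \<forall>z\<in>unit_disk. \<phi> (s + t) z = \<phi> s (\<phi> t z)) \<and>
     (\<forall>z\<in>unit_disk. ((\<lambda>t. \<phi> t z) \<longlongrightarrow> z) (at_right 0))"

definition generates :: "(real \<Rightarrow> complex \<Rightarrow> complex) \<Rightarrow> (complex \<Rightarrow> complex) \<Rightarrow> bool" where
  "generates \<phi> G \<longleftrightarrow> holo_semigroup \<phi> \<and> G holomorphic_on unit_disk \<and>
     (\<forall>z\<in>unit_disk. \<forall>t\<ge>0.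
        ((\<lambda>s. \<phi> s z) has_vector_derivative G (\<phi> t z)) (at t within {0..}))"

definition dw_point :: "(real \<Rightarrow> complex \<Rightarrow> complex) \<Rightarrow> complex \<Rightarrow> bool" where
  "dw_point \<phi> \<tau> \<longleftrightarrow> cmod \<tau> = 1 \<and> (\<forall>z\<in>unit_disk. ((\<lambda>t. \<phi> t z) \<longlongrightarrow> \<tau>) at_top)"

definition brfp :: "(real \<Rightarrow> complex \<Rightarrow> complex) \<Rightarrow> complex \<Rightarrow> real \<Rightarrow> bool" where
  "brfp \<phi> \<sigma> l \<longleftrightarrow> cmod \<sigma> = 1 \<and>
     (\<forall>t\<ge>0. angular_limit (\<phi> t) \<sigma> \<sigma> \<and>
             angular_limit (\<lambda>z. (\<phi> t z - \<sigma>) / (z - \<sigma>)) \<sigma> (complex_of_real (exp (- l * t))))"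

text \<open>Spectral value \<open>\<lambda>(G)\<close> at the boundary Denjoy--Wolff point \<open>\<tau>\<close>: \<open>\<phi>_t'(\<tau>) = e^{-\<lambda>(G) t}\<close>
  (for \<open>G \<equiv> 0\<close> this gives \<open>0\<close>).\<close>
definition spectral_value :: "complex \<Rightarrow> (complex \<Rightarrow> complex) \<Rightarrow> real" where
  "spectral_value \<tau> G = (THE \<omega>. \<exists>\<phi>. generates \<phi> G \<and>
     (\<forall>t\<ge>0. angular_limit (\<lambda>z. (\<phi> t z - \<tau>) / (z - \<tau>)) \<tau> (complex_of_real (exp (- \<omega> * t)))))"

definition Gen_FL :: "complex \<Rightarrow> nat \<Rightarrow> (nat \<Rightarrow> complex) \<Rightarrow> (nat \<Rightarrow> real) \<Rightarrow> (complex \<Rightarrow> complex) set" where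
  "Gen_FL \<tau> n \<sigma> lam = {G. \<exists>\<phi>. generates \<phi> G \<and>
      (dw_point \<phi> \<tau> \<or> (\<forall>z\<in>unit_disk. G z = 0)) \<and>
      (\<forall>k<n. \<exists>l. lam k \<le> l \<and> l \<le> 0 \<and> brfp \<phi> (\<sigma> k) l)}"

definition V_FL :: "complex \<Rightarrow> nat \<Rightarrow> (nat \<Rightarrow> complex) \<Rightarrow> (nat \<Rightarrow> real) \<Rightarrow> (complex \<times> real) set" where
  "V_FL \<tau> n \<sigma> lam = {(G 0, spectral_value \<tau> G) | G. G \<in> Gen_FL \<tau> n \<sigma> lam}"

definition alpha :: "complex \<Rightarrow> (nat \<Rightarrow> complex) \<Rightarrow> (nat \<Rightarrow> real) \<Rightarrow> nat \<Rightarrow> real" where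
  "alpha \<tau> \<sigma> lam k = (cmod (\<tau> - \<sigma> k))\<^sup>2 / (2 * \<bar>lam k\<bar>)"

definition p0 :: "complex \<Rightarrow> nat \<Rightarrow> (nat \<Rightarrow> complex) \<Rightarrow> (nat \<Rightarrow> real) \<Rightarrow> complex \<Rightarrow> complex" where
  "p0 \<tau> n \<sigma> lam z = (\<Sum>k<n. complex_of_real (alpha \<tau> \<sigma> lam k) * ((\<sigma> k + z) / (\<sigma> k - z)))"

definition Zset :: "complex \<Rightarrow> nat \<Rightarrow> (nat \<Rightarrow> complex) \<Rightarrow> (nat \<Rightarrow> real) \<Rightarrow> complex set" where
  "Zset \<tau> n \<sigma> lam =
     {\<zeta>. cmod ((2 * inverse \<tau> * complex_of_real (\<Sum>k<n. alpha \<tau> \<sigma> lam k)) * \<zeta> - 1) \<le> 1}"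

definition ell :: "complex \<Rightarrow> nat \<Rightarrow> (nat \<Rightarrow> complex) \<Rightarrow> (nat \<Rightarrow> real) \<Rightarrow> complex \<Rightarrow> complex" where
  "ell \<tau> n \<sigma> lam \<zeta> = \<tau> / \<zeta> - complex_of_real (\<Sum>k<n. alpha \<tau> \<sigma> lam k)"

definition fw :: "nat \<Rightarrow> (nat \<Rightarrow> real) \<Rightarrow> complex \<Rightarrow> real" where
  "fw n lam w = 2 * Re w / ((cmod w)\<^sup>2 + 2 * Re w * (\<Sum>k<n. 1 / \<bar>lam k\<bar>))"

definition omega :: "complex \<Rightarrow> nat \<Rightarrow> (nat \<Rightarrow> complex) \<Rightarrow> (nat \<Rightarrow> real) \<Rightarrow> complex \<Rightarrow> real" where
  "omega \<tau> n \<sigma> lam \<zeta> = fw n lam (ell \<tau> n \<sigma> lam \<zeta> +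
      \<i> * complex_of_real (\<Sum>k<n. (1 / \<bar>lam k\<bar>) * Im (cnj (\<sigma> k) * \<tau>)))"

text \<open>The interval \<open>I_\<zeta>\<close> (only meaningful for \<open>\<zeta> \<in> Z\<close>).\<close>
definition Iset :: "complex \<Rightarrow> nat \<Rightarrow> (nat \<Rightarrow> complex) \<Rightarrow> (nat \<Rightarrow> real) \<Rightarrow> complex \<Rightarrow> real set" where
  "Iset \<tau> n \<sigma> lam \<zeta> =
     (if \<zeta> \<in> interior (Zset \<tau> n \<sigma> lam) then {0 .. omega \<tau> n \<sigma> lam \<zeta>}
      else if \<zeta> \<noteq> 0 \<and> 1 / cnj \<zeta> = (\<Sum>k<n. complex_of_real (1 / \<bar>lam k\<bar>) * (\<tau> - \<sigma> k))
        then {1 / (\<Sum>k<n. 1 / \<bar>lam k\<bar>)}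
      else {0})"

text \<open>Denominator of the extremal generator, with parameter \<open>s = \<sigma>_\<zeta>\<close>.\<close>
definition denom :: "complex \<Rightarrow> nat \<Rightarrow> (nat \<Rightarrow> complex) \<Rightarrow> (nat \<Rightarrow> real) \<Rightarrow> complex \<Rightarrow> complex \<Rightarrow> complex \<Rightarrow> complex" where
  "denom \<tau> n \<sigma> lam \<zeta> s z =
     (s + z) / (s - z) * complex_of_real (Re (ell \<tau> n \<sigma> lam \<zeta>))
     + \<i> * complex_of_real (Im (ell \<tau> n \<sigma> lam \<zeta>)) + p0 \<tau> n \<sigma> lam z"

end

(*
  Berkson--Porta: G(z) = (tau - z)(1 - cnj tau z) / q(z) with Re q >= 0. In the Cayley coordinate
  w = (tau + z)/(tau - z) the semigroup is the flow of w' = 2/q, and a boundary fixed point sigma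
  with spectral value l is a point mass -|tau - sigma|^2/(2 l) of q at sigma. Hence q is the sum of
  the kernels alpha_k (sigma_k + z)/(sigma_k - z) and a function R - p0(tau) with Re R >= 0, and G(0)
  determines R(0). The spectral value at tau is the angular limit of 2/(q w). The kernels contribute
  2 sum 1/|lambda_k| to the limit of q w, and R contributes at least 1/Re(1/R(0)) by Julia's lemma for
  1/R, with equality only if 1/R is an affine function of w.

  The passage between semigroups and generators rests on one lemma (Landau--Valiron, from Schwarz--
  Pick): if Re f >= k Re w then f/w has an angular limit at infinity, namely the infimum of
  Re f / Re w. It is applied to generators, to the maps of the semigroup and to q. Conversely the
  semigroup of an explicit q is obtained from the Koenigs function, the integral of q/2 in w.
*)

theory Submission
  imports Defs "HOL-Complex_Analysis.Complex_Analysis"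
begin

section \<open>The half-plane kernel and the Schwarz--Pick inequality\<close>

text \<open>No Herglotz measure is ever constructed. A point mass of \<open>q\<close> at a boundary
  point is handled through two equal numbers: the largest m with Re q >= m Re kernel on the disk,
  and the angular limit of q / kernel. The first form yields inequalities on the whole disk, the
  second separates masses at different points. The angular derivatives of the maps of a semigroup
  come with no regularity in t. They are identified as exponentials by the doubling rule at t / 2^n,
  since a growth bound along times tending to 0 already differentiates to a bound on the generator.
  To fill the region, two kinds of R suffice for a prescribed R(0): the constant, and B / (w - c) in
  the half-plane coordinate w. Every B >= 1 / Re (1 / R(0)) is possible, so the spectral value 2 /
  (B + 2 sum 1/|lambda_k|) runs through all positive values up to the maximum. These R make q
  rational in w, so the Koenigs function consists of a linear term and logarithms.\<close>

definition herg :: "complex \<Rightarrow> complex \<Rightarrow> complex" where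
  "herg s z = (s + z) / (s - z)"

lemma disk_ne_unit: "cmod s = 1 \<Longrightarrow> z \<in> unit_disk \<Longrightarrow> s \<noteq> z"
  by auto

lemma herg_holomorphic [holomorphic_intros]:
  assumes "cmod s = 1" shows "herg s holomorphic_on unit_disk"
  unfolding herg_def using disk_ne_unit[OF assms] by (intro holomorphic_intros) auto

lemma Re_herg: "cmod s = 1 \<Longrightarrow> Re (herg s z) = (1 - (cmod z)\<^sup>2) / (cmod (s - z))\<^sup>2"
proof -
  assume "cmod s = 1"
  then have s: "Re s * Re s + Im s * Im s = 1"
    by (metis cmod_power2 power2_eq_square power_one)
  have "Re (s + z) * Re (s - z) + Im (s + z) * Im (s - z) = 1 - (cmod z)\<^sup>2"
    using s unfolding cmod_power2 by (simp add: algebra_simps power2_eq_square)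
  then show ?thesis
    unfolding herg_def Re_divide' by simp
qed

lemma Re_herg_pos: "cmod s = 1 \<Longrightarrow> z \<in> unit_disk \<Longrightarrow> Re (herg s z) > 0"
  using disk_ne_unit[of s z] by (simp add: Re_herg abs_square_less_1)

lemma Re_herg_unit: "cmod s = 1 \<Longrightarrow> cmod z = 1 \<Longrightarrow> Re (herg s z) = 0"
  by (simp add: Re_herg)

lemma herg_0 [simp]: "cmod s = 1 \<Longrightarrow> herg s 0 = 1"
  by (auto simp: herg_def)

lemma herg_plus_1: "s \<noteq> z \<Longrightarrow> herg s z + 1 = 2 * s / (s - z)"
  by (simp add: herg_def field_simps)

lemma herg_add_cnj:
  assumes "cmod s = 1" "s \<noteq> z" "s \<noteq> a"
  shows "herg s z + cnj (herg s a) = 2 * (1 - cnj a * z) / ((s - z) * cnj (s - a))"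
proof -
  have s: "s * cnj s = 1"
    using assms(1) by (simp add: complex_norm_square[symmetric])
  have ne: "s - z \<noteq> 0" "cnj s - cnj a \<noteq> 0"
    using assms by auto
  have "(s + z) * (cnj s - cnj a) + (cnj s + cnj a) * (s - z) = 2 * (s * cnj s) - 2 * cnj a * z"
    by (simp add: algebra_simps)
  then have "(s + z) * (cnj s - cnj a) + (cnj s + cnj a) * (s - z) = 2 * (1 - cnj a * z)"
    using s by (simp add: algebra_simps)
  then show ?thesis
    using ne by (simp add: herg_def add_frac_eq)
qed

text \<open>Precomposing with the disk automorphism that moves 0 to \<open>a\<close> and
  postcomposing with the Cayley map that moves \<open>f a\<close> to 0 reduces the claim to
  Schwarz's lemma. The form without quotients survives the limit to Re f >= 0 taken in
  \<open>schwarz_pick_herg\<close>.\<close>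

lemma schwarz_pick_pos:
  assumes holf: "f holomorphic_on unit_disk" and pos: "\<And>z. z \<in> unit_disk \<Longrightarrow> Re (f z) > 0"
    and z: "z \<in> unit_disk" and a: "a \<in> unit_disk"
  shows "(1 - (cmod z)\<^sup>2) * (1 - (cmod a)\<^sup>2) * (cmod (f z + cnj (f a)))\<^sup>2
         \<le> 4 * Re (f z) * Re (f a) * (cmod (1 - cnj a * z))\<^sup>2"
proof -
  define \<psi> where "\<psi> = (\<lambda>x. (x + a) / (1 + cnj a * x))"
  define g where "g = (\<lambda>x. (f (\<psi> x) - f a) / (f (\<psi> x) + cnj (f a)))"
  have sq: "(cmod (1 + cnj u * v))\<^sup>2 - (cmod (v + u))\<^sup>2 = (1 - (cmod v)\<^sup>2) * (1 - (cmod u)\<^sup>2)" for u v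
    unfolding cmod_power2 by (simp add: power2_eq_square algebra_simps)
  have ne: "1 + cnj a * x \<noteq> 0" if "x \<in> unit_disk" for x
  proof
    assume "1 + cnj a * x = 0"
    then have "cmod (cnj a * x) = 1"
      by (metis add_eq_0_iff norm_minus_cancel norm_one)
    moreover have "cmod a * cmod x < 1"
      using a that by (simp add: mult_strict_mono' [of "cmod a" 1 "cmod x" 1, simplified])
    ultimately show False by (simp add: norm_mult)
  qed
  have \<psi>in: "\<psi> x \<in> unit_disk" if "x \<in> unit_disk" for x
  proof -
    have "(cmod (1 + cnj a * x))\<^sup>2 - (cmod (x + a))\<^sup>2 > 0"
      unfolding sq using a that by (simp add: abs_square_less_1)
    then have "cmod (x + a) < cmod (1 + cnj a * x)"
      using power_less_imp_less_base by fastforce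
    then show ?thesis
      unfolding \<psi>_def using ne[OF that] by (simp add: norm_divide divide_simps)
  qed
  have hol\<psi>: "\<psi> holomorphic_on unit_disk"
    unfolding \<psi>_def using ne by (intro holomorphic_intros) auto
  have holc: "(\<lambda>x. f (\<psi> x)) holomorphic_on unit_disk"
    using holomorphic_on_compose_gen[OF hol\<psi> holf] \<psi>in by (metis (no_types, lifting) comp_apply holomorphic_cong image_subsetI)
  have re: "Re (f (\<psi> x) + cnj (f a)) > 0" if "x \<in> unit_disk" for x
    using pos[OF \<psi>in[OF that]] pos[OF a] by simp
  have dne: "f (\<psi> x) + cnj (f a) \<noteq> 0" if "x \<in> unit_disk" for x
    using re[OF that] by (metis less_irrefl zero_complex.simps(1))
  have holg: "g holomorphic_on unit_disk"
    unfolding g_def using dne holc by (intro holomorphic_intros) auto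
  have idn: "(cmod (u + cnj v))\<^sup>2 - (cmod (u - v))\<^sup>2 = 4 * Re u * Re v" for u v
    unfolding cmod_power2 by (simp add: power2_eq_square algebra_simps)
  have gl: "cmod (g x) < 1" if "cmod x < 1" for x
  proof -
    have x: "x \<in> unit_disk" using that by simp
    have "(cmod (f (\<psi> x) + cnj (f a)))\<^sup>2 - (cmod (f (\<psi> x) - f a))\<^sup>2 > 0"
      unfolding idn using pos[OF \<psi>in[OF x]] pos[OF a] by simp
    then have "cmod (f (\<psi> x) - f a) < cmod (f (\<psi> x) + cnj (f a))"
      using power_less_imp_less_base by fastforce
    then show ?thesis
      unfolding g_def using dne[OF x] by (simp add: norm_divide divide_simps)
  qed
  have g0: "g 0 = 0" by (simp add: g_def \<psi>_def)
  define x where "x = (z - a) / (1 - cnj a * z)"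
  have nz: "1 - cnj a * z \<noteq> 0" using ne[of "-z"] z by simp
  have "(cmod (1 - cnj a * z))\<^sup>2 - (cmod (z - a))\<^sup>2 = (1 - (cmod z)\<^sup>2) * (1 - (cmod a)\<^sup>2)"
    using sq[of "-a" z] by simp
  note sq2 = this
  have "(cmod (1 - cnj a * z))\<^sup>2 - (cmod (z - a))\<^sup>2 > 0"
    unfolding sq2 using a z by (simp add: abs_square_less_1)
  then have "cmod (z - a) < cmod (1 - cnj a * z)"
    using power_less_imp_less_base by fastforce
  then have x1: "cmod x < 1"
    unfolding x_def using nz by (simp add: norm_divide divide_simps)
  have "x \<in> unit_disk" using x1 by simp
  have \<psi>x: "\<psi> x = z"
  proof -
    have "1 + cnj a * x = (1 - cnj a * a) / (1 - cnj a * z)"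
      unfolding x_def using nz by (simp add: field_simps)
    moreover have "x + a = z * (1 - cnj a * a) / (1 - cnj a * z)"
      unfolding x_def using nz by (simp add: field_simps)
    moreover have "1 - cnj a * a \<noteq> 0" using ne[of "-a"] a by simp
    ultimately show ?thesis unfolding \<psi>_def using nz by simp
  qed
  have "cmod (g x) \<le> cmod x"
    using Schwarz_Lemma(1)[OF holg g0 gl x1] .
  then have le: "cmod (f z - f a) / cmod (f z + cnj (f a)) \<le> cmod (z - a) / cmod (1 - cnj a * z)"
    unfolding g_def \<psi>x unfolding x_def by (simp add: norm_divide)
  have p1: "cmod (f z + cnj (f a)) > 0" using dne[OF \<open>x \<in> unit_disk\<close>] \<psi>x by simp
  have p2: "cmod (1 - cnj a * z) > 0" using nz by simp
  have "cmod (f z - f a) * cmod (1 - cnj a * z) \<le> cmod (z - a) * cmod (f z + cnj (f a))"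
    using le p1 p2 by (simp add: divide_simps mult.commute)
  then have "(cmod (f z - f a))\<^sup>2 * (cmod (1 - cnj a * z))\<^sup>2 \<le> (cmod (z - a))\<^sup>2 * (cmod (f z + cnj (f a)))\<^sup>2"
    by (metis power_mult_distrib power_mono mult_nonneg_nonneg norm_ge_zero)
  \<comment> \<open>The identities \<open>idn\<close> and \<open>sq2\<close> eliminate the two
    differences; the product of the two remaining squares then cancels.\<close>
  moreover have "(cmod (f z - f a))\<^sup>2 = (cmod (f z + cnj (f a)))\<^sup>2 - 4 * Re (f z) * Re (f a)"
    using idn[of "f z" "f a"] by simp
  moreover have "(cmod (z - a))\<^sup>2 = (cmod (1 - cnj a * z))\<^sup>2 - (1 - (cmod z)\<^sup>2) * (1 - (cmod a)\<^sup>2)"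
    using sq2 by simp
  ultimately show ?thesis by (simp add: algebra_simps)
qed

text \<open>\<open>herg s\<close> attains equality in Schwarz--Pick, so the disk factors can be
  expressed through it and \<open>f\<close> is compared directly with the half-plane coordinate.
  Adding a constant e > 0 and letting e tend to 0 admits boundary values of the half-plane.\<close>

lemma schwarz_pick_herg:
  assumes holf: "f holomorphic_on unit_disk" and nn: "\<And>z. z \<in> unit_disk \<Longrightarrow> Re (f z) \<ge> 0"
    and s: "cmod s = 1" and z: "z \<in> unit_disk" and a: "a \<in> unit_disk"
  shows "Re (herg s z) * Re (herg s a) * (cmod (f z + cnj (f a)))\<^sup>2
         \<le> Re (f z) * Re (f a) * (cmod (herg s z + cnj (herg s a)))\<^sup>2"
proof -
  let ?A = "(1 - (cmod z)\<^sup>2) * (1 - (cmod a)\<^sup>2)"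
  let ?B = "(cmod (1 - cnj a * z))\<^sup>2"
  let ?l = "\<lambda>e::real. ?A * (cmod ((f z + of_real e) + cnj (f a + of_real e)))\<^sup>2"
  let ?r = "\<lambda>e::real. 4 * Re (f z + of_real e) * Re (f a + of_real e) * ?B"
  have ev: "\<forall>\<^sub>F e in at_right 0. ?l e \<le> ?r e"
    using eventually_at_right_less[of 0]
  proof eventually_elim
    case (elim e)
    have h: "(\<lambda>z. f z + of_real e) holomorphic_on unit_disk"
      using holf by (intro holomorphic_intros)
    show ?case
      by (rule schwarz_pick_pos[OF h _ z a]) (use nn elim in force)
  qed
  have "(?l \<longlongrightarrow> ?l 0) (at_right 0)" "(?r \<longlongrightarrow> ?r 0) (at_right 0)"
    by (intro tendsto_intros)+
  then have "?l 0 \<le> ?r 0"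
    using ev by (intro tendsto_le[of "at_right (0::real)" ?r "?r 0" ?l "?l 0"]) auto
  then have main: "?A * (cmod (f z + cnj (f a)))\<^sup>2 \<le> 4 * Re (f z) * Re (f a) * ?B" by simp
  have nez: "s \<noteq> z" "s \<noteq> a" using disk_ne_unit[OF s] z a by auto
  let ?D = "(cmod (s - z))\<^sup>2 * (cmod (s - a))\<^sup>2"
  have D: "?D > 0" using nez by simp
  have "cnj s - cnj a = cnj (s - a)" by simp
  then have "cmod (cnj s - cnj a) = cmod (s - a)" by (metis complex_mod_cnj)
  then have "(cmod (herg s z + cnj (herg s a)))\<^sup>2 = 4 * ?B / ?D"
    using herg_add_cnj[OF s nez]
    by (simp add: norm_divide norm_mult power_divide power_mult_distrib del: right_diff_distrib_numeral)
  moreover have "Re (herg s z) * Re (herg s a) = ?A / ?D"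
    using Re_herg[OF s] by simp
  moreover have "?A * (cmod (f z + cnj (f a)))\<^sup>2 / ?D \<le> 4 * Re (f z) * Re (f a) * ?B / ?D"
    using main D by (simp add: divide_right_mono)
  ultimately show ?thesis by (simp add: mult_ac)
qed

section \<open>Angular limits\<close>

lemma eventually_in_within: "\<forall>\<^sub>F z in at s within S. z \<in> S"
  by (auto simp: eventually_at_filter)

lemma inverse_herg_tendsto:
  assumes "cmod s = 1" shows "((\<lambda>z. inverse (herg s z)) \<longlongrightarrow> 0) (at s within S)"
proof -
  have "s \<noteq> 0" using assms by auto
  then have "((\<lambda>z. (s - z) / (s + z)) \<longlongrightarrow> (s - s) / (s + s)) (at s within S)"
    by (intro tendsto_intros) auto
  then show ?thesis by (simp add: herg_def)
qed

text \<open>In the half-plane a Stolz region lies in a sector around the positive axis. This is how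
  nontangential approach enters \<open>landau_valiron\<close>.\<close>

lemma herg_stolz_bound:
  assumes s: "cmod s = 1" and z: "z \<in> stolz_region s M"
  shows "cmod (herg s z) \<le> 2 * M * Re (herg s z)"
proof -
  have z1: "cmod z < 1" and z2: "cmod (s - z) < M * (1 - cmod z)"
    using z by (auto simp: stolz_region_def)
  have ne: "cmod (s - z) > 0" using disk_ne_unit[OF s, of z] z1 by auto
  have M: "M > 0" using z1 z2 ne by (metis diff_gt_0_iff_gt order_less_trans zero_less_mult_pos2)
  have "cmod (s + z) \<le> 2" using norm_triangle_ineq[of s z] s z1 by linarith
  then have "cmod (s + z) * cmod (s - z) \<le> 2 * (M * (1 - cmod z))"
    using z2 ne by (intro mult_mono) auto
  also have "\<dots> \<le> 2 * (M * (1 - (cmod z)\<^sup>2))"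
    using M z1 by (simp add: power2_eq_square mult_left_le)
  finally have "cmod (s + z) * cmod (s - z) / (cmod (s - z))\<^sup>2 \<le> 2 * (M * (1 - (cmod z)\<^sup>2)) / (cmod (s - z))\<^sup>2"
    by (rule divide_right_mono) simp
  moreover have "cmod (herg s z) = cmod (s + z) * cmod (s - z) / (cmod (s - z))\<^sup>2"
    using ne by (simp add: herg_def norm_divide power2_eq_square)
  ultimately show ?thesis
    by (simp add: Re_herg[OF s])
qed

text \<open>The radius lies in every Stolz region with M > 1. Hence an angular limit known to exist
  can be evaluated along the radius, which is why most later limits are taken at
  \<open>at_left 1\<close>.\<close>

lemma radial_tendsto:
  assumes s: "cmod s = 1" and M: "M > 1"
  shows "filterlim (\<lambda>r. of_real r * s) (at s within stolz_region s M) (at_left (1::real))"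
proof -
  have "((\<lambda>r. of_real r * s) \<longlongrightarrow> of_real 1 * s) (at_left (1::real))"
    by (intro tendsto_intros)
  moreover have "\<forall>\<^sub>F r in at_left (1::real). of_real r * s \<in> stolz_region s M \<and> of_real r * s \<noteq> s"
    using eventually_at_left_real[of 0 1]
  proof (rule eventually_mono)
    fix r :: real assume r: "r \<in> {0<..<1}"
    have "s - of_real r * s = of_real (1 - r) * s" by (simp add: algebra_simps)
    then have "cmod (s - of_real r * s) = 1 - r"
      using r s by (simp only: norm_mult norm_of_real) auto
    then show "of_real r * s \<in> stolz_region s M \<and> of_real r * s \<noteq> s"
      using r s M by (auto simp: stolz_region_def norm_mult)
  qed simp
  ultimately show ?thesis
    by (auto simp: filterlim_at)
qed

lemma angular_limit_radial:
  assumes s: "cmod s = 1" and "angular_limit f s L"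
  shows "((\<lambda>r. f (of_real r * s)) \<longlongrightarrow> L) (at_left (1::real))"
  by (rule filterlim_compose[OF _ radial_tendsto[OF s, of 2]])
    (use assms(2) in \<open>auto simp: angular_limit_def\<close>)

lemma radial_in_disk: "cmod s = 1 \<Longrightarrow> \<forall>\<^sub>F r in at_left (1::real). of_real r * s \<in> unit_disk"
  using eventually_at_left_real[of 0 1] by (rule eventually_mono) (auto simp: norm_mult)

lemma angular_limit_unique:
  assumes "cmod s = 1" "angular_limit f s a" "angular_limit f s b"
  shows "a = b"
  using angular_limit_radial[OF assms(1,2)] angular_limit_radial[OF assms(1,3)]
  by (rule tendsto_unique[OF trivial_limit_at_left_real])

lemma angular_limit_cong:
  assumes "angular_limit f s L" "\<And>z. z \<in> unit_disk \<Longrightarrow> f z = g z"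
  shows "angular_limit g s L"
  unfolding angular_limit_def
proof (intro allI impI)
  fix M :: real assume "M > 1"
  then have "(f \<longlongrightarrow> L) (at s within stolz_region s M)"
    using assms(1) by (auto simp: angular_limit_def)
  moreover have "\<forall>\<^sub>F z in at s within stolz_region s M. f z = g z"
    using eventually_in_within by (rule eventually_mono) (auto simp: stolz_region_def intro: assms(2))
  ultimately show "(g \<longlongrightarrow> L) (at s within stolz_region s M)"
    using Lim_transform_eventually by blast
qed

text \<open>After subtracting m times the kernel the infimum of Re g / Re herg is 0. Fix a point
  \<open>a\<close> where this quotient is below \<epsilon>: Schwarz--Pick between z and
  \<open>a\<close>, together with the sector bound, controls g z by a multiple of \<epsilon> |herg s
  z| up to terms of lower order.\<close>

lemma landau_valiron:
  assumes s: "cmod s = 1" and holf: "f holomorphic_on unit_disk"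
    and k: "\<And>z. z \<in> unit_disk \<Longrightarrow> Re (f z) \<ge> k * Re (herg s z)"
  obtains m where "m \<ge> k" "\<And>z. z \<in> unit_disk \<Longrightarrow> Re (f z) \<ge> m * Re (herg s z)"
    "angular_limit (\<lambda>z. f z / herg s z) s (of_real m)"
proof -
  define R where "R = (\<lambda>z. Re (f z) / Re (herg s z)) ` unit_disk"
  define m where "m = Inf R"
  note Kpos = Re_herg_pos[OF s]
  have Rk: "x \<ge> k" if "x \<in> R" for x
    using that k Kpos by (auto simp: R_def pos_le_divide_eq)
  have Rne: "R \<noteq> {}" by (auto simp: R_def intro: exI[of _ 0])
  have bdd: "bdd_below R" using Rk by (rule bdd_belowI)
  have mk: "m \<ge> k" unfolding m_def using Rne Rk by (intro cInf_greatest) auto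
  have mle: "Re (f z) \<ge> m * Re (herg s z)" if z: "z \<in> unit_disk" for z
  proof -
    have "m \<le> Re (f z) / Re (herg s z)"
      unfolding m_def using bdd z by (intro cInf_lower) (auto simp: R_def)
    then show ?thesis using Kpos[OF z] by (simp add: pos_le_divide_eq)
  qed
  define g where "g = (\<lambda>z. f z - of_real m * herg s z)"
  have holg: "g holomorphic_on unit_disk"
    unfolding g_def using holf s by (intro holomorphic_intros)
  have gnn: "Re (g z) \<ge> 0" if "z \<in> unit_disk" for z
    using mle[OF that] by (simp add: g_def)
  have Kne: "herg s z \<noteq> 0" if "z \<in> unit_disk" for z
    using Kpos[OF that] by auto
  have "angular_limit (\<lambda>z. f z / herg s z) s (of_real m)"
    unfolding angular_limit_def
  proof (intro allI impI)
    fix M :: real assume M: "M > 1"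
    let ?F = "at s within stolz_region s M"
    let ?u = "\<lambda>z. cmod (inverse (herg s z))"
    have u0: "(?u \<longlongrightarrow> 0) ?F"
      using tendsto_norm[OF inverse_herg_tendsto[OF s]] by simp
    have "((\<lambda>z. g z / herg s z) \<longlongrightarrow> 0) ?F"
    proof (rule tendsto_0_le[where K = 1])
      show "((\<lambda>z. cmod (g z / herg s z)) \<longlongrightarrow> 0) ?F"
      proof (rule tendstoI)
        fix e :: real assume e: "e > 0"
        \<comment> \<open>The final bound \<open>?b\<close> tends to 2 M \<epsilon>, which this
          choice makes e / 2.\<close>
        define \<epsilon> where "\<epsilon> = e / (4 * M)"
        have \<epsilon>: "\<epsilon> > 0" using e M by (simp add: \<epsilon>_def)
        have "Inf R < m + \<epsilon>" using \<epsilon> by (simp add: m_def)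
        then obtain x where "x \<in> R" "x < m + \<epsilon>"
          using cInf_lessD[OF Rne] by blast
        then obtain a where a: "a \<in> unit_disk" and "Re (f a) / Re (herg s a) < m + \<epsilon>"
          by (auto simp: R_def)
        then have "Re (f a) < (m + \<epsilon>) * Re (herg s a)"
          using Kpos[OF a] by (simp add: pos_divide_less_eq)
        then have ga: "Re (g a) \<le> \<epsilon> * Re (herg s a)"
          by (simp add: g_def algebra_simps)
        let ?b = "\<lambda>z. cmod (g a) * ?u z + 2 * M * \<epsilon> * (1 + cmod (herg s a) * ?u z)\<^sup>2"
        have bd: "cmod (g z / herg s z) \<le> ?b z" if z: "z \<in> stolz_region s M" for z
        proof -
          have zd: "z \<in> unit_disk" using z by (simp add: stolz_region_def)
          let ?X = "cmod (g z + cnj (g a))"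
          let ?Y = "cmod (herg s z + cnj (herg s a))"
          have sp: "Re (herg s z) * Re (herg s a) * ?X\<^sup>2 \<le> Re (g z) * Re (g a) * ?Y\<^sup>2"
            by (rule schwarz_pick_herg[OF holg gnn s zd a])
          \<comment> \<open>Estimating Re (g z) by \<open>?X\<close> itself lets one factor
            \<open>?X\<close> cancel, so the quadratic inequality becomes linear in
            \<open>?X\<close>.\<close>
          have "Re (g z) \<le> ?X"
            using complex_Re_le_cmod[of "g z + cnj (g a)"] gnn[OF a] by simp
          then have "Re (g z) * Re (g a) * ?Y\<^sup>2 \<le> ?X * (\<epsilon> * Re (herg s a)) * ?Y\<^sup>2"
            using ga gnn[OF zd] gnn[OF a] by (intro mult_right_mono mult_mono) auto
          with sp have "Re (herg s a) * (?X * (Re (herg s z) * ?X)) \<le> Re (herg s a) * (?X * (\<epsilon> * ?Y\<^sup>2))"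
            by (simp add: power2_eq_square mult_ac)
          then have "?X * (Re (herg s z) * ?X) \<le> ?X * (\<epsilon> * ?Y\<^sup>2)"
            using Kpos[OF a] by simp
          then have X: "Re (herg s z) * ?X \<le> \<epsilon> * ?Y\<^sup>2"
            using \<epsilon> by (cases "?X = 0") auto
          have K: "cmod (herg s z) > 0" using Kne[OF zd] by simp
          have "cmod (herg s z) * ?X \<le> 2 * M * Re (herg s z) * ?X"
            by (intro mult_right_mono herg_stolz_bound[OF s z]) simp
          also have "\<dots> \<le> 2 * M * (\<epsilon> * ?Y\<^sup>2)"
            using X M by simp
          also have "\<dots> \<le> 2 * M * (\<epsilon> * (cmod (herg s z) + cmod (herg s a))\<^sup>2)"
            using norm_triangle_ineq[of "herg s z" "cnj (herg s a)"] M \<epsilon>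
            by (intro mult_left_mono power_mono) auto
          also have "cmod (herg s z) + cmod (herg s a) = cmod (herg s z) * (1 + cmod (herg s a) * ?u z)"
            using K by (simp add: norm_inverse distrib_left)
          finally have "?X \<le> 2 * M * \<epsilon> * (1 + cmod (herg s a) * ?u z)\<^sup>2 * cmod (herg s z)"
            using K by (simp add: power_mult_distrib power2_eq_square mult_ac)
          moreover have "cmod (g z) \<le> cmod (g a) + ?X"
            using norm_triangle_ineq4[of "g z + cnj (g a)" "cnj (g a)"] by simp
          ultimately have "cmod (g z) \<le> cmod (g a) + 2 * M * \<epsilon> * (1 + cmod (herg s a) * ?u z)\<^sup>2 * cmod (herg s z)"
            by simp
          then show ?thesis
            using K by (simp add: norm_divide norm_inverse field_simps)
        qed
        have "(?b \<longlongrightarrow> cmod (g a) * 0 + 2 * M * \<epsilon> * (1 + cmod (herg s a) * 0)\<^sup>2) ?F"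
          by (intro tendsto_intros u0)
        then have "(?b \<longlongrightarrow> e / 2) ?F" using M by (simp add: \<epsilon>_def)
        then have "\<forall>\<^sub>F z in ?F. ?b z < e"
          by (rule order_tendstoD(2)) (use e in simp)
        then show "\<forall>\<^sub>F z in ?F. dist (cmod (g z / herg s z)) 0 < e"
          using eventually_in_within
        proof eventually_elim
          case (elim z) then show ?case using bd[of z] by simp
        qed
      qed
    qed simp
    then have "((\<lambda>z. g z / herg s z + of_real m) \<longlongrightarrow> 0 + of_real m) ?F"
      by (intro tendsto_intros)
    moreover have "\<forall>\<^sub>F z in ?F. g z / herg s z + of_real m = f z / herg s z"
      using eventually_in_within
      by (rule eventually_mono) (use Kne in \<open>auto simp: g_def stolz_region_def divide_simps\<close>)
    ultimately show "((\<lambda>z. f z / herg s z) \<longlongrightarrow> of_real m) ?F"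
      using Lim_transform_eventually by fastforce
  qed
  with mk mle show ?thesis by (rule that)
qed

lemma herg_radial: "cmod s = 1 \<Longrightarrow> r < 1 \<Longrightarrow> herg s (of_real r * s) = of_real ((1 + r) / (1 - r))"
proof -
  assume s: "cmod s = 1" and r: "r < 1"
  have "s + of_real r * s = s * of_real (1 + r)" "s - of_real r * s = s * of_real (1 - r)"
    by (simp_all add: algebra_simps)
  then have "herg s (of_real r * s) = of_real (1 + r) / of_real (1 - r)"
    using s unfolding herg_def by (metis mult_divide_mult_cancel_left norm_zero zero_neq_one)
  then show ?thesis by simp
qed

text \<open>The kernel is real and positive on the radius, so the bound passes to the quotient. With
  \<open>landau_valiron\<close> this makes the angular limit the largest admissible
  constant.\<close>

lemma radial_limit_lower_bound:
  assumes s: "cmod s = 1" and lim: "((\<lambda>r. f (of_real r * s) / herg s (of_real r * s)) \<longlongrightarrow> of_real m) (at_left (1::real))"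
    and k: "\<And>z. z \<in> unit_disk \<Longrightarrow> Re (f z) \<ge> k * Re (herg s z)"
  shows "k \<le> m"
proof -
  have "((\<lambda>r. Re (f (of_real r * s) / herg s (of_real r * s))) \<longlongrightarrow> Re (of_real m)) (at_left (1::real))"
    by (rule tendsto_Re[OF lim])
  moreover have "\<forall>\<^sub>F r in at_left (1::real). k \<le> Re (f (of_real r * s) / herg s (of_real r * s))"
    using eventually_at_left_real[of 0 1]
  proof (rule eventually_mono)
    fix r :: real assume r: "r \<in> {0<..<1}"
    then have r1: "r < 1" and d: "of_real r * s \<in> unit_disk" using s by (auto simp: norm_mult)
    have "Re (f (of_real r * s)) \<ge> k * Re (herg s (of_real r * s))" by (rule k[OF d])
    then show "k \<le> Re (f (of_real r * s) / herg s (of_real r * s))"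
      unfolding herg_radial[OF s r1] Re_divide_of_real using r
      by (subst pos_le_divide_eq) (auto simp: herg_radial[OF s r1])
  qed simp
  ultimately show ?thesis
    using tendsto_lowerbound[OF _ _ trivial_limit_at_left_real] by fastforce
qed

section \<open>Semigroups near a boundary point\<close>

text \<open>The vector field \<open>G\<close> transported by \<open>herg s\<close> to the right half-plane, where \<open>s\<close> becomes \<open>\<infinity>\<close>.\<close>
definition herg_field :: "complex \<Rightarrow> (complex \<Rightarrow> complex) \<Rightarrow> complex \<Rightarrow> complex" where
  "herg_field s G z = 2 * s * G z / (s - z)\<^sup>2"

lemma herg_has_field_derivative:
  "s \<noteq> z \<Longrightarrow> (herg s has_field_derivative 2 * s / (s - z)\<^sup>2) (at z within A)"
  unfolding herg_def by (auto intro!: derivative_eq_intros simp: power2_eq_square field_simps)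

lemma generates_disk: "generates \<phi> G \<Longrightarrow> t \<ge> 0 \<Longrightarrow> z \<in> unit_disk \<Longrightarrow> \<phi> t z \<in> unit_disk"
  unfolding generates_def holo_semigroup_def by blast

lemma generates_zero: "generates \<phi> G \<Longrightarrow> z \<in> unit_disk \<Longrightarrow> \<phi> 0 z = z"
  unfolding generates_def holo_semigroup_def by blast

lemma generates_add:
  "generates \<phi> G \<Longrightarrow> s \<ge> 0 \<Longrightarrow> t \<ge> 0 \<Longrightarrow> z \<in> unit_disk \<Longrightarrow> \<phi> (s + t) z = \<phi> s (\<phi> t z)"
  unfolding generates_def holo_semigroup_def by blast

lemma generates_holomorphic: "generates \<phi> G \<Longrightarrow> t \<ge> 0 \<Longrightarrow> \<phi> t holomorphic_on unit_disk"
  unfolding generates_def holo_semigroup_def by blast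

lemma Re_herg_flow_derivative:
  assumes gen: "generates \<phi> G" and s: "cmod s = 1" and z: "z \<in> unit_disk" and t: "t \<ge> 0"
  shows "((\<lambda>t. Re (herg s (\<phi> t z))) has_real_derivative Re (herg_field s G (\<phi> t z))) (at t within {0..})"
proof -
  have "((\<lambda>s. \<phi> s z) has_vector_derivative G (\<phi> t z)) (at t within {0..})"
    using gen z t unfolding generates_def by blast
  moreover have "s \<noteq> \<phi> t z"
    using disk_ne_unit[OF s generates_disk[OF gen t z]] .
  then have "(herg s has_field_derivative 2 * s / (s - \<phi> t z)\<^sup>2) (at (\<phi> t z) within (\<lambda>s. \<phi> s z) ` {0..})"
    by (rule herg_has_field_derivative)
  ultimately have "((herg s \<circ> (\<lambda>s. \<phi> s z)) has_vector_derivative G (\<phi> t z) * (2 * s / (s - \<phi> t z)\<^sup>2)) (at t within {0..})"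
    by (rule field_vector_diff_chain_within)
  then show ?thesis
    using has_field_derivative_Re by (fastforce simp: o_def herg_field_def mult_ac)
qed

text \<open>Gronwall's argument with integrating factor exp (- l t).\<close>

lemma herg_flow_growth:
  assumes gen: "generates \<phi> G" and s: "cmod s = 1" and z: "z \<in> unit_disk" and t: "t \<ge> 0"
    and l: "\<And>z. z \<in> unit_disk \<Longrightarrow> Re (herg_field s G z) \<ge> l * Re (herg s z)"
  shows "Re (herg s (\<phi> t z)) \<ge> exp (l * t) * Re (herg s z)"
proof -
  define F where "F = (\<lambda>t. exp (- l * t) * Re (herg s (\<phi> t z)))"
  have D: "(F has_real_derivative exp (- l * x) * (Re (herg_field s G (\<phi> x z)) - l * Re (herg s (\<phi> x z))))
        (at x within {0..})" if "x \<ge> 0" for x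
    unfolding F_def
    by (rule derivative_eq_intros Re_herg_flow_derivative[OF gen s z that] refl)+ (simp add: algebra_simps)
  have "F 0 \<le> F t"
  proof (rule DERIV_nonneg_imp_increasing_open[OF t])
    fix x assume x: "0 < x" "x < t"
    have "at x within {0..} = at x"
      using x by (intro at_within_interior) (simp add: interior_real_atLeast)
    moreover have "exp (- l * x) * (Re (herg_field s G (\<phi> x z)) - l * Re (herg s (\<phi> x z))) \<ge> 0"
      using l[OF generates_disk[OF gen _ z]] x by simp
    ultimately show "\<exists>y. DERIV F x :> y \<and> 0 \<le> y"
      using D[of x] x by force
  next
    have "continuous_on {0..} F"
      by (rule DERIV_continuous_on, rule D) simp
    then show "continuous_on {0..t} F" by (rule continuous_on_subset) auto
  qed
  then show ?thesis
    using generates_zero[OF gen z] by (simp add: F_def exp_minus field_simps)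
qed

text \<open>The growth bound is differentiated at t = 0. It is assumed only along a sequence of
  times so that it applies to the dyadic times of \<open>boundary_fixed_point\<close>.\<close>

lemma herg_field_lower_bound:
  assumes gen: "generates \<phi> G" and s: "cmod s = 1" and z: "z \<in> unit_disk"
    and T: "T \<longlonglongrightarrow> 0" "\<And>n::nat. T n > 0"
    and g: "\<And>n. Re (herg s (\<phi> (T n) z)) \<ge> exp (l * T n) * Re (herg s z)"
  shows "Re (herg_field s G z) \<ge> l * Re (herg s z)"
proof -
  have lim0: "filterlim T (at 0 within {0..}) sequentially"
  proof -
    have "T n \<noteq> 0 \<and> T n \<ge> 0" for n using T(2)[of n] by simp
    then show ?thesis using T(1) by (simp add: filterlim_at)
  qed
  have "((\<lambda>t. Re (herg s (\<phi> t z))) has_real_derivative Re (herg_field s G z)) (at 0 within {0..})"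
    using Re_herg_flow_derivative[OF gen s z order_refl] generates_zero[OF gen z] by simp
  then have "((\<lambda>t. (Re (herg s (\<phi> t z)) - Re (herg s z)) / t) \<longlongrightarrow> Re (herg_field s G z)) (at 0 within {0..})"
    using generates_zero[OF gen z] by (simp add: has_field_derivative_iff)
  then have 1: "(\<lambda>n. (Re (herg s (\<phi> (T n) z)) - Re (herg s z)) / T n) \<longlonglongrightarrow> Re (herg_field s G z)"
    by (rule filterlim_compose[OF _ lim0])
  have "((\<lambda>t. exp (l * t) * Re (herg s z)) has_real_derivative l * Re (herg s z)) (at 0 within {0..})"
    by (rule derivative_eq_intros refl)+ simp
  then have "((\<lambda>t. (exp (l * t) * Re (herg s z) - Re (herg s z)) / t) \<longlongrightarrow> l * Re (herg s z)) (at 0 within {0..})"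
    by (simp add: has_field_derivative_iff)
  then have 2: "(\<lambda>n. (exp (l * T n) * Re (herg s z) - Re (herg s z)) / T n) \<longlonglongrightarrow> l * Re (herg s z)"
    by (rule filterlim_compose[OF _ lim0])
  show ?thesis
  proof (rule LIMSEQ_le[OF 2 1], intro exI allI impI)
    fix n show "(exp (l * T n) * Re (herg s z) - Re (herg s z)) / T n
        \<le> (Re (herg s (\<phi> (T n) z)) - Re (herg s z)) / T n"
      using g[of n] T(2)[of n] by (intro divide_right_mono) auto
  qed
qed

text \<open>Julia--Caratheodory in the half-plane; a positive c is the reciprocal of the angular
  derivative of \<open>\<phi> t\<close> at s, by
  \<open>angular_limit_herg_quotient_iff\<close>.\<close>

lemma herg_flow_angular:
  assumes gen: "generates \<phi> G" and s: "cmod s = 1" and t: "t \<ge> 0"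
    and k: "\<And>z. z \<in> unit_disk \<Longrightarrow> Re (herg s (\<phi> t z)) \<ge> k * Re (herg s z)"
  obtains c where "c \<ge> k" "\<And>z. z \<in> unit_disk \<Longrightarrow> Re (herg s (\<phi> t z)) \<ge> c * Re (herg s z)"
    "angular_limit (\<lambda>z. herg s (\<phi> t z) / herg s z) s (of_real c)"
proof -
  have "herg s holomorphic_on \<phi> t ` unit_disk"
    using generates_disk[OF gen t] by (intro holomorphic_on_subset[OF herg_holomorphic[OF s]]) auto
  then have "(herg s \<circ> \<phi> t) holomorphic_on unit_disk"
    by (rule holomorphic_on_compose[OF generates_holomorphic[OF gen t]])
  then have "(\<lambda>z. herg s (\<phi> t z)) holomorphic_on unit_disk" by (simp add: o_def)
  from landau_valiron[OF s this k] that show ?thesis by blast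
qed

text \<open>By \<open>herg_plus_1\<close> the difference quotient is (herg s z + 1) / (herg s (g z)
  + 1), and the summands 1 are negligible against \<open>herg s z\<close>, which tends to infinity
  at s.\<close>

lemma angular_limit_herg_quotient_iff:
  assumes s: "cmod s = 1" and c: "c \<noteq> 0" and g: "\<And>z. z \<in> unit_disk \<Longrightarrow> g z \<in> unit_disk"
  shows "angular_limit (\<lambda>z. herg s (g z) / herg s z) s c
     \<longleftrightarrow> angular_limit (\<lambda>z. (g z - s) / (z - s)) s (inverse c)"
proof -
  let ?u = "\<lambda>z. inverse (herg s z)"
  have Kne: "herg s z \<noteq> 0" if "z \<in> unit_disk" for z
    using Re_herg_pos[OF s that] by auto
  have q: "(g z - s) / (z - s) = (herg s z + 1) / (herg s (g z) + 1)" if z: "z \<in> unit_disk" for z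
  proof -
    have "s \<noteq> z" "s \<noteq> g z" "s \<noteq> 0" using disk_ne_unit[OF s] z g s by auto
    then have "(herg s z + 1) / (herg s (g z) + 1) = (s - g z) / (s - z)"
      by (simp add: herg_plus_1)
    then show ?thesis by (metis minus_diff_eq minus_divide_divide)
  qed
  have "((\<lambda>z. herg s (g z) / herg s z) \<longlongrightarrow> c) F \<longleftrightarrow> ((\<lambda>z. (g z - s) / (z - s)) \<longlongrightarrow> inverse c) F"
    if F: "F = at s within stolz_region s M" for F M
  proof
    have u: "(?u \<longlongrightarrow> 0) F" unfolding F by (rule inverse_herg_tendsto[OF s])
    have ev: "\<forall>\<^sub>F z in F. z \<in> unit_disk"
      unfolding F by (rule eventually_mono[OF eventually_in_within]) (auto simp: stolz_region_def)
    {
      assume "((\<lambda>z. herg s (g z) / herg s z) \<longlongrightarrow> c) F"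
      then have "((\<lambda>z. (1 + ?u z) / (herg s (g z) / herg s z + ?u z)) \<longlongrightarrow> (1 + 0) / (c + 0)) F"
        using c by (intro tendsto_intros u) auto
      moreover have "\<forall>\<^sub>F z in F. (1 + ?u z) / (herg s (g z) / herg s z + ?u z) = (g z - s) / (z - s)"
        using ev
      proof eventually_elim
        case (elim z)
        show ?case unfolding q[OF elim] using Kne[OF elim] by (simp add: divide_simps)
      qed
      ultimately show "((\<lambda>z. (g z - s) / (z - s)) \<longlongrightarrow> inverse c) F"
        using Lim_transform_eventually by (fastforce simp: divide_inverse)
    }
    {
      assume "((\<lambda>z. (g z - s) / (z - s)) \<longlongrightarrow> inverse c) F"
      then have "((\<lambda>z. (1 + ?u z) * inverse ((g z - s) / (z - s)) - ?u z) \<longlongrightarrow> (1 + 0) * inverse (inverse c) - 0) F"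
        using c by (intro tendsto_intros u) auto
      moreover have "\<forall>\<^sub>F z in F. (1 + ?u z) * inverse ((g z - s) / (z - s)) - ?u z = herg s (g z) / herg s z"
        using ev
      proof eventually_elim
        case (elim z)
        have "Re (herg s z + 1) > 0"
          using Re_herg_pos[OF s elim] by simp
        then have "herg s z + 1 \<noteq> 0" by (metis less_irrefl zero_complex.simps(1))
        then show ?case unfolding q[OF elim] using Kne[OF elim] by (simp add: divide_simps)
      qed
      ultimately show "((\<lambda>z. herg s (g z) / herg s z) \<longlongrightarrow> c) F"
        using Lim_transform_eventually by fastforce
    }
  qed
  then show ?thesis unfolding angular_limit_def by blast
qed

lemma angular_limit_fixed_point:
  assumes s: "cmod s = 1" and lim: "angular_limit (\<lambda>z. (g z - s) / (z - s)) s c"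
  shows "angular_limit g s s"
  unfolding angular_limit_def
proof (intro allI impI)
  fix M :: real assume "M > 1"
  let ?F = "at s within stolz_region s M"
  have "((\<lambda>z. (g z - s) / (z - s)) \<longlongrightarrow> c) ?F"
    using lim \<open>M > 1\<close> by (auto simp: angular_limit_def)
  then have "((\<lambda>z. (g z - s) / (z - s) * (z - s) + s) \<longlongrightarrow> c * (s - s) + s) ?F"
    by (intro tendsto_intros)
  moreover have "\<forall>\<^sub>F z in ?F. (g z - s) / (z - s) * (z - s) + s = g z"
    using eventually_in_within
    by (rule eventually_mono) (use disk_ne_unit[OF s] in \<open>auto simp: stolz_region_def s\<close>)
  ultimately show "(g \<longlongrightarrow> s) ?F"
    using Lim_transform_eventually by fastforce
qed

text \<open>The angular derivative exp (- l t) identifies the Julia constant of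
  \<open>\<phi> t\<close> as exp (l t); the resulting bounds, differentiated at t = 0, pass to the
  generator.\<close>

lemma brfp_herg_field_bound:
  assumes gen: "generates \<phi> G" and b: "brfp \<phi> s l" and z: "z \<in> unit_disk"
  shows "Re (herg_field s G z) \<ge> l * Re (herg s z)"
proof -
  have s: "cmod s = 1" using b by (simp add: brfp_def)
  have bound: "Re (herg s (\<phi> t z)) \<ge> exp (l * t) * Re (herg s z)" if t: "t \<ge> 0" for t
  proof -
    note d = generates_disk[OF gen t]
    obtain c where c: "\<And>z. z \<in> unit_disk \<Longrightarrow> Re (herg s (\<phi> t z)) \<ge> c * Re (herg s z)"
      and lim: "angular_limit (\<lambda>z. herg s (\<phi> t z) / herg s z) s (of_real c)"
      using herg_flow_angular[OF gen s t, of 0] Re_herg_pos[OF s d] by (metis mult_zero_left less_imp_le)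
    have "angular_limit (\<lambda>z. (\<phi> t z - s) / (z - s)) s (complex_of_real (exp (- l * t)))"
      using b t by (auto simp: brfp_def)
    moreover have "complex_of_real (exp (- l * t)) = inverse (complex_of_real (exp (l * t)))"
      by (simp add: exp_minus)
    ultimately have "angular_limit (\<lambda>z. herg s (\<phi> t z) / herg s z) s (complex_of_real (exp (l * t)))"
      by (subst angular_limit_herg_quotient_iff[OF s _ d]) auto
    then have "complex_of_real c = of_real (exp (l * t))"
      by (rule angular_limit_unique[OF s lim])
    then have "c = exp (l * t)" by (simp only: of_real_eq_iff)
    then show ?thesis using c[OF z] by simp
  qed
  show ?thesis
    by (rule herg_field_lower_bound[OF gen s z LIMSEQ_inverse_real_of_nat]) (auto intro: bound)
qed

text \<open>Local converse of \<open>herg_stolz_bound\<close>: a sector leads back to a Stolz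
  region. Nearness to s keeps |s + w| >= 1, so that |herg s w| is at least 1 / |s - w|.\<close>

lemma in_stolz_region:
  assumes s: "cmod s = 1" and w: "w \<in> unit_disk" and near: "cmod (s - w) < 1"
    and \<delta>: "\<delta> > 0" "Re (herg s w) \<ge> \<delta> * cmod (herg s w)"
  shows "w \<in> stolz_region s (2 / \<delta> + 1)"
proof -
  have w1: "cmod w < 1" using w by simp
  have p: "cmod (s - w) > 0" using disk_ne_unit[OF s w] by simp
  have "s + w = 2 * s - (s - w)" by simp
  then have "cmod (s + w) \<ge> cmod (2 * s) - cmod (s - w)"
    using norm_triangle_ineq2[of "2 * s" "s - w"] by metis
  then have "cmod (s + w) \<ge> 1" using near s by (simp add: norm_mult)
  then have "\<delta> * cmod (s - w) \<le> \<delta> * (cmod (s + w) * cmod (s - w))"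
    using \<delta>(1) p by simp
  also have "\<dots> = \<delta> * cmod (herg s w) * (cmod (s - w))\<^sup>2"
    using p by (simp add: herg_def norm_divide power2_eq_square)
  also have "\<dots> \<le> Re (herg s w) * (cmod (s - w))\<^sup>2"
    using \<delta>(2) by (rule mult_right_mono) simp
  also have "\<dots> = 1 - (cmod w)\<^sup>2"
    using p by (simp add: Re_herg[OF s])
  also have "\<dots> = (1 - cmod w) * (1 + cmod w)"
    by (simp add: power2_eq_square algebra_simps)
  also have "\<dots> \<le> (1 - cmod w) * 2"
    using w1 by (intro mult_left_mono) auto
  finally have "cmod (s - w) \<le> 2 / \<delta> * (1 - cmod w)"
    using \<delta>(1) by (simp add: field_simps)
  also have "\<dots> < (2 / \<delta> + 1) * (1 - cmod w)"
    using w1 by (simp add: algebra_simps)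
  finally show ?thesis using w1 by (simp add: stolz_region_def)
qed

text \<open>The orbit \<open>\<phi> t (r s)\<close> of a radius stays in a Stolz region, so the chain rule for angular
  derivatives applies.\<close>
lemma angular_derivative_double:
  assumes gen: "generates \<phi> G" and s: "cmod s = 1" and t: "t \<ge> 0" and c: "c > 0"
    and bound: "\<And>z. z \<in> unit_disk \<Longrightarrow> Re (herg s (\<phi> t z)) \<ge> c * Re (herg s z)"
    and lim: "angular_limit (\<lambda>z. herg s (\<phi> t z) / herg s z) s (of_real c)"
    and lim2: "angular_limit (\<lambda>z. herg s (\<phi> (2 * t) z) / herg s z) s (of_real d)"
  shows "d = c\<^sup>2"
proof -
  let ?F = "at_left (1::real)"
  let ?p = "\<lambda>r. of_real r * s"
  let ?w = "\<lambda>r. \<phi> t (of_real r * s)"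
  note dsk = generates_disk[OF gen t]
  \<comment> \<open>At the image of a radial point p, the Julia bound gives Re >= c herg s p, and
    the limit eventually gives modulus below (c + 1) herg s p; the image therefore lies in the
    sector of ratio c / (c + 1).\<close>
  define \<delta> where "\<delta> = c / (c + 1)"
  have \<delta>: "\<delta> > 0" using c by (simp add: \<delta>_def)
  have L1: "((\<lambda>r. herg s (?w r) / herg s (?p r)) \<longlongrightarrow> of_real c) ?F"
    by (rule angular_limit_radial[OF s lim])
  have "angular_limit (\<lambda>z. (\<phi> t z - s) / (z - s)) s (inverse (of_real c))"
    using lim c by (subst angular_limit_herg_quotient_iff[OF s _ dsk, symmetric]) auto
  then have fx: "angular_limit (\<phi> t) s s"
    by (rule angular_limit_fixed_point[OF s])
  have wlim: "(?w \<longlongrightarrow> s) ?F" by (rule angular_limit_radial[OF s fx])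
  have "((\<lambda>r. cmod (herg s (?w r) / herg s (?p r))) \<longlongrightarrow> cmod (of_real c)) ?F"
    by (intro tendsto_intros L1)
  then have ev1: "\<forall>\<^sub>F r in ?F. cmod (herg s (?w r) / herg s (?p r)) < c + 1"
    by (rule order_tendstoD(2)) (use c in simp)
  have ev2: "\<forall>\<^sub>F r in ?F. cmod (s - ?w r) < 1"
    using tendstoD[OF wlim, of 1] by (simp add: dist_norm norm_minus_commute)
  have ev3: "\<forall>\<^sub>F r in ?F. r \<in> {0<..<1::real}"
    by (rule eventually_at_left_real) simp
  have "\<forall>\<^sub>F r in ?F. ?w r \<in> stolz_region s (2 / \<delta> + 1)"
    using ev1 ev2 ev3
  proof eventually_elim
    case (elim r)
    then have pd: "?p r \<in> unit_disk" and r: "r < 1" using s by (auto simp: norm_mult)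
    have K: "herg s (?p r) = of_real ((1 + r) / (1 - r))" by (rule herg_radial[OF s r])
    have Kp: "(1 + r) / (1 - r) > 0" using elim by simp
    have "cmod (herg s (?w r)) < (c + 1) * ((1 + r) / (1 - r))"
      using elim(1) unfolding K norm_divide norm_of_real abs_of_pos[OF Kp] pos_divide_less_eq[OF Kp] .
    then have "\<delta> * cmod (herg s (?w r)) \<le> \<delta> * ((c + 1) * ((1 + r) / (1 - r)))"
      using \<delta> by (intro mult_left_mono) auto
    also have "\<dots> = c * ((1 + r) / (1 - r))" using c by (simp add: \<delta>_def)
    also have "\<dots> \<le> Re (herg s (?w r))" using bound[OF pd] unfolding K by simp
    finally show ?case
      by (intro in_stolz_region[OF s dsk[OF pd] elim(2) \<delta>])
  qed
  moreover have "\<forall>\<^sub>F r in ?F. ?w r \<noteq> s"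
    using radial_in_disk[OF s]
  proof (rule eventually_mono)
    fix r assume "of_real r * s \<in> unit_disk"
    from disk_ne_unit[OF s dsk[OF this]] show "?w r \<noteq> s" by simp
  qed
  ultimately have "filterlim ?w (at s within stolz_region s (2 / \<delta> + 1)) ?F"
    using wlim by (auto simp: filterlim_at eventually_conj_iff)
  moreover have "2 / \<delta> + 1 > 1" using \<delta> by simp
  then have "((\<lambda>z. herg s (\<phi> t z) / herg s z) \<longlongrightarrow> of_real c) (at s within stolz_region s (2 / \<delta> + 1))"
    using lim unfolding angular_limit_def by blast
  ultimately have "((\<lambda>r. herg s (\<phi> t (?w r)) / herg s (?w r)) \<longlongrightarrow> of_real c) ?F"
    by (rule filterlim_compose[rotated])
  then have "((\<lambda>r. herg s (\<phi> t (?w r)) / herg s (?w r) * (herg s (?w r) / herg s (?p r))) \<longlongrightarrow> of_real c * of_real c) ?F"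
    by (intro tendsto_intros L1)
  moreover have "\<forall>\<^sub>F r in ?F. herg s (\<phi> t (?w r)) / herg s (?w r) * (herg s (?w r) / herg s (?p r))
      = herg s (\<phi> (2 * t) (?p r)) / herg s (?p r)"
    using radial_in_disk[OF s]
  proof eventually_elim
    case (elim r)
    have "herg s (?w r) \<noteq> 0" using Re_herg_pos[OF s dsk[OF elim]] by auto
    moreover have "\<phi> (2 * t) (?p r) = \<phi> t (?w r)"
      using generates_add[OF gen t t elim] unfolding mult_2 .
    ultimately show ?case by simp
  qed
  ultimately have "((\<lambda>r. herg s (\<phi> (2 * t) (?p r)) / herg s (?p r)) \<longlongrightarrow> of_real c * of_real c) ?F"
    by (rule Lim_transform_eventually)
  from tendsto_unique[OF trivial_limit_at_left_real this angular_limit_radial[OF s lim2]]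
  have "complex_of_real (c * c) = of_real d" by simp
  then show ?thesis by (simp only: of_real_eq_iff power2_eq_square)
qed

text \<open>The Julia constant c t of \<open>\<phi> t\<close> is at least exp (l t) by Gronwall.
  Conversely doubling gives c (t / 2^n) = exp (b t / 2^n) with b = ln (c t) / t; differentiating
  along these times bounds the field by b, and b <= l because l is the largest such constant. This
  argument takes the place of continuity of c.\<close>

lemma boundary_fixed_point:
  assumes gen: "generates \<phi> G" and s: "cmod s = 1"
    and k: "\<And>z. z \<in> unit_disk \<Longrightarrow> Re (herg_field s G z) \<ge> k * Re (herg s z)"
  obtains l where "l \<ge> k" "\<And>z. z \<in> unit_disk \<Longrightarrow> Re (herg_field s G z) \<ge> l * Re (herg s z)"
    "angular_limit (\<lambda>z. herg_field s G z / herg s z) s (of_real l)" "brfp \<phi> s l"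
proof -
  have holG: "G holomorphic_on unit_disk" using gen by (simp add: generates_def)
  have "herg_field s G holomorphic_on unit_disk"
    unfolding herg_field_def using disk_ne_unit[OF s] holG by (intro holomorphic_intros) auto
  then obtain l where l: "l \<ge> k" "\<And>z. z \<in> unit_disk \<Longrightarrow> Re (herg_field s G z) \<ge> l * Re (herg s z)"
    and llim: "angular_limit (\<lambda>z. herg_field s G z / herg s z) s (of_real l)"
    using landau_valiron[OF s _ k] by blast
  define P where "P t c \<longleftrightarrow> c \<ge> exp (l * t) \<and> (\<forall>z\<in>unit_disk. Re (herg s (\<phi> t z)) \<ge> c * Re (herg s z)) \<and>
      angular_limit (\<lambda>z. herg s (\<phi> t z) / herg s z) s (of_real c)" for t c
  have "\<exists>c. P t c" if t: "t \<ge> 0" for t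
  proof -
    obtain c where "c \<ge> exp (l * t)" "\<And>z. z \<in> unit_disk \<Longrightarrow> Re (herg s (\<phi> t z)) \<ge> c * Re (herg s z)"
      "angular_limit (\<lambda>z. herg s (\<phi> t z) / herg s z) s (of_real c)"
      using herg_flow_angular[OF gen s t herg_flow_growth[OF gen s _ t l(2)]] by blast
    then show ?thesis unfolding P_def by blast
  qed
  then obtain c where c: "\<And>t. t \<ge> 0 \<Longrightarrow> P t (c t)"
    by metis
  have cge: "c t \<ge> exp (l * t)"
    and cl: "angular_limit (\<lambda>z. herg s (\<phi> t z) / herg s z) s (of_real (c t))" if "t \<ge> 0" for t
    using c[OF that] by (auto simp: P_def)
  have cb: "Re (herg s (\<phi> t z)) \<ge> c t * Re (herg s z)" if "t \<ge> 0" "z \<in> unit_disk" for t z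
    using c[OF that(1)] that(2) by (auto simp: P_def)
  have cpos: "c t > 0" if "t \<ge> 0" for t
    using cge[OF that] exp_gt_zero[of "l * t"] by linarith
  have dbl: "c (2 * t) = (c t)\<^sup>2" if "t \<ge> 0" for t
    using that by (intro angular_derivative_double[OF gen s _ cpos cb cl cl]) auto
  have cexp: "c t = exp (l * t)" if t: "t \<ge> 0" for t
  proof (cases "t = 0")
    case True
    have "c 0 = (c 0)\<^sup>2" using dbl[of 0] by simp
    then have "c 0 = 1" using cpos[of 0] by (simp add: power2_eq_square)
    then show ?thesis using True by simp
  next
    case False
    then have t: "t > 0" using t by simp
    define b where "b = ln (c t) / t"
    define T where "T = (\<lambda>n. t / 2 ^ n :: real)"
    have T0: "T n > 0" for n using t by (simp add: T_def)
    have Tc: "ln (c (T n)) = b * T n" for n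
    proof (induction n)
      case 0 then show ?case using t by (simp add: T_def b_def)
    next
      case (Suc n)
      have "T n = 2 * T (Suc n)" by (simp add: T_def)
      then have "c (T n) = (c (T (Suc n)))\<^sup>2" using dbl T0 by (simp add: less_imp_le)
      then have "ln (c (T n)) = 2 * ln (c (T (Suc n)))"
        using cpos[of "T (Suc n)"] T0[of "Suc n"] by (simp add: ln_realpow)
      then show ?case using Suc \<open>T n = 2 * T (Suc n)\<close> by simp
    qed
    have Te: "c (T n) = exp (b * T n)" for n
      using Tc[of n] cpos[of "T n"] T0[of n] by (metis exp_ln less_imp_le)
    have Tlim: "T \<longlonglongrightarrow> 0"
      unfolding T_def using LIMSEQ_divide_realpow_zero[of 2 t] by simp
    have "Re (herg_field s G z) \<ge> b * Re (herg s z)" if z: "z \<in> unit_disk" for z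
      by (rule herg_field_lower_bound[OF gen s z Tlim T0])
         (use cb[OF less_imp_le[OF T0] z] in \<open>simp add: Te\<close>)
    then have "b \<le> l"
      by (rule radial_limit_lower_bound[OF s angular_limit_radial[OF s llim]])
    then have "ln (c t) \<le> l * t" using t by (simp add: b_def divide_le_eq)
    then have "c t \<le> exp (l * t)" using cpos[of t] t by (metis exp_le_cancel_iff exp_ln less_imp_le)
    then show ?thesis using cge[of t] t by simp
  qed
  have "brfp \<phi> s l"
    unfolding brfp_def
  proof (intro conjI allI impI s)
    fix t :: real assume t: "t \<ge> 0"
    have "complex_of_real (exp (- l * t)) = inverse (complex_of_real (exp (l * t)))"
      by (simp add: exp_minus)
    moreover have "angular_limit (\<lambda>z. (\<phi> t z - s) / (z - s)) s (inverse (complex_of_real (exp (l * t))))"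
      using cl[OF t] cexp[OF t] angular_limit_herg_quotient_iff[OF s _ generates_disk[OF gen t]] by simp
    ultimately show *: "angular_limit (\<lambda>z. (\<phi> t z - s) / (z - s)) s (complex_of_real (exp (- l * t)))"
      by simp
    show "angular_limit (\<phi> t) s s" by (rule angular_limit_fixed_point[OF s *])
  qed
  with l llim show ?thesis by (rule that)
qed

text \<open>The description in \<open>spectral_value\<close> ranges over all semigroups generated by
  G. The multiplier is therefore computed from G alone, for each of them at once, and the values at
  t = 1 already determine the exponent.\<close>

lemma spectral_value_eqI:
  assumes gen: "generates \<phi> G" and s: "cmod s = 1"
    and k: "\<And>z. z \<in> unit_disk \<Longrightarrow> Re (herg_field s G z) \<ge> k * Re (herg s z)"
    and lim: "((\<lambda>r. herg_field s G (of_real r * s) / herg s (of_real r * s)) \<longlongrightarrow> of_real l) (at_left (1::real))"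
  shows "spectral_value s G = l"
  unfolding spectral_value_def
proof (rule the_equality)
  have bl: "brfp \<psi> s l" if g: "generates \<psi> G" for \<psi>
  proof -
    obtain m where m: "angular_limit (\<lambda>z. herg_field s G z / herg s z) s (of_real m)" "brfp \<psi> s m"
      using boundary_fixed_point[OF g s k] by blast
    have "complex_of_real m = of_real l"
      by (rule tendsto_unique[OF trivial_limit_at_left_real angular_limit_radial[OF s m(1)] lim])
    then show ?thesis using m by simp
  qed
  show "\<exists>\<phi>. generates \<phi> G \<and> (\<forall>t\<ge>0. angular_limit (\<lambda>z. (\<phi> t z - s) / (z - s)) s (complex_of_real (exp (- l * t))))"
    using bl[OF gen] gen by (auto simp: brfp_def)
  fix \<omega> assume "\<exists>\<phi>. generates \<phi> G \<and> (\<forall>t\<ge>0. angular_limit (\<lambda>z. (\<phi> t z - s) / (z - s)) s (complex_of_real (exp (- \<omega> * t))))"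
  then obtain \<psi> where \<psi>: "generates \<psi> G"
    "\<forall>t\<ge>0. angular_limit (\<lambda>z. (\<psi> t z - s) / (z - s)) s (complex_of_real (exp (- \<omega> * t)))" by blast
  have "angular_limit (\<lambda>z. (\<psi> 1 z - s) / (z - s)) s (complex_of_real (exp (- \<omega> * 1)))"
    using \<psi>(2) zero_le_one by blast
  moreover have "angular_limit (\<lambda>z. (\<psi> 1 z - s) / (z - s)) s (complex_of_real (exp (- l * 1)))"
    using bl[OF \<psi>(1)] zero_le_one unfolding brfp_def by blast
  ultimately have "complex_of_real (exp (- \<omega> * 1)) = complex_of_real (exp (- l * 1))"
    by (rule angular_limit_unique[OF s])
  then show "\<omega> = l" by (simp only: of_real_eq_iff exp_inj_iff)
qed

lemma generates_identity:
  assumes "\<And>z. z \<in> unit_disk \<Longrightarrow> G z = 0"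
  shows "generates (\<lambda>t z. z) G"
proof -
  have "G holomorphic_on unit_disk"
    by (rule holomorphic_transform[of "\<lambda>_. 0"]) (use assms in auto)
  then show ?thesis
    using assms by (auto simp: generates_def holo_semigroup_def)
qed

lemma brfp_identity: "cmod s = 1 \<Longrightarrow> brfp (\<lambda>t z. z) s 0"
proof -
  assume s: "cmod s = 1"
  have "angular_limit (\<lambda>z. (z - s) / (z - s)) s 1"
  proof (rule angular_limit_cong)
    show "angular_limit (\<lambda>z. 1) s 1" by (simp add: angular_limit_def)
    show "1 = (z - s) / (z - s)" if "z \<in> unit_disk" for z using disk_ne_unit[OF s that] by simp
  qed
  then show ?thesis using s angular_limit_fixed_point by (auto simp: brfp_def)
qed

section \<open>Wolff's lemma and point masses\<close>

text \<open>Wolff's lemma: with \<open>w\<^sub>n\<close> the orbit of \<open>0\<close> in the half-plane, \<open>Re (1 / w\<^sub>n)\<close> tends to \<open>0\<close>,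
  whereas Schwarz--Pick would make it eventually nondecreasing if the horodisc condition failed.\<close>
lemma dw_point_horodisc:
  assumes gen: "generates \<phi> G" and dw: "dw_point \<phi> \<tau>" and t: "t \<ge> 0" and z: "z \<in> unit_disk"
  shows "Re (herg \<tau> (\<phi> t z)) \<ge> Re (herg \<tau> z)"
proof (cases "t = 0")
  case True then show ?thesis using generates_zero[OF gen z] by simp
next
  case False
  then have t: "t > 0" using t by simp
  then have t0: "t \<ge> 0" by simp
  have s: "cmod \<tau> = 1" using dw by (simp add: dw_point_def)
  have zero: "0 \<in> unit_disk" by simp
  define a where "a n = \<phi> (real n * t) 0" for n
  have ad: "a n \<in> unit_disk" for n unfolding a_def using generates_disk[OF gen _ zero] t by simp
  have aS: "\<phi> t (a n) = a (Suc n)" for n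
  proof -
    have "real (Suc n) * t = t + real n * t" by (simp add: algebra_simps)
    then show ?thesis unfolding a_def using generates_add[OF gen t0 _ zero, of "real n * t"] t0 by simp
  qed
  have "filterlim (\<lambda>n. real n * t) at_top sequentially"
    using t by (intro filterlim_tendsto_pos_mult_at_top filterlim_real_sequentially tendsto_const
        filterlim_at_top_mult_tendsto_pos) auto
  moreover have "((\<lambda>t. \<phi> t 0) \<longlongrightarrow> \<tau>) at_top" using dw zero by (auto simp: dw_point_def)
  ultimately have "a \<longlonglongrightarrow> \<tau>" unfolding a_def by (rule filterlim_compose[rotated])
  moreover have "a n \<noteq> \<tau>" for n using disk_ne_unit[OF s ad, of n] by simp
  ultimately have "filterlim a (at \<tau>) sequentially" by (simp add: filterlim_at)
  define w where "w n = herg \<tau> (a n)" for n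
  have winv: "(\<lambda>n. inverse (w n)) \<longlonglongrightarrow> 0"
    unfolding w_def by (rule filterlim_compose[OF inverse_herg_tendsto[OF s] \<open>filterlim a (at \<tau>) sequentially\<close>])
  have Rew: "Re (w n) > 0" for n unfolding w_def by (rule Re_herg_pos[OF s ad])
  then have w0: "w n \<noteq> 0" for n by (metis less_irrefl zero_complex.simps(1))
  \<comment> \<open>This is Re (1 / w n), the coordinate in which convergence to \<tau> becomes
    convergence to 0.\<close>
  define b where "b n = Re (w n) / (cmod (w n))\<^sup>2" for n
  have bpos: "b n > 0" for n using Rew w0 by (simp add: b_def)
  have "b = (\<lambda>n. Re (inverse (w n)))" by (simp add: b_def[abs_def] cmod_power2)
  then have blim: "b \<longlonglongrightarrow> 0"
    using tendsto_Re[OF winv] by simp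
  define f where "f = (\<lambda>z. herg \<tau> (\<phi> t z))"
  have fpos: "Re (f z) > 0" if "z \<in> unit_disk" for z
    unfolding f_def by (rule Re_herg_pos[OF s generates_disk[OF gen t0 that]])
  have holf: "f holomorphic_on unit_disk"
  proof -
    have "(herg \<tau> \<circ> \<phi> t) holomorphic_on unit_disk"
      by (rule holomorphic_on_compose_gen[OF generates_holomorphic[OF gen t0] herg_holomorphic[OF s]])
        (use generates_disk[OF gen t0] in blast)
    then show ?thesis by (simp add: f_def o_def)
  qed
  have Kz: "Re (herg \<tau> z) > 0" by (rule Re_herg_pos[OF s z])
  show ?thesis
  proof (rule ccontr)
    assume "\<not> ?thesis"
    then have lt: "Re (f z) < Re (herg \<tau> z)" by (simp add: f_def)
    have sp: "Re (herg \<tau> z) * b n * (cmod (f z + cnj (w (Suc n))) / cmod (w (Suc n)))\<^sup>2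
        \<le> Re (f z) * b (Suc n) * (cmod (herg \<tau> z + cnj (w n)) / cmod (w n))\<^sup>2" for n
    proof -
      have "f (a n) = w (Suc n)" by (simp add: f_def w_def aS)
      then have "Re (herg \<tau> z) * Re (w n) * (cmod (f z + cnj (w (Suc n))))\<^sup>2
         \<le> Re (f z) * Re (w (Suc n)) * (cmod (herg \<tau> z + cnj (w n)))\<^sup>2"
        using schwarz_pick_herg[OF holf less_imp_le[OF fpos] s z ad[of n]] by (simp add: w_def)
      then have "Re (herg \<tau> z) * Re (w n) * (cmod (f z + cnj (w (Suc n))))\<^sup>2 / ((cmod (w n))\<^sup>2 * (cmod (w (Suc n)))\<^sup>2)
         \<le> Re (f z) * Re (w (Suc n)) * (cmod (herg \<tau> z + cnj (w n)))\<^sup>2 / ((cmod (w n))\<^sup>2 * (cmod (w (Suc n)))\<^sup>2)"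
        by (rule divide_right_mono) simp
      then show ?thesis by (simp add: b_def power_divide mult_ac)
    qed
    have q1: "(\<lambda>n. (cmod (u + cnj (w n)) / cmod (w n))\<^sup>2) \<longlonglongrightarrow> 1" for u
    proof -
      have "(\<lambda>n. (cmod (cnj u * inverse (w n) + 1))\<^sup>2) \<longlonglongrightarrow> (cmod (cnj u * 0 + 1))\<^sup>2"
        by (intro tendsto_intros winv)
      moreover have "cmod (cnj u * inverse (w n) + 1) = cmod (u + cnj (w n)) / cmod (w n)" for n
      proof -
        have "cnj u * inverse (w n) + 1 = cnj (u + cnj (w n)) / w n"
          using w0[of n] by (simp add: field_simps)
        then show ?thesis by (simp only: norm_divide complex_mod_cnj)
      qed
      ultimately show ?thesis by simp
    qed
    \<comment> \<open>If the horodisc condition fails at z, the midpoint c strictly separates the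
      limits Re (f z) and Re (herg \<tau> z) of the coefficients of b (n + 1) and b n in
      \<open>sp\<close>.\<close>
    define c where "c = (Re (f z) + Re (herg \<tau> z)) / 2"
    have cpos: "c > 0" using fpos[OF z] Kz by (simp add: c_def)
    have "(\<lambda>n. Re (herg \<tau> z) * (cmod (f z + cnj (w (Suc n))) / cmod (w (Suc n)))\<^sup>2) \<longlonglongrightarrow> Re (herg \<tau> z) * 1"
      by (intro tendsto_intros LIMSEQ_Suc q1)
    then have e1: "\<forall>\<^sub>F n in sequentially. c < Re (herg \<tau> z) * (cmod (f z + cnj (w (Suc n))) / cmod (w (Suc n)))\<^sup>2"
      by (rule order_tendstoD(1)) (use lt in \<open>simp add: c_def\<close>)
    have "(\<lambda>n. Re (f z) * (cmod (herg \<tau> z + cnj (w n)) / cmod (w n))\<^sup>2) \<longlonglongrightarrow> Re (f z) * 1"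
      by (intro tendsto_intros q1)
    then have e2: "\<forall>\<^sub>F n in sequentially. Re (f z) * (cmod (herg \<tau> z + cnj (w n)) / cmod (w n))\<^sup>2 < c"
      by (rule order_tendstoD(2)) (use lt in \<open>simp add: c_def\<close>)
    have "\<forall>\<^sub>F n in sequentially. b n \<le> b (Suc n)"
      using e1 e2
    proof eventually_elim
      case (elim n)
      have "c * b n \<le> (Re (herg \<tau> z) * (cmod (f z + cnj (w (Suc n))) / cmod (w (Suc n)))\<^sup>2) * b n"
        using elim(1) bpos[of n] by (intro mult_right_mono) auto
      also have "\<dots> \<le> (Re (f z) * (cmod (herg \<tau> z + cnj (w n)) / cmod (w n))\<^sup>2) * b (Suc n)"
        using sp[of n] by (simp add: mult_ac)
      also have "\<dots> \<le> c * b (Suc n)"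
        using elim(2) bpos[of "Suc n"] by (intro mult_right_mono) auto
      finally show ?case using cpos by simp
    qed
    then obtain N where N: "\<And>n. n \<ge> N \<Longrightarrow> b n \<le> b (Suc n)"
      unfolding eventually_sequentially by blast
    have "b N \<le> b n" if "n \<ge> N" for n
      using that by (induction n rule: dec_induct) (use N order_trans in blast)+
    then have "b N \<le> 0"
      using LIMSEQ_le_const[OF blim] by blast
    then show False using bpos[of N] by simp
  qed
qed

text \<open>The infinitesimal form of Wolff's lemma, and the positivity in the Berkson--Porta
  formula.\<close>

lemma herg_field_dw_nonneg:
  assumes gen: "generates \<phi> G" and dw: "dw_point \<phi> \<tau>" and z: "z \<in> unit_disk"
  shows "Re (herg_field \<tau> G z) \<ge> 0"
proof -
  have "cmod \<tau> = 1" using dw by (simp add: dw_point_def)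
  then have "Re (herg_field \<tau> G z) \<ge> 0 * Re (herg \<tau> z)"
    by (rule herg_field_lower_bound[OF gen _ z LIMSEQ_inverse_real_of_nat])
      (use dw_point_horodisc[OF gen dw _ z] in auto)
  then show ?thesis by simp
qed

text \<open>The minimum principle, read off from Schwarz--Pick: if Re (f a) = 0 its right-hand side
  vanishes and forces f z = - cnj (f a).\<close>

lemma Re_nonneg_constant:
  assumes holf: "f holomorphic_on unit_disk" and nn: "\<And>z. z \<in> unit_disk \<Longrightarrow> Re (f z) \<ge> 0"
    and a: "a \<in> unit_disk" "Re (f a) = 0" and z: "z \<in> unit_disk"
  shows "f z = f a"
proof -
  have s: "cmod 1 = 1" by simp
  have "Re (herg 1 z) * Re (herg 1 a) * (cmod (f z + cnj (f a)))\<^sup>2 \<le> 0"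
    using schwarz_pick_herg[OF holf nn s z a(1)] a(2) by simp
  moreover have "Re (herg 1 z) * Re (herg 1 a) > 0"
    using Re_herg_pos[OF s] z a(1) by simp
  ultimately have "(cmod (f z + cnj (f a)))\<^sup>2 \<le> 0"
    by (metis mult_le_0_iff not_less)
  then have "f z = - cnj (f a)" by (simp add: eq_neg_iff_add_eq_0)
  then show ?thesis using a(2) by (simp add: complex_eq_iff)
qed

lemma unit_diff_square:
  assumes "cmod s = 1" "cmod t = 1"
  shows "(s - t)\<^sup>2 = - (s * t * of_real ((cmod (s - t))\<^sup>2))"
proof -
  have st: "s * cnj s = 1" "t * cnj t = 1"
    using assms by (simp_all add: complex_norm_square[symmetric])
  have "s * t * of_real ((cmod (s - t))\<^sup>2) = s * t * ((s - t) * (cnj s - cnj t))"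
    using complex_norm_square[of "s - t"] by simp
  also have "\<dots> = (s - t) * (t * (s * cnj s) - s * (t * cnj t))" by (simp add: algebra_simps)
  also have "\<dots> = - (s - t)\<^sup>2" unfolding st by (simp add: power2_eq_square algebra_simps)
  finally show ?thesis by simp
qed

lemma herg_diff:
  assumes "s \<noteq> z" "s \<noteq> t"
  shows "herg s z - herg s t = 2 * s * (z - t) / ((s - z) * (s - t))"
  using assms unfolding herg_def by (simp add: diff_frac_eq) (simp add: algebra_simps)

text \<open>The Berkson--Porta formula based at t, seen from another boundary point s. The numerator
  is quadratic in \<open>herg s\<close>, so linear growth of q at s corresponds to linear growth of
  the field there.\<close>

lemma herg_field_quotient:
  assumes s: "cmod s = 1" and t: "cmod t = 1" and st: "s \<noteq> t" and sz: "s \<noteq> z"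
    and G: "G z = (t - z)\<^sup>2 / (t * q)"
  shows "herg_field s G z = - of_real ((cmod (s - t))\<^sup>2 / 2) * (herg s z - herg s t)\<^sup>2 / q"
proof -
  have s0: "s \<noteq> 0" "t \<noteq> 0" "s - z \<noteq> 0" "s - t \<noteq> 0" using assms by auto
  have d: "of_real ((cmod (s - t))\<^sup>2 / 2) = - (s - t)\<^sup>2 / (2 * s * t)"
    using unit_diff_square[OF s t] s0 by (simp add: field_simps)
  have "- of_real ((cmod (s - t))\<^sup>2 / 2) * (herg s z - herg s t)\<^sup>2 = 2 * s * (t - z)\<^sup>2 / (t * (s - z)\<^sup>2)"
  proof -
    have "- (- e\<^sup>2 / (2 * s * t)) * (2 * s * b / (c * e))\<^sup>2 = 2 * s * b\<^sup>2 / (t * c\<^sup>2)"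
      if "e \<noteq> 0" "c \<noteq> 0" for e b c
      using that s0 by (simp add: field_simps power2_eq_square)
    from this[of "s - t" "s - z" "z - t"] show ?thesis
      unfolding d herg_diff[OF sz st] power2_commute[of t z] using s0 by simp
  qed
  then show ?thesis unfolding herg_field_def G by simp
qed

text \<open>Each of the two half-plane coordinates is a Moebius function of the other with a simple
  pole. This converts a kernel at s into a simple pole in the coordinate based at t.\<close>

lemma herg_diff_mult:
  assumes s: "cmod s = 1" and t: "cmod t = 1" and st: "s \<noteq> t" and z: "s \<noteq> z" "t \<noteq> z"
  shows "(herg s z - herg s t) * (herg t z - herg t s) = of_real (4 / (cmod (s - t))\<^sup>2)"
proof -
  have s0: "s \<noteq> 0" "t \<noteq> 0" "s - z \<noteq> 0" "s - t \<noteq> 0" "t - z \<noteq> 0" "t - s \<noteq> 0" using assms by auto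
  have c0: "complex_of_real ((cmod (s - t))\<^sup>2) \<noteq> 0" using s0 by simp
  have "(herg s z - herg s t) * (herg t z - herg t s)
      = (2 * s * (z - t) * (2 * t * (z - s))) / (((s - z) * (s - t)) * ((t - z) * (t - s)))"
    using herg_diff[OF z(1) st] herg_diff[OF z(2) st[symmetric]] by simp
  also have "\<dots> = - (4 * s * t) / (s - t)\<^sup>2"
  proof -
    have "(2 * s * (z - t) * (2 * t * (z - s))) * (s - t)\<^sup>2 = - (4 * s * t) * (((s - z) * (s - t)) * ((t - z) * (t - s)))"
      by (simp add: power2_eq_square algebra_simps)
    moreover have "x / y = u / v" if "x * v = u * y" "y \<noteq> 0" "v \<noteq> 0" for x y u v :: complex
      using that by (simp add: frac_eq_eq)
    ultimately show ?thesis using s0 by (metis mult_eq_0_iff power_not_zero)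
  qed
  also have "\<dots> = 4 / of_real ((cmod (s - t))\<^sup>2)"
    unfolding unit_diff_square[OF s t] using s0 c0 by (simp add: field_simps)
  finally show ?thesis by simp
qed

lemma inverse_herg_radial:
  "cmod s = 1 \<Longrightarrow> ((\<lambda>r. inverse (herg s (of_real r * s))) \<longlongrightarrow> 0) (at_left (1::real))"
  by (rule filterlim_compose[OF inverse_herg_tendsto radial_tendsto[of s 2]]) auto

text \<open>The point mass of \<open>q\<close> at a boundary point \<open>s \<noteq> t\<close> and the spectral value of \<open>G\<close> there
  determine each other.\<close>
lemma spectral_value_mass:
  assumes s: "cmod s = 1" and t: "cmod t = 1" and st: "s \<noteq> t"
    and holq: "q holomorphic_on unit_disk" and q: "\<And>z. z \<in> unit_disk \<Longrightarrow> Re (q z) \<ge> 0"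
    and q0: "\<And>z. z \<in> unit_disk \<Longrightarrow> q z \<noteq> 0"
    and G: "\<And>z. z \<in> unit_disk \<Longrightarrow> G z = (t - z)\<^sup>2 / (t * q z)"
    and l: "angular_limit (\<lambda>z. herg_field s G z / herg s z) s (of_real l)"
  obtains m where "m > 0" "l * m = - (cmod (s - t))\<^sup>2 / 2"
    "\<And>z. z \<in> unit_disk \<Longrightarrow> Re (q z) \<ge> m * Re (herg s z)"
proof -
  have k0: "Re (q z) \<ge> 0 * Re (herg s z)" if "z \<in> unit_disk" for z using q[OF that] by simp
  obtain m where m0: "m \<ge> 0" and m: "\<And>z. z \<in> unit_disk \<Longrightarrow> Re (q z) \<ge> m * Re (herg s z)"
    and mlim: "angular_limit (\<lambda>z. q z / herg s z) s (of_real m)"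
    using landau_valiron[OF s holq k0] by blast
  let ?p = "\<lambda>r. of_real r * s" and ?F = "at_left (1::real)"
  \<comment> \<open>In this product q cancels; what remains is computed by
    \<open>herg_field_quotient\<close> and has the nonzero limit - |s - t|^2 / 2. A finite spectral
    value thus forces a positive mass.\<close>
  have "((\<lambda>r. (herg_field s G (?p r) / herg s (?p r)) * (q (?p r) / herg s (?p r))) \<longlongrightarrow> of_real l * of_real m) ?F"
    by (intro tendsto_intros angular_limit_radial[OF s] l mlim)
  moreover have "((\<lambda>r. - of_real ((cmod (s - t))\<^sup>2 / 2) * (1 - herg s t * inverse (herg s (?p r)))\<^sup>2)
      \<longlongrightarrow> - of_real ((cmod (s - t))\<^sup>2 / 2) * (1 - herg s t * 0)\<^sup>2) ?F"
    by (intro tendsto_intros inverse_herg_radial[OF s])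
  moreover have "\<forall>\<^sub>F r in ?F. - of_real ((cmod (s - t))\<^sup>2 / 2) * (1 - herg s t * inverse (herg s (?p r)))\<^sup>2
      = (herg_field s G (?p r) / herg s (?p r)) * (q (?p r) / herg s (?p r))"
    using radial_in_disk[OF s]
  proof eventually_elim
    case (elim r)
    have K: "herg s (?p r) \<noteq> 0" using Re_herg_pos[OF s elim] by auto
    have "1 - herg s t * inverse (herg s (?p r)) = (herg s (?p r) - herg s t) / herg s (?p r)"
      using K by (simp add: field_simps)
    moreover have "herg_field s G (?p r) = - of_real ((cmod (s - t))\<^sup>2 / 2) * (herg s (?p r) - herg s t)\<^sup>2 / q (?p r)"
      by (rule herg_field_quotient[of s t "?p r" G "q (?p r)", OF s t st disk_ne_unit[OF s elim] G[OF elim]])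
    moreover have "d * (v / K)\<^sup>2 = d * v\<^sup>2 / y / K * (y / K)" if "y \<noteq> 0" for d v K y :: complex
      using that by (simp add: power_divide power2_eq_square)
    ultimately show ?case using q0[OF elim] by (simp only:)
  qed
  note tends = calculation(1) Lim_transform_eventually[OF calculation(2) this]
  have "complex_of_real l * of_real m = - of_real ((cmod (s - t))\<^sup>2 / 2) * (1 - herg s t * 0)\<^sup>2"
    by (rule tendsto_unique[OF trivial_limit_at_left_real tends])
  then have "complex_of_real (l * m) = of_real (- (cmod (s - t))\<^sup>2 / 2)" by simp
  then have lm: "l * m = - (cmod (s - t))\<^sup>2 / 2" by (simp only: of_real_eq_iff)
  moreover have "(cmod (s - t))\<^sup>2 > 0" using st by simp
  ultimately have "m \<noteq> 0" by auto
  with m0 have "m > 0" by simp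
  from that[OF this lm m] show ?thesis .
qed

text \<open>Mass and spectral value have a fixed negative product, so a lower bound on the spectral
  value becomes a lower bound on the mass; \<open>alpha\<close> is exactly the mass belonging to the
  extreme value \<open>lam\<close>.\<close>

lemma brfp_mass:
  assumes gen: "generates \<phi> G" and b: "brfp \<phi> s l" "lam \<le> l" "lam < 0"
    and t: "cmod t = 1" and st: "s \<noteq> t"
    and holq: "q holomorphic_on unit_disk" and q: "\<And>z. z \<in> unit_disk \<Longrightarrow> Re (q z) \<ge> 0"
    and q0: "\<And>z. z \<in> unit_disk \<Longrightarrow> q z \<noteq> 0"
    and G: "\<And>z. z \<in> unit_disk \<Longrightarrow> G z = (t - z)\<^sup>2 / (t * q z)"
    and z: "z \<in> unit_disk"
  shows "Re (q z) \<ge> (cmod (t - s))\<^sup>2 / (2 * \<bar>lam\<bar>) * Re (herg s z)"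
proof -
  have s: "cmod s = 1" using b by (simp add: brfp_def)
  have k: "lam * Re (herg s z) \<le> Re (herg_field s G z)" if z: "z \<in> unit_disk" for z
  proof -
    have "lam * Re (herg s z) \<le> l * Re (herg s z)"
      using b(2) Re_herg_pos[OF s z] by (intro mult_right_mono) auto
    then show ?thesis using brfp_herg_field_bound[OF gen b(1) z] by simp
  qed
  obtain l' where l': "lam \<le> l'" "angular_limit (\<lambda>z. herg_field s G z / herg s z) s (of_real l')"
    using boundary_fixed_point[OF gen s k] by blast
  obtain m where m: "m > 0" "l' * m = - (cmod (s - t))\<^sup>2 / 2" "Re (q z) \<ge> m * Re (herg s z)"
    using spectral_value_mass[OF s t st holq q q0 G l'(2)] z by blast
  have "(cmod (t - s))\<^sup>2 / 2 = - l' * m" using m(2) by (simp add: norm_minus_commute)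
  also have "\<dots> \<le> \<bar>lam\<bar> * m" using m(1) l'(1) b(3) by (intro mult_right_mono) auto
  finally have "(cmod (t - s))\<^sup>2 / (2 * \<bar>lam\<bar>) \<le> m" using b(3) by (simp add: field_simps)
  then have "(cmod (t - s))\<^sup>2 / (2 * \<bar>lam\<bar>) * Re (herg s z) \<le> m * Re (herg s z)"
    using Re_herg_pos[OF s z] by (intro mult_right_mono) auto
  then show ?thesis using m(3) by simp
qed

section \<open>Flows in the half-plane\<close>

text \<open>Noshiro--Warschawski: along the segment from a to b the function Re (h / (b - a))
  increases strictly.\<close>

lemma inj_on_pos_Re_deriv:
  fixes h Q :: "complex \<Rightarrow> complex"
  assumes H: "convex H" and d: "\<And>w. w \<in> H \<Longrightarrow> (h has_field_derivative Q w) (at w)"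
    and Q: "\<And>w. w \<in> H \<Longrightarrow> Re (Q w) > 0"
  shows "inj_on h H"
proof (rule inj_onI, rule ccontr)
  fix a b assume a: "a \<in> H" and b: "b \<in> H" and eq: "h a = h b" and ne: "a \<noteq> b"
  define \<gamma> where "\<gamma> = (\<lambda>x::real. a + of_real x * (b - a))"
  define F where "F = (\<lambda>x. Re (h (\<gamma> x) / (b - a)))"
  have \<gamma>: "\<gamma> x \<in> H" if "0 \<le> x" "x \<le> 1" for x
  proof -
    have "\<gamma> x = (1 - x) *\<^sub>R a + x *\<^sub>R b"
      by (simp add: \<gamma>_def scaleR_conv_of_real algebra_simps)
    then show ?thesis using convexD[OF H a b, of "1 - x" x] that by simp
  qed
  have "F 0 < F 1"
  proof (rule DERIV_pos_imp_increasing[OF zero_less_one])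
    fix x :: real assume x: "0 \<le> x" "x \<le> 1"
    have "(\<gamma> has_vector_derivative (b - a)) (at x)"
      unfolding \<gamma>_def by (auto intro!: derivative_eq_intros)
    moreover have "(h has_field_derivative Q (\<gamma> x)) (at (\<gamma> x) within range \<gamma>)"
      using d[OF \<gamma>[OF x]] by (rule has_field_derivative_at_within)
    ultimately have "((h \<circ> \<gamma>) has_vector_derivative (b - a) * Q (\<gamma> x)) (at x)"
      by (rule field_vector_diff_chain_within)
    then have "((\<lambda>y. (h \<circ> \<gamma>) y / (b - a)) has_vector_derivative (b - a) * Q (\<gamma> x) / (b - a)) (at x)"
      by (rule has_vector_derivative_divide)
    then have "(F has_real_derivative Re ((b - a) * Q (\<gamma> x) / (b - a))) (at x)"
      unfolding F_def o_def by (rule has_field_derivative_Re)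
    then show "\<exists>y. DERIV F x :> y \<and> 0 < y"
      using Q[OF \<gamma>[OF x]] ne by auto
  qed
  then show False using eq by (simp add: F_def \<gamma>_def)
qed

abbreviation half_plane :: "complex set" where
  "half_plane \<equiv> {w. Re w > 0}"

lemma convex_half_plane: "convex half_plane"
  by (simp add: convex_halfspace_Re_gt)

lemma open_half_plane: "open half_plane"
  by (simp add: open_halfspace_Re_gt)

text \<open>The flow of \<open>w' = 1 / Q w\<close> is conjugated to translation by the Koenigs function \<open>h\<close>.
  Since \<open>Re w\<close> increases along trajectories, a trajectory could stop in finite time only by
  escaping to infinity, which properness of \<open>h\<close> excludes.\<close>
lemma half_plane_flow:
  fixes h Q :: "complex \<Rightarrow> complex"
  assumes d: "\<And>w. w \<in> half_plane \<Longrightarrow> (h has_field_derivative Q w) (at w)"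
    and Q: "\<And>w. w \<in> half_plane \<Longrightarrow> Re (Q w) > 0"
    and proper: "\<And>e K. e > 0 \<Longrightarrow> \<exists>M. \<forall>w. Re w \<ge> e \<longrightarrow> cmod (h w) \<le> K \<longrightarrow> cmod w \<le> M"
  obtains W :: "real \<Rightarrow> complex \<Rightarrow> complex" where
    "\<And>t. t \<ge> 0 \<Longrightarrow> W t holomorphic_on half_plane"
    "\<And>t w. t \<ge> 0 \<Longrightarrow> w \<in> half_plane \<Longrightarrow> W t w \<in> half_plane"
    "\<And>w. w \<in> half_plane \<Longrightarrow> W 0 w = w"
    "\<And>s t w. s \<ge> 0 \<Longrightarrow> t \<ge> 0 \<Longrightarrow> w \<in> half_plane \<Longrightarrow> W (s + t) w = W s (W t w)"
    "\<And>t w. t \<ge> 0 \<Longrightarrow> w \<in> half_plane \<Longrightarrow> ((\<lambda>s. W s w) has_vector_derivative 1 / Q (W t w)) (at t)"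
    "\<And>w. w \<in> half_plane \<Longrightarrow> filterlim (\<lambda>t. W t w) at_infinity at_top"
proof -
  have holh: "h holomorphic_on half_plane"
    unfolding holomorphic_on_def field_differentiable_def using d has_field_derivative_at_within by blast
  have inj: "inj_on h half_plane"
    by (rule inj_on_pos_Re_deriv[OF convex_half_plane d Q])
  obtain g where holg: "g holomorphic_on (h ` half_plane)"
    and dg: "\<And>w. w \<in> half_plane \<Longrightarrow> deriv h w * deriv g (h w) = 1"
    and gh: "\<And>w. w \<in> half_plane \<Longrightarrow> g (h w) = w"
    using holomorphic_has_inverse[OF holh open_half_plane inj] by metis
  define \<Omega> where "\<Omega> = h ` half_plane"
  have \<Omega>: "open \<Omega>" unfolding \<Omega>_def by (rule open_mapping_thm3[OF holh open_half_plane inj])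
  have hg: "h (g v) = v" and gH: "g v \<in> half_plane" if "v \<in> \<Omega>" for v
    using that gh by (auto simp: \<Omega>_def)
  have gder: "(g has_field_derivative 1 / Q (g v)) (at v)" if v: "v \<in> \<Omega>" for v
  proof -
    have "deriv h (g v) = Q (g v)" using d[OF gH[OF v]] by (rule DERIV_imp_deriv)
    moreover have "deriv h (g v) * deriv g v = 1" using dg[OF gH[OF v]] hg[OF v] by simp
    ultimately have "deriv g v = 1 / Q (g v)"
      by (metis nonzero_eq_divide_eq mult.commute mult_zero_left zero_neq_one)
    then show ?thesis
      using holomorphic_derivI[OF holg[folded \<Omega>_def] \<Omega> v] by simp
  qed
  have Wder: "((\<lambda>t. g (c + of_real t)) has_vector_derivative 1 / Q (g (c + of_real t))) (at t)"
    if "c + of_real t \<in> \<Omega>" for c t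
  proof -
    have "((\<lambda>t. c + of_real t) has_vector_derivative 1) (at t)"
      by (auto intro!: derivative_eq_intros)
    from field_vector_diff_chain_at[OF this gder[OF that]] show ?thesis by (simp add: o_def)
  qed
  have Qinv: "Re (1 / Q w) > 0" if "w \<in> half_plane" for w
  proof -
    have "Re (Q w) > 0" using Q that by simp
    moreover from this have "Q w \<noteq> 0" by auto
    ultimately show ?thesis by (simp add: Re_divide')
  qed
  have mono: "Re (g c) \<le> Re (g (c + of_real t))"
    if t: "t \<ge> 0" and c: "\<And>x. 0 \<le> x \<Longrightarrow> x \<le> t \<Longrightarrow> c + of_real x \<in> \<Omega>" for c t
  proof -
    have "Re (g (c + of_real 0)) \<le> Re (g (c + of_real t))"
    proof (rule DERIV_nonneg_imp_nondecreasing[OF t])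
      fix x assume x: "0 \<le> x" "x \<le> t"
      have "((\<lambda>t. Re (g (c + of_real t))) has_real_derivative Re (1 / Q (g (c + of_real x)))) (at x)"
        by (rule has_field_derivative_Re[OF Wder[OF c[OF x]]])
      then show "\<exists>y. ((\<lambda>t. Re (g (c + of_real t))) has_real_derivative y) (at x) \<and> 0 \<le> y"
        using Qinv[OF gH[OF c[OF x]]] less_imp_le by blast
    qed
    then show ?thesis by simp
  qed
  \<comment> \<open>The image of h is invariant under translation to the right. Otherwise let T be
    the first exit time: the preimages u n at times x n below T stay in the compact set S by
    monotonicity and properness, and a limit point of them is a preimage at time T.\<close>
  have trans: "h w + of_real t \<in> \<Omega>" if w: "w \<in> half_plane" and t: "t \<ge> 0" for w t
  proof (rule ccontr)
    assume nt: "h w + of_real t \<notin> \<Omega>"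
    define C where "C = {x. h w + of_real x \<notin> \<Omega>} \<inter> {0..}"
    have "closed {x::real. h w + of_real x \<notin> \<Omega>}"
    proof -
      have "open ((\<lambda>x::real. h w + of_real x) -` \<Omega>)"
        by (intro open_vimage \<Omega> continuous_intros)
      moreover have "{x::real. h w + of_real x \<notin> \<Omega>} = - ((\<lambda>x::real. h w + of_real x) -` \<Omega>)" by auto
      ultimately show ?thesis by (simp add: closed_Compl)
    qed
    then have Ccl: "closed C" unfolding C_def by (intro closed_Int) auto
    have Cne: "C \<noteq> {}" using nt t by (auto simp: C_def)
    have Cbd: "bdd_below C" by (auto simp: C_def intro!: bdd_belowI[of _ 0])
    define T where "T = Inf C"
    have TC: "T \<in> C" unfolding T_def by (rule closed_contains_Inf[OF Cne Cbd Ccl])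
    have below: "h w + of_real x \<in> \<Omega>" if "0 \<le> x" "x < T" for x
    proof (rule ccontr)
      assume "h w + of_real x \<notin> \<Omega>"
      then have "x \<in> C" using that by (simp add: C_def)
      then have "T \<le> x" unfolding T_def using Cbd by (rule cInf_lower)
      then show False using that by simp
    qed
    have "T \<noteq> 0" using TC w by (auto simp: C_def \<Omega>_def)
    then have T: "T > 0" using TC by (simp add: C_def)
    define x where "x n = T * (1 - 1 / real (n + 2))" for n
    have x: "0 \<le> x n" "x n < T" for n
      using T by (auto simp: x_def field_simps)
    have xlim: "x \<longlonglongrightarrow> T"
    proof -
      have "(\<lambda>n. 1 / real (n + 2)) \<longlonglongrightarrow> 0"
        using LIMSEQ_ignore_initial_segment[OF lim_inverse_n, of 2] by (simp add: inverse_eq_divide)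
      then have "(\<lambda>n. T * (1 - 1 / real (n + 2))) \<longlonglongrightarrow> T * (1 - 0)"
        by (intro tendsto_intros)
      then show ?thesis by (simp add: x_def[abs_def])
    qed
    define u where "u n = g (h w + of_real (x n))" for n
    have hu: "h (u n) = h w + of_real (x n)" for n
      unfolding u_def by (rule hg[OF below[OF x]])
    have Re_u: "Re (u n) \<ge> Re w" for n
    proof -
      have "Re (g (h w)) \<le> Re (u n)"
        unfolding u_def using x[of n] by (intro mono below) auto
      then show ?thesis using gh[OF w] by simp
    qed
    obtain M where M: "\<And>v. Re v \<ge> Re w \<Longrightarrow> cmod (h v) \<le> cmod (h w) + T \<Longrightarrow> cmod v \<le> M"
      using proper[of "Re w" "cmod (h w) + T"] w by auto
    have "cmod (h (u n)) \<le> cmod (h w) + T" for n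
      unfolding hu using norm_triangle_ineq[of "h w" "of_real (x n)"] x[of n] by simp
    then have uM: "cmod (u n) \<le> M" for n using M Re_u by blast
    define S where "S = cball 0 M \<inter> {v. Re v \<ge> Re w}"
    have "compact S" unfolding S_def
      by (intro compact_Int_closed compact_cball closed_halfspace_Re_ge)
    moreover have "\<forall>n. u n \<in> S" using uM Re_u by (simp add: S_def)
    ultimately obtain l r where l: "l \<in> S" and r: "strict_mono r" and ul: "(u \<circ> r) \<longlonglongrightarrow> l"
      unfolding compact_def by metis
    have lH: "l \<in> half_plane" using l w by (auto simp: S_def)
    have "isCont h l" using d[OF lH] by (rule DERIV_isCont)
    then have "(\<lambda>n. h ((u \<circ> r) n)) \<longlonglongrightarrow> h l" using ul by (rule isCont_tendsto_compose)
    moreover have "(\<lambda>n. h ((u \<circ> r) n)) \<longlonglongrightarrow> h w + of_real T"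
      unfolding o_def hu using LIMSEQ_subseq_LIMSEQ[OF xlim r]
      by (intro tendsto_intros) (simp add: o_def)
    ultimately have "h l = h w + of_real T" by (rule LIMSEQ_unique)
    then have "h w + of_real T \<in> \<Omega>" using lH unfolding \<Omega>_def by (metis imageI)
    then show False using TC by (simp add: C_def)
  qed
  define W where "W t w = g (h w + of_real t)" for t w
  have hW: "h (W t w) = h w + of_real t" if "t \<ge> 0" "w \<in> half_plane" for t w
    unfolding W_def using hg trans that by blast
  have WH: "W t w \<in> half_plane" if "t \<ge> 0" "w \<in> half_plane" for t w
    unfolding W_def using gH trans that by blast
  show ?thesis
  proof
    show "W t holomorphic_on half_plane" if t: "t \<ge> 0" for t
    proof -
      have "(\<lambda>w. h w + of_real t) holomorphic_on half_plane"
        using holh by (intro holomorphic_intros)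
      then have "(g \<circ> (\<lambda>w. h w + of_real t)) holomorphic_on half_plane"
        by (rule holomorphic_on_compose)
          (rule holomorphic_on_subset[OF holg[folded \<Omega>_def]], use trans[OF _ t] in auto)
      then show ?thesis by (simp add: o_def W_def[abs_def])
    qed
    show "W t w \<in> half_plane" if "t \<ge> 0" "w \<in> half_plane" for t w by (rule WH[OF that])
    show "W 0 w = w" if "w \<in> half_plane" for w using gh[OF that] by (simp add: W_def)
    show "W (s + t) w = W s (W t w)" if "s \<ge> 0" "t \<ge> 0" "w \<in> half_plane" for s t w
      unfolding W_def[of s "W t w"] hW[OF that(2,3)] by (simp add: W_def add_ac)
    show "((\<lambda>s. W s w) has_vector_derivative 1 / Q (W t w)) (at t)" if "t \<ge> 0" "w \<in> half_plane" for t w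
      unfolding W_def by (rule Wder[OF trans[OF that(2,1)]])
    show "filterlim (\<lambda>t. W t w) at_infinity at_top" if w: "w \<in> half_plane" for w
      unfolding filterlim_at_infinity[OF order_refl]
    proof (intro allI impI)
      fix M :: real assume "M > 0"
      \<comment> \<open>h is bounded on \<open>?S\<close> while |h (W t w)| grows at least like t,
        so the trajectory leaves \<open>?S\<close>; since Re does not decrease, it can leave only
        through |v| > M.\<close>
      let ?S = "cball 0 M \<inter> {v. Re v \<ge> Re w}"
      have "compact ?S" by (intro compact_Int_closed compact_cball closed_halfspace_Re_ge)
      moreover have "continuous_on ?S h"
        by (rule continuous_on_subset[OF holomorphic_on_imp_continuous_on[OF holh]]) (use w in auto)
      ultimately have "bounded (h ` ?S)" by (intro compact_imp_bounded compact_continuous_image)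
      then obtain K where K: "\<And>v. v \<in> ?S \<Longrightarrow> cmod (h v) \<le> K" unfolding bounded_iff by blast
      show "\<forall>\<^sub>F t in at_top. M \<le> cmod (W t w)"
        using eventually_gt_at_top[of "K + cmod (h w)"] eventually_ge_at_top[of 0]
      proof eventually_elim
        case (elim t)
        have "Re (g (h w)) \<le> Re (W t w)"
          unfolding W_def using elim w trans by (intro mono) auto
        then have 1: "Re w \<le> Re (W t w)" using gh[OF w] by simp
        have "cmod (h (W t w)) \<ge> t - cmod (h w)"
          unfolding hW[OF elim(2) w] using norm_diff_ineq[of "of_real t" "h w"] elim(2) by (simp add: add.commute)
        then have "cmod (h (W t w)) > K" using elim(1) by simp
        then have "W t w \<notin> ?S" using K[of "W t w"] by linarith
        then show ?case using 1 by auto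
      qed
    qed
  qed
qed

section \<open>Transfer of the flow to the disk\<close>

definition herg_inv :: "complex \<Rightarrow> complex \<Rightarrow> complex" where
  "herg_inv s w = s * (w - 1) / (w + 1)"

lemma half_plane_add_1:
  assumes "w \<in> half_plane" shows "w + 1 \<noteq> 0"
proof
  assume "w + 1 = 0"
  then have "Re (w + 1) = 0" by simp
  then show False using assms by simp
qed

lemma herg_inv_disk: "cmod s = 1 \<Longrightarrow> w \<in> half_plane \<Longrightarrow> herg_inv s w \<in> unit_disk"
proof -
  assume s: "cmod s = 1" and w: "w \<in> half_plane"
  have "(cmod (w - 1))\<^sup>2 < (cmod (w + 1))\<^sup>2"
    using w unfolding cmod_power2 by (simp add: power2_eq_square algebra_simps)
  then have "cmod (w - 1) < cmod (w + 1)" using power_less_imp_less_base norm_ge_zero by blast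
  then show ?thesis using s half_plane_add_1[OF w] by (simp add: herg_inv_def norm_divide norm_mult)
qed

lemma diff_herg_inv: "w \<in> half_plane \<Longrightarrow> s - herg_inv s w = 2 * s / (w + 1)"
  using half_plane_add_1[of w] by (simp add: herg_inv_def field_simps)

lemma herg_herg_inv: "cmod s = 1 \<Longrightarrow> w \<in> half_plane \<Longrightarrow> herg s (herg_inv s w) = w"
proof -
  assume s: "cmod s = 1" and w: "w \<in> half_plane"
  have s0: "s \<noteq> 0" using s by auto
  have "herg s (herg_inv s w) + 1 = 2 * s / (s - herg_inv s w)"
    by (rule herg_plus_1[OF disk_ne_unit[OF s herg_inv_disk[OF s w]]])
  also have "\<dots> = w + 1" using s0 half_plane_add_1[OF w] by (simp add: diff_herg_inv[OF w])
  finally show ?thesis by simp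
qed

lemma herg_inv_herg: "cmod s = 1 \<Longrightarrow> z \<in> unit_disk \<Longrightarrow> herg_inv s (herg s z) = z"
proof -
  assume s: "cmod s = 1" and z: "z \<in> unit_disk"
  have "s \<noteq> 0" "s - z \<noteq> 0" using s disk_ne_unit[OF s z] by auto
  then show ?thesis by (simp add: herg_inv_def herg_def divide_simps)
qed

lemma herg_in_half_plane: "cmod s = 1 \<Longrightarrow> z \<in> unit_disk \<Longrightarrow> herg s z \<in> half_plane"
  using Re_herg_pos by simp

lemma herg_inv_has_field_derivative:
  "w \<in> half_plane \<Longrightarrow> (herg_inv s has_field_derivative 2 * s / (w + 1)\<^sup>2) (at w within A)"
  unfolding herg_inv_def using half_plane_add_1[of w]
  by (auto intro!: derivative_eq_intros simp: power2_eq_square field_simps)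

text \<open>Conjugation by \<open>herg s\<close>, whose derivative 2 s / (s - z)^2 pulls the field 1
  / Q back to G. Escape to infinity in the half-plane is convergence to s in the disk, which makes s
  the Denjoy--Wolff point.\<close>

lemma disk_flow:
  fixes h Q :: "complex \<Rightarrow> complex"
  assumes s: "cmod s = 1"
    and d: "\<And>w. w \<in> half_plane \<Longrightarrow> (h has_field_derivative Q w) (at w)"
    and Q: "\<And>w. w \<in> half_plane \<Longrightarrow> Re (Q w) > 0"
    and proper: "\<And>e K. e > 0 \<Longrightarrow> \<exists>M. \<forall>w. Re w \<ge> e \<longrightarrow> cmod (h w) \<le> K \<longrightarrow> cmod w \<le> M"
    and hol: "G holomorphic_on unit_disk"
    and G: "\<And>z. z \<in> unit_disk \<Longrightarrow> G z = (s - z)\<^sup>2 / (2 * s * Q (herg s z))"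
  obtains \<phi> where "generates \<phi> G" "dw_point \<phi> s"
proof (rule half_plane_flow[OF d Q proper])
  fix W :: "real \<Rightarrow> complex \<Rightarrow> complex"
  assume Whol: "\<And>t. t \<ge> 0 \<Longrightarrow> W t holomorphic_on half_plane"
    and WH: "\<And>t w. t \<ge> 0 \<Longrightarrow> w \<in> half_plane \<Longrightarrow> W t w \<in> half_plane"
    and W0: "\<And>w. w \<in> half_plane \<Longrightarrow> W 0 w = w"
    and Wadd: "\<And>s t w. s \<ge> 0 \<Longrightarrow> t \<ge> 0 \<Longrightarrow> w \<in> half_plane \<Longrightarrow> W (s + t) w = W s (W t w)"
    and Wder: "\<And>t w. t \<ge> 0 \<Longrightarrow> w \<in> half_plane \<Longrightarrow> ((\<lambda>s. W s w) has_vector_derivative 1 / Q (W t w)) (at t)"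
    and Winf: "\<And>w. w \<in> half_plane \<Longrightarrow> filterlim (\<lambda>t. W t w) at_infinity at_top"
  define \<phi> where "\<phi> t z = herg_inv s (W t (herg s z))" for t z
  note hp = herg_in_half_plane[OF s]
  have \<phi>d: "\<phi> t z \<in> unit_disk" if "t \<ge> 0" "z \<in> unit_disk" for t z
    unfolding \<phi>_def by (rule herg_inv_disk[OF s WH[OF that(1) hp[OF that(2)]]])
  have h\<phi>: "herg s (\<phi> t z) = W t (herg s z)" if "t \<ge> 0" "z \<in> unit_disk" for t z
    unfolding \<phi>_def by (rule herg_herg_inv[OF s WH[OF that(1) hp[OF that(2)]]])
  have hol\<phi>: "\<phi> t holomorphic_on unit_disk" if t: "t \<ge> 0" for t
  proof -
    have "(W t \<circ> herg s) holomorphic_on unit_disk"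
      by (rule holomorphic_on_compose_gen[OF herg_holomorphic[OF s] Whol[OF t]]) (use hp in auto)
    moreover have "herg_inv s holomorphic_on half_plane"
      unfolding herg_inv_def using half_plane_add_1 by (intro holomorphic_intros) blast
    ultimately have "(herg_inv s \<circ> (W t \<circ> herg s)) holomorphic_on unit_disk"
      by (rule holomorphic_on_compose_gen) (use hp WH[OF t] in auto)
    then show ?thesis by (simp add: o_def \<phi>_def[abs_def])
  qed
  have der: "((\<lambda>s. \<phi> s z) has_vector_derivative G (\<phi> t z)) (at t)" if z: "z \<in> unit_disk" and t: "t \<ge> 0" for z t
  proof -
    let ?w = "W t (herg s z)"
    have w: "?w \<in> half_plane" by (rule WH[OF t hp[OF z]])
    have "((herg_inv s \<circ> (\<lambda>t. W t (herg s z))) has_vector_derivative 1 / Q ?w * (2 * s / (?w + 1)\<^sup>2)) (at t)"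
      by (rule field_vector_diff_chain_at[OF Wder[OF t hp[OF z]] herg_inv_has_field_derivative[OF w]])
    moreover have "G (\<phi> t z) = 1 / Q ?w * (2 * s / (?w + 1)\<^sup>2)"
    proof -
      have "s \<noteq> 0" using s by auto
      moreover have "s - \<phi> t z = 2 * s / (?w + 1)" unfolding \<phi>_def by (rule diff_herg_inv[OF w])
      ultimately show ?thesis
        using G[OF \<phi>d[OF t z]] h\<phi>[OF t z] by (simp add: power2_eq_square)
    qed
    ultimately show ?thesis by (simp add: o_def \<phi>_def[abs_def])
  qed
  have "generates \<phi> G"
    unfolding generates_def holo_semigroup_def
  proof (intro conjI allI ballI impI)
    show "\<phi> t holomorphic_on unit_disk" if "t \<ge> 0" for t by (rule hol\<phi>[OF that])
    show "\<phi> t ` unit_disk \<subseteq> unit_disk" if "t \<ge> 0" for t using \<phi>d[OF that] by blast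
    show z0: "\<phi> 0 z = z" if "z \<in> unit_disk" for z
      unfolding \<phi>_def using W0[OF hp[OF that]] herg_inv_herg[OF s that] by simp
    show "\<phi> (a + t) z = \<phi> a (\<phi> t z)" if "a \<ge> 0" "t \<ge> 0" "z \<in> unit_disk" for a t z
      unfolding \<phi>_def[of "a + t"] \<phi>_def[of a] h\<phi>[OF that(2,3)] Wadd[OF that(1,2) hp[OF that(3)]] ..
    show "((\<lambda>t. \<phi> t z) \<longlongrightarrow> z) (at_right 0)" if z: "z \<in> unit_disk" for z
    proof -
      have "isCont (\<lambda>t. \<phi> t z) 0"
        using has_vector_derivative_continuous[OF der[OF z order_refl]] by simp
      then have "((\<lambda>t. \<phi> t z) \<longlongrightarrow> \<phi> 0 z) (at 0)" by (simp add: isCont_def)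
      then show ?thesis using z0[OF z] by (metis filterlim_at_split)
    qed
    show "((\<lambda>s. \<phi> s z) has_vector_derivative G (\<phi> t z)) (at t within {0..})"
      if "z \<in> unit_disk" "t \<ge> 0" for z t
      by (rule has_vector_derivative_at_within[OF der[OF that]])
  qed (rule hol)
  moreover have "dw_point \<phi> s"
    unfolding dw_point_def
  proof (intro conjI ballI s)
    fix z assume z: "z \<in> unit_disk"
    have "filterlim (\<lambda>t. W t (herg s z) + 1) at_infinity at_top"
      by (rule tendsto_add_filterlim_at_infinity'[OF Winf[OF hp[OF z]] tendsto_const])
    then have "((\<lambda>t. inverse (W t (herg s z) + 1)) \<longlongrightarrow> 0) at_top"
      by (rule filterlim_compose[OF tendsto_inverse_0])
    then have "((\<lambda>t. s - 2 * s * inverse (W t (herg s z) + 1)) \<longlongrightarrow> s - 2 * s * 0) at_top"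
      by (intro tendsto_intros)
    moreover have "\<forall>\<^sub>F t in at_top. s - 2 * s * inverse (W t (herg s z) + 1) = \<phi> t z"
      using eventually_ge_at_top[of 0]
    proof eventually_elim
      case (elim t)
      have "s - \<phi> t z = 2 * s / (W t (herg s z) + 1)"
        unfolding \<phi>_def by (rule diff_herg_inv[OF WH[OF elim hp[OF z]]])
      then show ?case by (simp add: divide_inverse algebra_simps)
    qed
    ultimately show "((\<lambda>t. \<phi> t z) \<longlongrightarrow> s) at_top"
      using Lim_transform_eventually by fastforce
  qed
  ultimately show ?thesis by (rule that)
qed

section \<open>Masses, boundary zeros and rational flows\<close>

text \<open>Point masses at distinct points add up: subtracting the kernels at the other points does not
  change the mass, which is a boundary limit.\<close>
lemma sum_of_masses:
  fixes s :: "nat \<Rightarrow> complex" and a :: "nat \<Rightarrow> real"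
  assumes s: "\<And>k. k < n \<Longrightarrow> cmod (s k) = 1" and inj: "inj_on s {..<n}"
    and holq: "q holomorphic_on unit_disk" and q: "\<And>z. z \<in> unit_disk \<Longrightarrow> Re (q z) \<ge> 0"
    and a: "\<And>k z. k < n \<Longrightarrow> z \<in> unit_disk \<Longrightarrow> Re (q z) \<ge> a k * Re (herg (s k) z)"
    and z: "z \<in> unit_disk"
  shows "Re (q z) \<ge> (\<Sum>k<n. a k * Re (herg (s k) z))"
proof -
  define r where "r j = (\<lambda>z. q z - (\<Sum>k<j. of_real (a k) * herg (s k) z))" for j
  have "\<forall>z\<in>unit_disk. Re (r j z) \<ge> 0" if "j \<le> n" for j
    using that
  proof (induction j)
    case 0 then show ?case using q by (simp add: r_def)
  next
    case (Suc j)
    then have j: "j < n" and IH: "\<And>z. z \<in> unit_disk \<Longrightarrow> Re (r j z) \<ge> 0" by auto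
    let ?s = "s j" and ?F = "at_left (1::real)"
    let ?p = "\<lambda>r. of_real r * s j"
    note sj = s[OF j]
    have holr: "r j holomorphic_on unit_disk"
      unfolding r_def using s j by (intro holomorphic_intros holq) auto
    obtain m where m: "m \<ge> a j" and mlim: "angular_limit (\<lambda>z. q z / herg ?s z) ?s (of_real m)"
      using landau_valiron[OF sj holq a[OF j]] by blast
    have k0: "Re (r j z) \<ge> 0 * Re (herg ?s z)" if "z \<in> unit_disk" for z using IH[OF that] by simp
    obtain m' where m': "\<And>z. z \<in> unit_disk \<Longrightarrow> Re (r j z) \<ge> m' * Re (herg ?s z)"
      and mlim': "angular_limit (\<lambda>z. r j z / herg ?s z) ?s (of_real m')"
      using landau_valiron[OF sj holr k0] by blast
    have p: "(?p \<longlongrightarrow> of_real 1 * s j) ?F" by (intro tendsto_intros)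
    \<comment> \<open>Injectivity keeps the earlier kernels finite at \<open>s j\<close>, so they
      disappear after division by the kernel with its pole there.\<close>
    have hl: "((\<lambda>x. herg (s k) (?p x)) \<longlongrightarrow> herg (s k) (s j)) ?F" if k: "k < j" for k
    proof -
      have "s k \<noteq> s j" using inj k j by (auto simp: inj_on_def)
      then show ?thesis unfolding herg_def using p by (intro tendsto_intros) auto
    qed
    have "((\<lambda>x. q (?p x) / herg ?s (?p x) - (\<Sum>k<j. of_real (a k) * herg (s k) (?p x)) * inverse (herg ?s (?p x)))
        \<longlongrightarrow> of_real m - (\<Sum>k<j. of_real (a k) * herg (s k) (s j)) * 0) ?F"
      by (intro tendsto_intros angular_limit_radial[OF sj mlim] inverse_herg_radial[OF sj] hl) auto
    moreover have "q (?p x) / herg ?s (?p x) - (\<Sum>k<j. of_real (a k) * herg (s k) (?p x)) * inverse (herg ?s (?p x))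
        = r j (?p x) / herg ?s (?p x)" for x
      by (simp add: r_def divide_inverse left_diff_distrib)
    ultimately have "((\<lambda>x. r j (?p x) / herg ?s (?p x)) \<longlongrightarrow> of_real m) ?F" by simp
    from tendsto_unique[OF trivial_limit_at_left_real this angular_limit_radial[OF sj mlim']]
    have "m = m'" by (simp only: of_real_eq_iff)
    show ?case
    proof
      fix z assume z: "z \<in> unit_disk"
      have "a j * Re (herg ?s z) \<le> m' * Re (herg ?s z)"
        using m \<open>m = m'\<close> Re_herg_pos[OF sj z] by (intro mult_right_mono) auto
      then show "Re (r (Suc j) z) \<ge> 0" using m'[OF z] by (simp add: r_def)
    qed
  qed
  then have "Re (r n z) \<ge> 0" using z by blast
  then show ?thesis by (simp add: r_def)
qed

text \<open>Julia's inequality for \<open>1 / R\<close>, with its equality case.\<close>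
lemma boundary_zero_derivative:
  assumes t: "cmod t = 1" and holR: "R holomorphic_on unit_disk"
    and R: "\<And>z. z \<in> unit_disk \<Longrightarrow> Re (R z) \<ge> 0" and R0: "Re (R 0) > 0"
    and lim: "((\<lambda>r. R (of_real r * t) * herg t (of_real r * t)) \<longlongrightarrow> of_real B) (at_left (1::real))"
  shows "B > 0" and "1 / B \<le> Re (1 / R 0)"
    and "1 / B = Re (1 / R 0) \<Longrightarrow> z \<in> unit_disk \<Longrightarrow>
      R z * (of_real (Re (1 / R 0)) * herg t z + \<i> * of_real (Im (1 / R 0))) = 1"
proof -
  have Rne: "R z \<noteq> 0" if "z \<in> unit_disk" for z
  proof
    assume "R z = 0"
    then have "R 0 = R z" using Re_nonneg_constant[OF holR R that] by simp
    then show False using R0 \<open>R z = 0\<close> by simp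
  qed
  define g where "g = (\<lambda>z. 1 / R z)"
  have holg: "g holomorphic_on unit_disk"
    unfolding g_def using holR Rne by (intro holomorphic_intros) auto
  have gnn: "Re (g z) \<ge> 0 * Re (herg t z)" if "z \<in> unit_disk" for z
    using R[OF that] by (simp add: g_def Re_divide')
  obtain m where m0: "m \<ge> 0" and m: "\<And>z. z \<in> unit_disk \<Longrightarrow> Re (g z) \<ge> m * Re (herg t z)"
    and mlim: "angular_limit (\<lambda>z. g z / herg t z) t (of_real m)"
    using landau_valiron[OF t holg gnn] by blast
  let ?p = "\<lambda>r. of_real r * t" and ?F = "at_left (1::real)"
  have "((\<lambda>r. R (?p r) * herg t (?p r) * (g (?p r) / herg t (?p r))) \<longlongrightarrow> of_real B * of_real m) ?F"
    by (intro tendsto_mult lim angular_limit_radial[OF t mlim])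
  moreover have "\<forall>\<^sub>F r in ?F. R (?p r) * herg t (?p r) * (g (?p r) / herg t (?p r)) = 1"
    using radial_in_disk[OF t]
  proof eventually_elim
    case (elim r)
    have "herg t (?p r) \<noteq> 0" using Re_herg_pos[OF t elim] by auto
    then show ?case using Rne[OF elim] by (simp add: g_def)
  qed
  ultimately have "((\<lambda>r. 1) \<longlongrightarrow> complex_of_real B * of_real m) ?F"
    by (rule Lim_transform_eventually)
  from tendsto_unique[OF trivial_limit_at_left_real this tendsto_const]
  \<comment> \<open>R herg and (1 / R) / herg have limits B and m along the radius and product 1:
    the zero of R at t and the mass of 1 / R there are reciprocal.\<close>
  have "complex_of_real (B * m) = of_real 1" by simp
  then have Bm: "B * m = 1" by (simp only: of_real_eq_iff)
  then have "m \<noteq> 0" by auto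
  then have mpos: "m > 0" using m0 by simp
  then show "B > 0" using Bm by (metis zero_less_mult_pos2 zero_less_one)
  have mB: "m = 1 / B" using Bm by (metis mult_zero_left nonzero_eq_divide_eq mult.commute zero_neq_one)
  show "1 / B \<le> Re (1 / R 0)" using m[of 0] t by (simp add: mB g_def)
  assume eq: "1 / B = Re (1 / R 0)" and z: "z \<in> unit_disk"
  \<comment> \<open>In the equality case 1 / R minus its kernel part has real part 0 at the centre,
    hence is an imaginary constant.\<close>
  define k where "k = (\<lambda>z. g z - of_real m * herg t z)"
  have "k holomorphic_on unit_disk" unfolding k_def by (intro holomorphic_intros holg t)
  moreover have "Re (k z) \<ge> 0" if "z \<in> unit_disk" for z using m[OF that] by (simp add: k_def)
  moreover have "Re (k 0) = 0" using eq t by (simp add: k_def g_def mB)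
  ultimately have "k z = k 0" using z by (intro Re_nonneg_constant) auto
  moreover have "k 0 = \<i> * of_real (Im (1 / R 0))"
    using eq t by (simp add: k_def g_def mB complex_eq_iff)
  ultimately have gz: "g z = of_real (Re (1 / R 0)) * herg t z + \<i> * of_real (Im (1 / R 0))"
    using eq by (simp add: k_def mB algebra_simps)
  have "R z * g z = 1" using Rne[OF z] by (simp add: g_def)
  then show "R z * (of_real (Re (1 / R 0)) * herg t z + \<i> * of_real (Im (1 / R 0))) = 1"
    unfolding gz .
qed

text \<open>With r = q - \<alpha> v one has v r / q = v - \<alpha> v^2 / q, so the claim is Re (v r
  / q) >= 0. For r nonzero v r / q is the reciprocal of \<alpha> / r + 1 / v, a sum with nonnegative
  real part. The lemma turns a mass of q into a bound on the field, the direction opposite to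
  \<open>brfp_mass\<close>.\<close>

lemma Re_square_quotient_le:
  fixes q v :: complex and \<alpha> :: real
  assumes \<alpha>: "\<alpha> > 0" and v: "Re v > 0" and q: "Re q \<ge> \<alpha> * Re v"
  shows "Re (v\<^sup>2 / q) \<le> Re v / \<alpha>"
proof -
  define r where "r = q - of_real \<alpha> * v"
  have rr: "Re r \<ge> 0" using q by (simp add: r_def)
  have v0: "v \<noteq> 0" using v by auto
  have "Re q > 0" using q v \<alpha> by (meson mult_pos_pos order_less_le_trans)
  then have q0: "q \<noteq> 0" by auto
  have "Re (v * r / q) \<ge> 0"
  proof (cases "r = 0")
    case False
    have nn: "Re (1 / x) \<ge> 0" if "Re x \<ge> 0" for x using that by (simp add: Re_divide')
    have "v * r / q = 1 / (of_real \<alpha> * (1 / r) + 1 / v)"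
      using False v0 q0 by (simp add: r_def field_simps)
    moreover have Re_lin: "Re (of_real \<alpha> * x + y) = \<alpha> * Re x + Re y" for x y by simp
    have "Re (of_real \<alpha> * (1 / r) + 1 / v) \<ge> 0"
      unfolding Re_lin by (intro add_nonneg_nonneg mult_nonneg_nonneg nn rr less_imp_le \<alpha> v)
    ultimately show ?thesis using nn by presburger
  qed simp
  moreover have "v * r / q = v - of_real \<alpha> * (v\<^sup>2 / q)"
    using q0 by (simp add: r_def field_simps power2_eq_square)
  moreover have "Re (v - of_real \<alpha> * x) = Re v - \<alpha> * Re x" for x by simp
  ultimately have "Re v - \<alpha> * Re (v\<^sup>2 / q) \<ge> 0" by metis
  then show ?thesis using \<alpha> by (simp add: field_simps)
qed

text \<open>Properness of the Koenigs function of a rational field. If \<kappa> = 0 its real part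
  grows like a positive multiple of ln |w|, as J is nonempty; otherwise the linear term dominates
  the logarithms.\<close>

lemma log_sum_proper:
  fixes c :: "'j \<Rightarrow> complex" and b :: "'j \<Rightarrow> real" and \<kappa> :: complex
  assumes J: "finite J" "J \<noteq> {}" and b: "\<And>j. j \<in> J \<Longrightarrow> b j > 0" and c: "\<And>j. j \<in> J \<Longrightarrow> Re (c j) \<le> 0"
  shows "\<exists>M. \<forall>w. Re w > 0 \<longrightarrow> cmod (\<kappa> * w + (\<Sum>j\<in>J. of_real (b j) * Ln (w - c j))) \<le> K \<longrightarrow> cmod w \<le> M"
proof -
  define C where "C = (\<Sum>j\<in>J. cmod (c j))"
  define B where "B = sum b J"
  have Cj: "cmod (c j) \<le> C" if "j \<in> J" for j
    unfolding C_def using J that by (intro member_le_sum) auto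
  have C0: "C \<ge> 0" unfolding C_def by (intro sum_nonneg) auto
  have B: "B > 0" unfolding B_def using J b by (intro sum_pos) auto
  have ne: "w - c j \<noteq> 0" if "Re w > 0" "j \<in> J" for w j
    using c[OF that(2)] that(1) by auto
  show ?thesis
  proof (cases "\<kappa> = 0")
    case True
    show ?thesis
    proof (intro exI allI impI)
      fix w assume w: "Re w > 0" and K: "cmod (\<kappa> * w + (\<Sum>j\<in>J. of_real (b j) * Ln (w - c j))) \<le> K"
      \<comment> \<open>Beyond this radius the real part, which is at least B ln (|w| - C), exceeds
        K.\<close>
      show "cmod w \<le> C + exp (K / B)"
      proof (rule ccontr)
        assume big: "\<not> cmod w \<le> C + exp (K / B)"
        have "exp (K / B) < cmod w - C" using big by simp
        then have "ln (exp (K / B)) < ln (cmod w - C)"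
          using exp_gt_zero[of "K / B"] by (subst ln_less_cancel_iff) linarith+
        then have "K / B < ln (cmod w - C)" by simp
        then have "K < B * ln (cmod w - C)" using B by (simp add: field_simps)
        also have "\<dots> = (\<Sum>j\<in>J. b j * ln (cmod w - C))" by (simp add: B_def sum_distrib_right)
        also have "\<dots> \<le> (\<Sum>j\<in>J. b j * ln (cmod (w - c j)))"
        proof (intro sum_mono mult_left_mono)
          fix j assume j: "j \<in> J"
          have "cmod w - C > 0" using big exp_gt_zero[of "K / B"] by linarith
          moreover have "cmod w - C \<le> cmod (w - c j)"
            using norm_triangle_ineq2[of w "c j"] Cj[OF j] by linarith
          ultimately show "ln (cmod w - C) \<le> ln (cmod (w - c j))"
            by (subst ln_le_cancel_iff) linarith+
        qed (use b in \<open>auto intro: less_imp_le\<close>)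
        also have "\<dots> = Re (\<Sum>j\<in>J. of_real (b j) * Ln (w - c j))"
          using ne[OF w] by simp
        also have "\<dots> \<le> K" using K complex_Re_le_cmod order_trans unfolding True by fastforce
        finally show False by simp
      qed
    qed
  next
    case False
    \<comment> \<open>With this slope the tangent bound ln x <= e x - 1 - ln e, summed with weights
      b, uses up only half of |\<kappa>| |w|; L is what the other half then allows.\<close>
    define e where "e = cmod \<kappa> / (2 * B)"
    have e: "e > 0" using False B by (simp add: e_def)
    define L where "L = 2 / cmod \<kappa> * (K + cmod \<kappa> * C / 2 + B * (pi - 1 - ln e))"
    show ?thesis
    proof (intro exI allI impI)
      fix w assume w: "Re w > 0" and K: "cmod (\<kappa> * w + (\<Sum>j\<in>J. of_real (b j) * Ln (w - c j))) \<le> K"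
      show "cmod w \<le> max (C + 1) L"
      proof (cases "cmod w \<le> C + 1")
        case False
        have "cmod (Ln (w - c j)) \<le> e * (cmod w + C) - 1 - ln e + pi" if j: "j \<in> J" for j
        proof -
          have l: "1 \<le> cmod (w - c j)"
            using norm_triangle_ineq2[of w "c j"] Cj[OF j] False by linarith
          have u: "cmod (w - c j) \<le> cmod w + C"
            using norm_triangle_ineq4[of w "c j"] Cj[OF j] by linarith
          have "cmod (Ln (w - c j)) \<le> \<bar>Re (Ln (w - c j))\<bar> + \<bar>Im (Ln (w - c j))\<bar>"
            by (rule cmod_le)
          also have "\<bar>Re (Ln (w - c j))\<bar> = ln (cmod (w - c j))"
            using ne[OF w j] l by simp
          also have "\<bar>Im (Ln (w - c j))\<bar> \<le> pi"
            using Im_Ln_le_pi[OF ne[OF w j]] mpi_less_Im_Ln[OF ne[OF w j]] by simp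
          also have "ln (cmod (w - c j)) \<le> ln (cmod w + C)"
            using l u by (subst ln_le_cancel_iff) linarith+
          also have "ln (cmod w + C) = ln (e * (cmod w + C)) - ln e"
            using e l u by (simp add: ln_mult)
          also have "ln (e * (cmod w + C)) \<le> e * (cmod w + C) - 1"
            using e l u by (intro ln_le_minus_one) auto
          finally show ?thesis by simp
        qed
        then have "cmod (\<Sum>j\<in>J. of_real (b j) * Ln (w - c j)) \<le> (\<Sum>j\<in>J. b j * (e * (cmod w + C) - 1 - ln e + pi))"
          using b by (intro sum_norm_le) (simp add: norm_mult less_imp_le abs_of_pos mult_left_mono)
        also have "\<dots> = B * (e * (cmod w + C) - 1 - ln e + pi)"
          by (simp add: B_def sum_distrib_right)
        also have "\<dots> = (B * e) * (cmod w + C) + B * (pi - 1 - ln e)"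
          by (simp add: algebra_simps)
        also have "B * e = cmod \<kappa> / 2" using B by (simp add: e_def)
        finally have "cmod (\<Sum>j\<in>J. of_real (b j) * Ln (w - c j)) \<le> cmod \<kappa> / 2 * (cmod w + C) + B * (pi - 1 - ln e)" .
        moreover have "cmod \<kappa> * cmod w \<le> K + cmod (\<Sum>j\<in>J. of_real (b j) * Ln (w - c j))"
          using norm_diff_ineq[of "\<kappa> * w" "\<Sum>j\<in>J. of_real (b j) * Ln (w - c j)"] K by (simp add: norm_mult)
        moreover have "cmod \<kappa> / 2 * (cmod w + C) = cmod \<kappa> * cmod w / 2 + cmod \<kappa> * C / 2"
          by (simp add: algebra_simps)
        ultimately have "cmod \<kappa> * cmod w / 2 \<le> K + cmod \<kappa> * C / 2 + B * (pi - 1 - ln e)"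
          by linarith
        then have "cmod w \<le> L" unfolding L_def using \<open>\<kappa> \<noteq> 0\<close> by (simp add: field_simps)
        then show ?thesis by simp
      qed simp
    qed
  qed
qed

text \<open>Partial fractions with positive residues and poles off the open half-plane keep Re q
  positive and integrate to logarithms.\<close>

lemma rational_flow:
  fixes c :: "'j \<Rightarrow> complex" and b :: "'j \<Rightarrow> real" and \<kappa> :: complex
  assumes t: "cmod t = 1"
    and J: "finite J" "J \<noteq> {}" and b: "\<And>j. j \<in> J \<Longrightarrow> b j > 0" and c: "\<And>j. j \<in> J \<Longrightarrow> Re (c j) \<le> 0"
    and \<kappa>: "Re \<kappa> \<ge> 0"
    and hol: "G holomorphic_on unit_disk"
    and G: "\<And>z. z \<in> unit_disk \<Longrightarrow> G z = (t - z)\<^sup>2 / (t * (\<kappa> + (\<Sum>j\<in>J. of_real (b j) / (herg t z - c j))))"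
  obtains \<phi> where "generates \<phi> G" "dw_point \<phi> t"
proof -
  \<comment> \<open>In the coordinate \<open>herg t\<close> the field is 2 / q, hence the factor
    1/2.\<close>
  define Q where "Q w = (\<kappa> + (\<Sum>j\<in>J. of_real (b j) / (w - c j))) / 2" for w
  define h where "h w = (\<kappa> * w + (\<Sum>j\<in>J. of_real (b j) * Ln (w - c j))) / 2" for w
  have Re_pos: "Re (w - c j) > 0" if "w \<in> half_plane" "j \<in> J" for w j
    using c[OF that(2)] that(1) by auto
  show ?thesis
  proof (rule disk_flow[OF t])
    show "(h has_field_derivative Q w) (at w)" if w: "w \<in> half_plane" for w
      unfolding h_def Q_def
    proof (rule DERIV_cdivide, rule DERIV_add)
      show "((\<lambda>w. \<kappa> * w) has_field_derivative \<kappa>) (at w)"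
        by (auto intro!: derivative_eq_intros)
      show "((\<lambda>w. \<Sum>j\<in>J. of_real (b j) * Ln (w - c j)) has_field_derivative (\<Sum>j\<in>J. of_real (b j) / (w - c j))) (at w)"
      proof (rule DERIV_sum)
        fix j assume j: "j \<in> J"
        have "w - c j \<notin> \<real>\<^sub>\<le>\<^sub>0" using Re_pos[OF w j] complex_nonpos_Reals_iff by fastforce
        then show "((\<lambda>w. of_real (b j) * Ln (w - c j)) has_field_derivative of_real (b j) / (w - c j)) (at w)"
          by (auto intro!: derivative_eq_intros simp: divide_inverse)
      qed
    qed
    show "Re (Q w) > 0" if w: "w \<in> half_plane" for w
    proof -
      have "Re (\<Sum>j\<in>J. of_real (b j) / (w - c j)) = (\<Sum>j\<in>J. Re (of_real (b j) / (w - c j)))" by simp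
      also have "\<dots> > 0"
      proof (intro sum_pos J)
        fix j assume j: "j \<in> J"
        have p: "Re (w - c j) > 0" by (rule Re_pos[OF w j])
        then have "w - c j \<noteq> 0" by (metis less_irrefl zero_complex.simps(1))
        then have "0 < b j * Re (w - c j) / (cmod (w - c j))\<^sup>2"
          using b[OF j] p by (intro divide_pos_pos mult_pos_pos) auto
        then show "Re (of_real (b j) / (w - c j)) > 0" by (simp add: Re_divide')
      qed
      finally show ?thesis using \<kappa> by (simp add: Q_def)
    qed
    fix e K :: real assume e: "e > 0"
    obtain M where M: "\<And>w. Re w > 0 \<Longrightarrow> cmod (\<kappa> * w + (\<Sum>j\<in>J. of_real (b j) * Ln (w - c j))) \<le> 2 * K \<Longrightarrow> cmod w \<le> M"
      using log_sum_proper[of J b c \<kappa> "2 * K", OF J b c] by blast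
    show "\<exists>M. \<forall>w. Re w \<ge> e \<longrightarrow> cmod (h w) \<le> K \<longrightarrow> cmod w \<le> M"
      using M e by (intro exI[of _ M]) (auto simp: h_def norm_divide)
  next
    show "G z = (t - z)\<^sup>2 / (2 * t * Q (herg t z))" if "z \<in> unit_disk" for z
      using G[OF that] by (simp add: Q_def)
  qed (use hol that in auto)
qed

section \<open>Generators with prescribed boundary fixed points\<close>

locale interpolation_data =
  fixes \<tau> :: complex and n :: nat and \<sigma> :: "nat \<Rightarrow> complex" and lam :: "nat \<Rightarrow> real"
  assumes n_pos: "n \<ge> 1"
    and sigma: "\<And>k. k < n \<Longrightarrow> cmod (\<sigma> k) = 1"
    and inj: "inj_on \<sigma> {..<n}"
    and lam: "\<And>k. k < n \<Longrightarrow> lam k < 0"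
    and tau: "cmod \<tau> = 1"
    and sigma_tau: "\<And>k. k < n \<Longrightarrow> \<sigma> k \<noteq> \<tau>"
begin

abbreviation "\<alpha> \<equiv> alpha \<tau> \<sigma> lam"
abbreviation "p \<equiv> p0 \<tau> n \<sigma> lam"
definition "A = (\<Sum>k<n. \<alpha> k)"
text \<open>Half the coefficient of 1 / \<open>herg \<tau>\<close> in the expansion of
  \<open>p\<close> at \<tau>; see \<open>p_radial\<close>.\<close>

definition "S = (\<Sum>k<n. 1 / \<bar>lam k\<bar>)"

lemma alpha_pos: "k < n \<Longrightarrow> \<alpha> k > 0"
  using lam[of k] sigma_tau[of k] unfolding alpha_def by (intro divide_pos_pos) auto

lemma A_pos: "A > 0"
  unfolding A_def using n_pos alpha_pos by (intro sum_pos) (auto simp: lessThan_empty_iff)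

lemma S_pos: "S > 0"
  unfolding S_def using n_pos lam by (intro sum_pos) (force simp: lessThan_empty_iff)+

lemma tau_0: "\<tau> \<noteq> 0"
  using tau by auto

lemma p_herg: "p z = (\<Sum>k<n. of_real (\<alpha> k) * herg (\<sigma> k) z)"
  by (simp add: p0_def herg_def)

lemma p_0: "p 0 = of_real A"
  unfolding p_herg A_def using sigma by simp

text \<open>This is where the imaginary shift in \<open>omega\<close> comes from: kernels are
  imaginary on the circle, and the factor |\<tau> - \<sigma> k|^2 of \<open>alpha\<close> cancels
  their denominator at \<tau>.\<close>

lemma p_tau: "p \<tau> = \<i> * of_real (\<Sum>k<n. (1 / \<bar>lam k\<bar>) * Im (cnj (\<sigma> k) * \<tau>))"
proof -
  have "of_real (\<alpha> k) * herg (\<sigma> k) \<tau> = \<i> * of_real ((1 / \<bar>lam k\<bar>) * Im (cnj (\<sigma> k) * \<tau>))" if k: "k < n" for k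
  proof -
    have d: "(cmod (\<sigma> k - \<tau>))\<^sup>2 \<noteq> 0" using sigma_tau[OF k] by simp
    have "Re (herg (\<sigma> k) \<tau>) = 0" by (rule Re_herg_unit[OF sigma[OF k] tau])
    moreover have "Im (herg (\<sigma> k) \<tau>) = 2 * Im (cnj (\<sigma> k) * \<tau>) / (cmod (\<sigma> k - \<tau>))\<^sup>2"
      unfolding herg_def Im_divide' by (simp add: algebra_simps)
    ultimately have "herg (\<sigma> k) \<tau> = \<i> * of_real (2 * Im (cnj (\<sigma> k) * \<tau>) / (cmod (\<sigma> k - \<tau>))\<^sup>2)"
      by (simp add: complex_eq_iff)
    moreover have "\<alpha> k * (2 * y / (cmod (\<sigma> k - \<tau>))\<^sup>2) = 1 / \<bar>lam k\<bar> * y" for y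
      using d lam[OF k] by (simp add: alpha_def norm_minus_commute[of \<tau>] field_simps)
    moreover have "of_real a * (\<i> * of_real b) = \<i> * of_real (a * b)" for a b by simp
    ultimately show ?thesis by (simp only:)
  qed
  then show ?thesis by (simp add: p_herg sum_distrib_left)
qed

lemma Re_p_tau: "Re (p \<tau>) = 0"
  by (simp add: p_tau)

lemma omega_eq: "omega \<tau> n \<sigma> lam \<zeta> = fw n lam (ell \<tau> n \<sigma> lam \<zeta> + p \<tau>)"
  by (simp add: omega_def p_tau)

text \<open>Termwise this is |\<tau> - s|^2 / 2 - i Im (cnj s \<tau>) = \<tau> cnj (\<tau> - s) for
  unit s and \<tau>. It turns the exceptional condition on 1 / cnj \<zeta> into the vanishing of
  \<open>ell\<close> + \<open>p \<tau>\<close>, that is, of R(0).\<close>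

lemma A_minus_p_tau: "of_real A - p \<tau> = \<tau> * cnj (\<Sum>k<n. of_real (1 / \<bar>lam k\<bar>) * (\<tau> - \<sigma> k))"
proof -
  have "of_real (\<alpha> k) - \<i> * of_real ((1 / \<bar>lam k\<bar>) * Im (cnj (\<sigma> k) * \<tau>))
      = of_real (1 / \<bar>lam k\<bar>) * (\<tau> * cnj (\<tau> - \<sigma> k))" if k: "k < n" for k
  proof -
    have n: "(Re \<tau>)\<^sup>2 + (Im \<tau>)\<^sup>2 = 1" "(Re (\<sigma> k))\<^sup>2 + (Im (\<sigma> k))\<^sup>2 = 1"
      using tau sigma[OF k] by (metis cmod_power2 power_one)+
    have "(cmod (\<tau> - \<sigma> k))\<^sup>2 / 2 = 1 - (Re \<tau> * Re (\<sigma> k) + Im \<tau> * Im (\<sigma> k))"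
      unfolding cmod_power2 minus_complex.simps power2_diff using n by argo
    moreover have "Re \<tau> * Re \<tau> + Im \<tau> * Im \<tau> = 1"
      using n(1) by (simp add: power2_eq_square)
    ultimately have "of_real ((cmod (\<tau> - \<sigma> k))\<^sup>2 / 2) - \<i> * of_real (Im (cnj (\<sigma> k) * \<tau>)) = \<tau> * cnj (\<tau> - \<sigma> k)"
      by (simp add: complex_eq_iff algebra_simps)
    moreover have "\<alpha> k = 1 / \<bar>lam k\<bar> * ((cmod (\<tau> - \<sigma> k))\<^sup>2 / 2)" by (simp add: alpha_def)
    moreover have "of_real (c * d) - \<i> * of_real (c * e) = of_real c * (of_real d - \<i> * of_real e)" for c d e
      by (simp add: algebra_simps)
    ultimately show ?thesis by (simp only:)
  qed
  then have "(\<Sum>k<n. of_real (\<alpha> k) - \<i> * of_real ((1 / \<bar>lam k\<bar>) * Im (cnj (\<sigma> k) * \<tau>)))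
     = (\<Sum>k<n. of_real (1 / \<bar>lam k\<bar>) * (\<tau> * cnj (\<tau> - \<sigma> k)))"
    by (intro sum.cong) auto
  then show ?thesis
    unfolding p_tau A_def by (simp add: sum_subtractf sum_distrib_left mult_ac)
qed

lemma p_holomorphic: "p holomorphic_on unit_disk"
  unfolding p_herg[abs_def] using sigma by (intro holomorphic_intros) auto

lemma Re_p: "Re (p z) = (\<Sum>k<n. \<alpha> k * Re (herg (\<sigma> k) z))"
  by (simp add: p_herg)

lemma Re_p_ge:
  assumes k: "k < n" and z: "z \<in> unit_disk" shows "Re (p z) \<ge> \<alpha> k * Re (herg (\<sigma> k) z)"
  unfolding Re_p using k alpha_pos Re_herg_pos[OF sigma z]
  by (intro member_le_sum) (auto intro: less_imp_le)

lemma Re_p_pos: "z \<in> unit_disk \<Longrightarrow> Re (p z) > 0"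
  unfolding Re_p using n_pos alpha_pos Re_herg_pos[OF sigma]
  by (intro sum_pos) (auto simp: lessThan_empty_iff)

text \<open>Partial fractions in the coordinate \<open>herg \<tau>\<close>: by
  \<open>herg_diff_mult\<close> each kernel less its value at \<tau> is a simple pole, and the
  weight \<open>alpha\<close> makes its residue 2 / |lam k|.\<close>

lemma p_pole_form:
  assumes z: "z \<in> unit_disk"
  shows "p z - p \<tau> = (\<Sum>k<n. of_real (2 / \<bar>lam k\<bar>) / (herg \<tau> z - herg \<tau> (\<sigma> k)))"
proof -
  have "of_real (\<alpha> k) * (herg (\<sigma> k) z - herg (\<sigma> k) \<tau>) = of_real (2 / \<bar>lam k\<bar>) / (herg \<tau> z - herg \<tau> (\<sigma> k))"
    if k: "k < n" for k
  proof -
    have "Re (herg \<tau> z - herg \<tau> (\<sigma> k)) > 0"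
      using Re_herg_pos[OF tau z] Re_herg_unit[OF tau sigma[OF k]] by simp
    then have ne: "herg \<tau> z - herg \<tau> (\<sigma> k) \<noteq> 0" by (metis less_irrefl zero_complex.simps(1))
    have m: "(herg (\<sigma> k) z - herg (\<sigma> k) \<tau>) * (herg \<tau> z - herg \<tau> (\<sigma> k)) = of_real (4 / (cmod (\<sigma> k - \<tau>))\<^sup>2)"
      by (rule herg_diff_mult[OF sigma[OF k] tau sigma_tau[OF k] disk_ne_unit[OF sigma[OF k] z] disk_ne_unit[OF tau z]])
    have "\<alpha> k * (4 / (cmod (\<sigma> k - \<tau>))\<^sup>2) = 2 / \<bar>lam k\<bar>"
      using sigma_tau[OF k] lam[OF k] by (simp add: alpha_def norm_minus_commute[of \<tau>] field_simps)
    then have "of_real (\<alpha> k) * (herg (\<sigma> k) z - herg (\<sigma> k) \<tau>) * (herg \<tau> z - herg \<tau> (\<sigma> k)) = of_real (2 / \<bar>lam k\<bar>)"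
      unfolding mult.assoc m by (metis of_real_mult)
    then show ?thesis using nonzero_eq_divide_eq[OF ne] by blast
  qed
  then show ?thesis
    unfolding p_herg by (simp add: sum_subtractf[symmetric] right_diff_distrib[symmetric])
qed

lemma p_radial:
  "((\<lambda>r. (p (of_real r * \<tau>) - p \<tau>) * herg \<tau> (of_real r * \<tau>)) \<longlongrightarrow> of_real (2 * S)) (at_left (1::real))"
proof -
  let ?F = "at_left (1::real)" and ?z = "\<lambda>r. of_real r * \<tau>"
  have "((\<lambda>r. \<Sum>k<n. of_real (2 / \<bar>lam k\<bar>) / (1 - herg \<tau> (\<sigma> k) * inverse (herg \<tau> (?z r))))
      \<longlongrightarrow> (\<Sum>k<n. of_real (2 / \<bar>lam k\<bar>) / (1 - herg \<tau> (\<sigma> k) * 0))) ?F"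
    by (intro tendsto_intros inverse_herg_radial[OF tau]) auto
  moreover have "(\<Sum>k<n. of_real (2 / \<bar>lam k\<bar>) / (1 - herg \<tau> (\<sigma> k) * 0)) = complex_of_real (2 * S)"
    by (simp add: S_def sum_distrib_left)
  moreover have "\<forall>\<^sub>F r in ?F. (\<Sum>k<n. of_real (2 / \<bar>lam k\<bar>) / (1 - herg \<tau> (\<sigma> k) * inverse (herg \<tau> (?z r))))
      = (p (?z r) - p \<tau>) * herg \<tau> (?z r)"
    using radial_in_disk[OF tau]
  proof eventually_elim
    case (elim r)
    have K: "herg \<tau> (?z r) \<noteq> 0" using Re_herg_pos[OF tau elim] by auto
    have frac: "c / (1 - y * inverse x) = c / (x - y) * x" if "x \<noteq> 0" for c x y :: complex
      using that by (simp add: field_simps)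
    show ?case
      unfolding p_pole_form[OF elim] sum_distrib_right by (intro sum.cong refl frac K)
  qed
  ultimately show ?thesis using Lim_transform_eventually by fastforce
qed

section \<open>The disk Z in the coordinate ell\<close>

lemma Zset_cball: "Zset \<tau> n \<sigma> lam = cball (\<tau> / of_real (2 * A)) (1 / (2 * A))"
proof -
  have "cmod ((2 * inverse \<tau> * complex_of_real A) * \<zeta> - 1) = 2 * A * dist (\<tau> / of_real (2 * A)) \<zeta>" for \<zeta>
  proof -
    have "(2 * inverse \<tau> * complex_of_real A) * \<zeta> - 1 = of_real (2 * A) * inverse \<tau> * (\<zeta> - \<tau> / of_real (2 * A))"
      using A_pos tau_0 by (simp add: field_simps)
    then have "cmod ((2 * inverse \<tau> * complex_of_real A) * \<zeta> - 1) = 2 * A * cmod (\<zeta> - \<tau> / of_real (2 * A))"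
      using A_pos tau by (simp add: norm_mult norm_inverse)
    then show ?thesis by (simp add: dist_norm norm_minus_commute)
  qed
  then show ?thesis
    unfolding Zset_def A_def[symmetric] using A_pos by (auto simp: field_simps)
qed

text \<open>The boundary circle of Z passes through 0, so the inversion \<tau> / \<zeta> carries the
  disk to the half-plane Re >= A.\<close>

lemma dist_Z:
  assumes "\<zeta> \<noteq> 0"
  shows "dist (\<tau> / of_real (2 * A)) \<zeta> < 1 / (2 * A) \<longleftrightarrow> Re (\<tau> / \<zeta>) > A"
    and "dist (\<tau> / of_real (2 * A)) \<zeta> \<le> 1 / (2 * A) \<longleftrightarrow> Re (\<tau> / \<zeta>) \<ge> A"
proof -
  define d where "d = dist (\<tau> / of_real (2 * A)) \<zeta>"
  have z: "(cmod \<zeta>)\<^sup>2 > 0" using assms by simp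
  have "\<tau> / of_real (2 * A) - \<zeta> = (\<tau> - of_real (2 * A) * \<zeta>) / of_real (2 * A)"
    using A_pos by (simp add: field_simps)
  then have d: "2 * A * d = cmod (\<tau> - of_real (2 * A) * \<zeta>)"
    using A_pos by (simp add: d_def dist_norm norm_divide)
  have t: "(Re \<tau>)\<^sup>2 + (Im \<tau>)\<^sup>2 = 1" using tau by (metis cmod_power2 power_one)
  have "(2 * A * d)\<^sup>2 = (Re \<tau>)\<^sup>2 + (Im \<tau>)\<^sup>2 + 4 * A * (A * (cmod \<zeta>)\<^sup>2 - (Re \<tau> * Re \<zeta> + Im \<tau> * Im \<zeta>))"
    unfolding d cmod_power2 by (simp add: power2_eq_square algebra_simps)
  also have "Re \<tau> * Re \<zeta> + Im \<tau> * Im \<zeta> = Re (\<tau> / \<zeta>) * (cmod \<zeta>)\<^sup>2"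
    using z by (simp add: Re_divide')
  finally have e: "(2 * A * d)\<^sup>2 = 1 + 4 * A * (cmod \<zeta>)\<^sup>2 * (A - Re (\<tau> / \<zeta>))"
    using t by (simp add: algebra_simps)
  have x: "x < 1 \<longleftrightarrow> x\<^sup>2 < 1" "x \<le> 1 \<longleftrightarrow> x\<^sup>2 \<le> 1" if "x \<ge> 0" for x :: real
    using that by (simp_all add: power_less_one_iff power_le_one_iff)
  have dn: "2 * A * d \<ge> 0" using A_pos by (simp add: d_def)
  have c: "4 * A * (cmod \<zeta>)\<^sup>2 > 0" using A_pos z by simp
  have sgn_c: "4 * A * (cmod \<zeta>)\<^sup>2 * x < 0 \<longleftrightarrow> x < 0" "4 * A * (cmod \<zeta>)\<^sup>2 * x \<le> 0 \<longleftrightarrow> x \<le> 0" for x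
    using mult_less_cancel_left_pos[OF c, of x 0] mult_le_cancel_left_pos[OF c, of x 0] by simp_all
  have "d < 1 / (2 * A) \<longleftrightarrow> 2 * A * d < 1" using A_pos by (simp add: field_simps)
  also have "\<dots> \<longleftrightarrow> 4 * A * (cmod \<zeta>)\<^sup>2 * (A - Re (\<tau> / \<zeta>)) < 0"
    unfolding x(1)[OF dn] e by simp
  also have "\<dots> \<longleftrightarrow> Re (\<tau> / \<zeta>) > A"
    unfolding sgn_c(1) by simp
  finally show "dist (\<tau> / of_real (2 * A)) \<zeta> < 1 / (2 * A) \<longleftrightarrow> Re (\<tau> / \<zeta>) > A"
    unfolding d_def .
  have "d \<le> 1 / (2 * A) \<longleftrightarrow> 2 * A * d \<le> 1" using A_pos by (simp add: field_simps)
  also have "\<dots> \<longleftrightarrow> 4 * A * (cmod \<zeta>)\<^sup>2 * (A - Re (\<tau> / \<zeta>)) \<le> 0"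
    unfolding x(2)[OF dn] e by simp
  also have "\<dots> \<longleftrightarrow> Re (\<tau> / \<zeta>) \<ge> A"
    unfolding sgn_c(2) by simp
  finally show "dist (\<tau> / of_real (2 * A)) \<zeta> \<le> 1 / (2 * A) \<longleftrightarrow> Re (\<tau> / \<zeta>) \<ge> A"
    unfolding d_def .
qed

lemma dist_Z_0: "dist (\<tau> / of_real (2 * A)) 0 = 1 / (2 * A)"
  using A_pos tau by (simp add: norm_divide)

lemma Re_ell: "Re (ell \<tau> n \<sigma> lam \<zeta>) = Re (\<tau> / \<zeta>) - A"
  by (simp add: ell_def A_def)

lemma interior_Zset_iff: "\<zeta> \<in> interior (Zset \<tau> n \<sigma> lam) \<longleftrightarrow> \<zeta> \<noteq> 0 \<and> Re (ell \<tau> n \<sigma> lam \<zeta>) > 0"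
  using dist_Z(1)[of \<zeta>] dist_Z_0 unfolding Zset_cball interior_cball mem_ball Re_ell by (cases "\<zeta> = 0") auto

lemma Zset_iff: "\<zeta> \<in> Zset \<tau> n \<sigma> lam \<longleftrightarrow> \<zeta> = 0 \<or> Re (ell \<tau> n \<sigma> lam \<zeta>) \<ge> 0"
  using dist_Z(2)[of \<zeta>] dist_Z_0 unfolding Zset_cball mem_cball Re_ell by (cases "\<zeta> = 0") auto

lemma boundary_condition:
  assumes "\<zeta> \<noteq> 0"
  shows "1 / cnj \<zeta> = (\<Sum>k<n. complex_of_real (1 / \<bar>lam k\<bar>) * (\<tau> - \<sigma> k)) \<longleftrightarrow> ell \<tau> n \<sigma> lam \<zeta> + p \<tau> = 0"
proof -
  let ?X = "\<Sum>k<n. complex_of_real (1 / \<bar>lam k\<bar>) * (\<tau> - \<sigma> k)"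
  have "1 / cnj \<zeta> = ?X \<longleftrightarrow> cnj (1 / cnj \<zeta>) = cnj ?X" by (simp only: complex_cnj_cancel_iff)
  also have "\<dots> \<longleftrightarrow> \<tau> / \<zeta> = \<tau> * cnj ?X" using tau_0 by (simp add: divide_inverse)
  also have "\<dots> \<longleftrightarrow> \<tau> / \<zeta> = of_real A - p \<tau>" by (simp only: A_minus_p_tau)
  also have "\<dots> \<longleftrightarrow> ell \<tau> n \<sigma> lam \<zeta> + p \<tau> = 0"
    unfolding ell_def A_def[symmetric] by (auto simp: algebra_simps)
  finally show ?thesis .
qed

section \<open>Parametrization of the generators by R\<close>

text \<open>\<open>p \<tau>\<close> is imaginary; subtracting it makes the kernels vanish at \<open>\<tau>\<close>, so that the spectral
  value at \<open>\<tau>\<close> is positive only if \<open>R\<close> vanishes there, too.\<close>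
definition "denom_of R z = R z + (p z - p \<tau>)"
definition "gen_of R z = (\<tau> - z)\<^sup>2 / (\<tau> * denom_of R z)"

lemma Re_denom_of_pos: "Re (R z) \<ge> 0 \<Longrightarrow> z \<in> unit_disk \<Longrightarrow> Re (denom_of R z) > 0"
  using Re_p_pos[of z] by (simp add: denom_of_def Re_p_tau)

lemma denom_of_nonzero: "Re (R z) \<ge> 0 \<Longrightarrow> z \<in> unit_disk \<Longrightarrow> denom_of R z \<noteq> 0"
  using Re_denom_of_pos[of R z] by auto

lemma denom_of_holomorphic: "R holomorphic_on unit_disk \<Longrightarrow> denom_of R holomorphic_on unit_disk"
  unfolding denom_of_def by (intro holomorphic_intros p_holomorphic)

lemma gen_of_holomorphic:
  assumes "R holomorphic_on unit_disk" "\<And>z. z \<in> unit_disk \<Longrightarrow> Re (R z) \<ge> 0"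
  shows "gen_of R holomorphic_on unit_disk"
  unfolding gen_of_def using assms tau_0 denom_of_nonzero
  by (intro holomorphic_intros denom_of_holomorphic) auto

text \<open>The value at 0 is \<tau> / (R 0 + A - p \<tau>), so prescribing \<zeta> amounts to
  prescribing R 0, whose real part is that of \<open>ell\<close>.\<close>

lemma gen_of_0: "R 0 = ell \<tau> n \<sigma> lam \<zeta> + p \<tau> \<Longrightarrow> \<zeta> \<noteq> 0 \<Longrightarrow> gen_of R 0 = \<zeta>"
  using tau_0 by (simp add: gen_of_def denom_of_def p_0 ell_def A_def[symmetric] power2_eq_square)

lemma R_0_eq:
  assumes "gen_of R 0 = \<zeta>" "\<zeta> \<noteq> 0" shows "R 0 = ell \<tau> n \<sigma> lam \<zeta> + p \<tau>"
proof -
  have \<zeta>: "\<zeta> = \<tau> / denom_of R 0" using assms(1) tau_0 by (simp add: gen_of_def power2_eq_square)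
  then have "denom_of R 0 \<noteq> 0" using assms(2) by auto
  then have "\<zeta> * denom_of R 0 = \<tau>" using \<zeta> by (simp add: field_simps)
  then have "denom_of R 0 = \<tau> / \<zeta>" using assms(2) by (metis nonzero_mult_div_cancel_left)
  then show ?thesis by (simp add: denom_of_def p_0 ell_def A_def[symmetric] algebra_simps)
qed

lemma herg_field_tau:
  assumes z: "z \<in> unit_disk" and G: "G z = gen_of R z"
  shows "herg_field \<tau> G z = 2 / denom_of R z"
proof -
  have "(\<tau> - z)\<^sup>2 \<noteq> 0" using disk_ne_unit[OF tau z] by simp
  then show ?thesis unfolding herg_field_def G gen_of_def using tau_0 by simp
qed

lemma generator_representation:
  assumes gen: "generates \<phi> G" and dw: "dw_point \<phi> \<tau>"
    and b: "\<And>k. k < n \<Longrightarrow> \<exists>l. lam k \<le> l \<and> l \<le> 0 \<and> brfp \<phi> (\<sigma> k) l"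
    and nz: "\<not> (\<forall>z\<in>unit_disk. G z = 0)"
  obtains R where "R holomorphic_on unit_disk" "\<And>z. z \<in> unit_disk \<Longrightarrow> Re (R z) \<ge> 0"
    "\<And>z. z \<in> unit_disk \<Longrightarrow> G z = gen_of R z"
proof -
  have holG: "G holomorphic_on unit_disk" using gen by (simp add: generates_def)
  define P where "P = herg_field \<tau> G"
  have Pnn: "Re (P z) \<ge> 0" if "z \<in> unit_disk" for z
    unfolding P_def by (rule herg_field_dw_nonneg[OF gen dw that])
  have holP: "P holomorphic_on unit_disk"
    unfolding P_def herg_field_def using disk_ne_unit[OF tau] holG by (intro holomorphic_intros) auto
  have PG: "G z = P z * (\<tau> - z)\<^sup>2 / (2 * \<tau>)" if "z \<in> unit_disk" for z
    using disk_ne_unit[OF tau that] tau_0 by (simp add: P_def herg_field_def)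
  \<comment> \<open>A zero of the field would make it vanish identically by the minimum principle,
    so 2 / P is defined on the whole disk.\<close>
  have Pne: "P z \<noteq> 0" if z: "z \<in> unit_disk" for z
  proof
    assume 0: "P z = 0"
    have "P x = 0" if "x \<in> unit_disk" for x
      using Re_nonneg_constant[OF holP Pnn z _ that] 0 by simp
    then show False using nz PG by simp
  qed
  define q where "q z = 2 / P z" for z
  have holq: "q holomorphic_on unit_disk"
    unfolding q_def using holP Pne by (intro holomorphic_intros) auto
  have qnn: "Re (q z) \<ge> 0" if "z \<in> unit_disk" for z
    using Pnn[OF that] by (simp add: q_def Re_divide')
  have qne: "q z \<noteq> 0" if "z \<in> unit_disk" for z
    using Pne[OF that] by (simp add: q_def)
  have Gq: "G z = (\<tau> - z)\<^sup>2 / (\<tau> * q z)" if "z \<in> unit_disk" for z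
    using PG[OF that] Pne[OF that] tau_0 by (simp add: q_def field_simps)
  have mass: "Re (q z) \<ge> \<alpha> k * Re (herg (\<sigma> k) z)" if k: "k < n" and z: "z \<in> unit_disk" for k z
  proof -
    obtain l where l: "lam k \<le> l" "brfp \<phi> (\<sigma> k) l" using b[OF k] by blast
    show ?thesis
      unfolding alpha_def
      by (rule brfp_mass[OF gen l(2,1) lam[OF k] tau sigma_tau[OF k] holq qnn qne Gq z])
  qed
  have sums: "Re (q z) \<ge> (\<Sum>k<n. \<alpha> k * Re (herg (\<sigma> k) z))" if "z \<in> unit_disk" for z
    by (rule sum_of_masses[OF sigma inj holq qnn mass that])
  define R where "R z = q z - (p z - p \<tau>)" for z
  show ?thesis
  proof (rule that[of R])
    show "R holomorphic_on unit_disk"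
      unfolding R_def by (intro holomorphic_intros holq p_holomorphic)
    show "Re (R z) \<ge> 0" if "z \<in> unit_disk" for z
      using sums[OF that] by (simp add: R_def Re_p_tau Re_p[of z])
    show "G z = gen_of R z" if "z \<in> unit_disk" for z
      using Gq[OF that] by (simp add: gen_of_def denom_of_def R_def)
  qed
qed

section \<open>The spectral value at \<tau>\<close>

text \<open>In the coordinate \<open>herg \<tau>\<close> the field is 2 / denom_of R, with
  nonnegative real part. The limit therefore exists by \<open>boundary_fixed_point\<close>, and the
  later lemmas have only to identify it.\<close>

lemma spectral_value_radial:
  assumes gen: "generates \<phi> G"
    and R: "\<And>z. z \<in> unit_disk \<Longrightarrow> Re (R z) \<ge> 0" and G: "\<And>z. z \<in> unit_disk \<Longrightarrow> G z = gen_of R z"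
  shows "spectral_value \<tau> G \<ge> 0"
    and "((\<lambda>r. 2 / (denom_of R (of_real r * \<tau>) * herg \<tau> (of_real r * \<tau>))) \<longlongrightarrow> of_real (spectral_value \<tau> G)) (at_left (1::real))"
    and "((\<lambda>r. 2 / (denom_of R (of_real r * \<tau>) * herg \<tau> (of_real r * \<tau>))) \<longlongrightarrow> of_real l) (at_left (1::real))
        \<Longrightarrow> spectral_value \<tau> G = l"
proof -
  have k0: "Re (herg_field \<tau> G z) \<ge> 0 * Re (herg \<tau> z)" if z: "z \<in> unit_disk" for z
    using Re_denom_of_pos[of R z, OF R[OF z] z] unfolding herg_field_tau[of z G R, OF z G[OF z]] by (simp add: Re_divide')
  obtain m where m: "m \<ge> 0" "angular_limit (\<lambda>z. herg_field \<tau> G z / herg \<tau> z) \<tau> (of_real m)"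
    by (rule boundary_fixed_point[OF gen tau k0]) (assumption, rule that)
  note rl = angular_limit_radial[OF tau m(2)]
  have sv: "spectral_value \<tau> G = m"
    by (rule spectral_value_eqI[OF gen tau k0 rl])
  then show "spectral_value \<tau> G \<ge> 0" using m by simp
  have ev: "\<forall>\<^sub>F r in at_left (1::real). herg_field \<tau> G (of_real r * \<tau>) / herg \<tau> (of_real r * \<tau>)
      = 2 / (denom_of R (of_real r * \<tau>) * herg \<tau> (of_real r * \<tau>))"
    using radial_in_disk[OF tau]
    by (rule eventually_mono) (simp add: herg_field_tau[of _ G R, OF _ G] del: mem_ball)
  show lim: "((\<lambda>r. 2 / (denom_of R (of_real r * \<tau>) * herg \<tau> (of_real r * \<tau>))) \<longlongrightarrow> of_real (spectral_value \<tau> G)) (at_left (1::real))"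
    unfolding sv by (rule Lim_transform_eventually[OF rl ev])
  show "spectral_value \<tau> G = l"
    if "((\<lambda>r. 2 / (denom_of R (of_real r * \<tau>) * herg \<tau> (of_real r * \<tau>))) \<longlongrightarrow> of_real l) (at_left (1::real))"
    using tendsto_unique[OF trivial_limit_at_left_real lim that] by (simp only: of_real_eq_iff)
qed

lemma spectral_value_of_limit:
  assumes gen: "generates \<phi> G"
    and R: "\<And>z. z \<in> unit_disk \<Longrightarrow> Re (R z) \<ge> 0" and G: "\<And>z. z \<in> unit_disk \<Longrightarrow> G z = gen_of R z"
    and B: "B \<ge> 0"
    and lim: "((\<lambda>r. R (of_real r * \<tau>) * herg \<tau> (of_real r * \<tau>)) \<longlongrightarrow> of_real B) (at_left (1::real))"
  shows "spectral_value \<tau> G = 2 / (B + 2 * S)"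
proof (rule spectral_value_radial(3)[OF gen R G])
  have "((\<lambda>r. 2 / (R (of_real r * \<tau>) * herg \<tau> (of_real r * \<tau>)
        + (p (of_real r * \<tau>) - p \<tau>) * herg \<tau> (of_real r * \<tau>)))
      \<longlongrightarrow> 2 / (of_real B + of_real (2 * S))) (at_left (1::real))"
  proof (intro tendsto_divide tendsto_add tendsto_const lim p_radial)
    have "B + 2 * S \<noteq> 0" using B S_pos by simp
    then show "complex_of_real B + of_real (2 * S) \<noteq> 0"
      by (metis of_real_add of_real_eq_0_iff)
  qed
  then show "((\<lambda>r. 2 / (denom_of R (of_real r * \<tau>) * herg \<tau> (of_real r * \<tau>)))
      \<longlongrightarrow> of_real (2 / (B + 2 * S))) (at_left (1::real))"
    by (simp add: denom_of_def distrib_right)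
qed

text \<open>A nonzero constant R makes the denominator times \<open>herg \<tau>\<close> unbounded.
  It supplies the lower end 0 of the intervals and the value at the ordinary boundary points of
  Z.\<close>

lemma spectral_value_const:
  assumes gen: "generates \<phi> G" and \<kappa>: "Re \<kappa> \<ge> 0" "\<kappa> \<noteq> 0"
    and R: "\<And>z. z \<in> unit_disk \<Longrightarrow> R z = \<kappa>" and G: "\<And>z. z \<in> unit_disk \<Longrightarrow> G z = gen_of R z"
  shows "spectral_value \<tau> G = 0"
proof (rule spectral_value_radial(3)[OF gen _ G])
  show "Re (R z) \<ge> 0" if "z \<in> unit_disk" for z using R[OF that] \<kappa> by simp
  let ?F = "at_left (1::real)" and ?z = "\<lambda>r. of_real r * \<tau>"
  have u: "((\<lambda>r. inverse (herg \<tau> (?z r))) \<longlongrightarrow> 0) ?F" by (rule inverse_herg_radial[OF tau])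
  have "((\<lambda>r. (p (?z r) - p \<tau>) * herg \<tau> (?z r) * inverse (herg \<tau> (?z r))) \<longlongrightarrow> of_real (2 * S) * 0) ?F"
    by (intro tendsto_mult p_radial u)
  then have v: "((\<lambda>r. (p (?z r) - p \<tau>) * herg \<tau> (?z r) * inverse (herg \<tau> (?z r))) \<longlongrightarrow> 0) ?F" by simp
  have "((\<lambda>r. 2 / (\<kappa> + (p (?z r) - p \<tau>) * herg \<tau> (?z r) * inverse (herg \<tau> (?z r))) * inverse (herg \<tau> (?z r)))
      \<longlongrightarrow> 2 / (\<kappa> + 0) * 0) ?F"
    by (rule tendsto_mult[OF tendsto_divide[OF tendsto_const tendsto_add[OF tendsto_const v]] u]) (use \<kappa> in auto)
  moreover have "\<forall>\<^sub>F r in ?F. 2 / (\<kappa> + (p (?z r) - p \<tau>) * herg \<tau> (?z r) * inverse (herg \<tau> (?z r))) * inverse (herg \<tau> (?z r))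
      = 2 / (denom_of R (?z r) * herg \<tau> (?z r))"
    using radial_in_disk[OF tau]
  proof eventually_elim
    case (elim r)
    have "herg \<tau> (?z r) \<noteq> 0" using Re_herg_pos[OF tau elim] by auto
    then show ?case using R[OF elim] by (simp add: denom_of_def divide_inverse mult.assoc)
  qed
  ultimately show "((\<lambda>r. 2 / (denom_of R (?z r) * herg \<tau> (?z r))) \<longlongrightarrow> of_real 0) ?F"
    using Lim_transform_eventually by fastforce
qed

text \<open>A limit B of R \<open>herg \<tau>\<close> gives the spectral value 2 / (B + 2 S), which
  decreases in B; f w is its value at B = 1 / Re (1 / w), the least B that Julia's inequality allows
  when R 0 = w.\<close>

lemma fw_eq: "Re w > 0 \<Longrightarrow> fw n lam w = 2 / (1 / Re (1 / w) + 2 * S)"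
proof -
  assume w: "Re w > 0"
  then have c: "(cmod w)\<^sup>2 > 0" by auto
  have "1 / Re (1 / w) = (cmod w)\<^sup>2 / Re w" by (simp add: Re_divide')
  then have "1 / Re (1 / w) + 2 * S = ((cmod w)\<^sup>2 + 2 * Re w * S) / Re w"
    using w by (simp add: add_divide_distrib)
  then show ?thesis unfolding fw_def S_def[symmetric] by simp
qed

text \<open>If the spectral value l is positive, R \<open>herg \<tau>\<close> has the radial limit B
  = 2 / l - 2 S and both claims are those of \<open>boundary_zero_derivative\<close>. If l = 0 the
  bound is strict, since f is positive.\<close>

lemma spectral_value_bound:
  assumes gen: "generates \<phi> G" and holR: "R holomorphic_on unit_disk"
    and R: "\<And>z. z \<in> unit_disk \<Longrightarrow> Re (R z) \<ge> 0" and G: "\<And>z. z \<in> unit_disk \<Longrightarrow> G z = gen_of R z"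
    and R0: "Re (R 0) > 0"
  shows "spectral_value \<tau> G \<le> fw n lam (R 0)"
    and "spectral_value \<tau> G = fw n lam (R 0) \<Longrightarrow> z \<in> unit_disk \<Longrightarrow>
      R z * (of_real (Re (1 / R 0)) * herg \<tau> z + \<i> * of_real (Im (1 / R 0))) = 1"
proof -
  define l where "l = spectral_value \<tau> G"
  have l0: "l \<ge> 0" unfolding l_def by (rule spectral_value_radial(1)[OF gen R G])
  have Rinv: "Re (1 / R 0) > 0"
  proof -
    have "R 0 \<noteq> 0" using R0 by auto
    then show ?thesis using R0 by (simp add: Re_divide')
  qed
  have fpos: "fw n lam (R 0) > 0"
    unfolding fw_eq[OF R0] using Rinv S_pos by (simp add: add_pos_pos)
  have "(l \<le> fw n lam (R 0)) \<and> (l = fw n lam (R 0) \<longrightarrow> (\<forall>z\<in>unit_disk.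
      R z * (of_real (Re (1 / R 0)) * herg \<tau> z + \<i> * of_real (Im (1 / R 0))) = 1))"
  proof (cases "l = 0")
    case True then show ?thesis using fpos by simp
  next
    case False
    define B where "B = 2 / l - 2 * S"
    have "((\<lambda>r. 2 / (2 / (denom_of R (of_real r * \<tau>) * herg \<tau> (of_real r * \<tau>)))
          - (p (of_real r * \<tau>) - p \<tau>) * herg \<tau> (of_real r * \<tau>)) \<longlongrightarrow> 2 / of_real l - of_real (2 * S)) (at_left (1::real))"
      by (intro tendsto_diff tendsto_divide tendsto_const p_radial
           spectral_value_radial(2)[OF gen R G, folded l_def]) (use False in auto)
    moreover have "2 / (2 / (denom_of R z * herg \<tau> z)) - (p z - p \<tau>) * herg \<tau> z = R z * herg \<tau> z" for z
    proof -
      have "2 / (2 / x) = x" for x :: complex by simp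
      moreover have "denom_of R z * herg \<tau> z - (p z - p \<tau>) * herg \<tau> z = R z * herg \<tau> z"
        by (simp add: denom_of_def distrib_right)
      ultimately show ?thesis by (simp only:)
    qed
    ultimately have lim: "((\<lambda>r. R (of_real r * \<tau>) * herg \<tau> (of_real r * \<tau>)) \<longlongrightarrow> of_real B) (at_left (1::real))"
      by (simp add: B_def)
    note J = boundary_zero_derivative[OF tau holR R R0 lim]
    have lB: "l = 2 / (B + 2 * S)" using False by (simp add: B_def)
    have "1 / Re (1 / R 0) \<le> B" using J(1,2) Rinv by (simp add: field_simps)
    then have "l \<le> fw n lam (R 0)"
      unfolding lB fw_eq[OF R0] using Rinv S_pos J(1) by (intro divide_left_mono mult_pos_pos add_pos_pos) auto
    moreover have "1 / B = Re (1 / R 0)" if "l = fw n lam (R 0)"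
    proof -
      have "2 / (B + 2 * S) = 2 / (1 / Re (1 / R 0) + 2 * S)" using that lB fw_eq[OF R0] by simp
      moreover have "x = y" if "2 / x = 2 / y" for x y :: real using that by simp
      ultimately have "B + 2 * S = 1 / Re (1 / R 0) + 2 * S" by blast
      then show ?thesis by simp
    qed
    ultimately show ?thesis using J(3) by blast
  qed
  then show "spectral_value \<tau> G \<le> fw n lam (R 0)"
    and "spectral_value \<tau> G = fw n lam (R 0) \<Longrightarrow> z \<in> unit_disk \<Longrightarrow>
      R z * (of_real (Re (1 / R 0)) * herg \<tau> z + \<i> * of_real (Im (1 / R 0))) = 1"
    unfolding l_def by blast+
qed

text \<open>\<open>e\<close> counts the additional poles of \<open>R\<close>: the constant case is \<open>e = 0\<close>.\<close>
lemma generator_exists: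
  assumes \<kappa>: "Re \<kappa> \<ge> 0" and e: "e \<le> (1::nat)" and b: "b > (0::real)" and c: "Re c \<le> 0"
    and R: "\<And>z. z \<in> unit_disk \<Longrightarrow> R z = \<kappa> + of_nat e * (of_real b / (herg \<tau> z - c))"
  shows "R holomorphic_on unit_disk" and "\<And>z. z \<in> unit_disk \<Longrightarrow> Re (R z) \<ge> 0"
    and "\<exists>\<phi>. generates \<phi> (gen_of R)" and "gen_of R \<in> Gen_FL \<tau> n \<sigma> lam"
proof -
  have Kc: "Re (herg \<tau> z - c) > 0" if "z \<in> unit_disk" for z
    using Re_herg_pos[OF tau that] c by simp
  have Kc0: "herg \<tau> z - c \<noteq> 0" if "z \<in> unit_disk" for z
    using Kc[OF that] by (metis less_irrefl zero_complex.simps(1))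
  have "(\<lambda>z. \<kappa> + of_nat e * (of_real b / (herg \<tau> z - c))) holomorphic_on unit_disk"
    using Kc0 tau by (intro holomorphic_intros) auto
  then show holR: "R holomorphic_on unit_disk" by (rule holomorphic_transform) (use R in auto)
  show Rnn: "Re (R z) \<ge> 0" if z: "z \<in> unit_disk" for z
  proof -
    have "Re (of_real b / (herg \<tau> z - c)) = b * Re (herg \<tau> z - c) / (cmod (herg \<tau> z - c))\<^sup>2"
      by (simp add: Re_divide')
    also have "\<dots> \<ge> 0" using b Kc[OF z] by (intro divide_nonneg_nonneg mult_nonneg_nonneg) auto
    finally have "Re (of_real b / (herg \<tau> z - c)) \<ge> 0" .
    moreover have "e = 0 \<or> e = 1" using e by auto
    ultimately show ?thesis using R[OF z] \<kappa> by auto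
  qed
  \<comment> \<open>The indices below n carry the poles of \<open>p\<close>; for e = 1 the index n
    carries the additional pole c of R.\<close>
  define J where "J = {..<n + e}"
  define bb where "bb j = (if j < n then 2 / \<bar>lam j\<bar> else b)" for j
  define cc where "cc j = (if j < n then herg \<tau> (\<sigma> j) else c)" for j
  have q: "denom_of R z = \<kappa> + (\<Sum>j\<in>J. of_real (bb j) / (herg \<tau> z - cc j))" if z: "z \<in> unit_disk" for z
  proof -
    have "e = 0 \<or> e = 1" using e by auto
    then have "(\<Sum>j\<in>J. of_real (bb j) / (herg \<tau> z - cc j))
       = (\<Sum>j<n. of_real (bb j) / (herg \<tau> z - cc j)) + of_nat e * (of_real b / (herg \<tau> z - c))"
      unfolding J_def by (auto simp: bb_def cc_def)
    moreover have "(\<Sum>j<n. of_real (bb j) / (herg \<tau> z - cc j)) = p z - p \<tau>"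
      unfolding p_pole_form[OF z] by (intro sum.cong) (auto simp: bb_def cc_def)
    ultimately show ?thesis using R[OF z] by (simp add: denom_of_def)
  qed
  obtain \<phi> where gen: "generates \<phi> (gen_of R)" and dw: "dw_point \<phi> \<tau>"
  proof (rule rational_flow[of \<tau> J bb cc \<kappa> "gen_of R"])
    show "finite J" "J \<noteq> {}" using n_pos by (auto simp: J_def lessThan_empty_iff)
    show "bb j > 0" for j using b lam[of j] by (auto simp: bb_def)
    show "Re (cc j) \<le> 0" for j using c Re_herg_unit[OF tau sigma, of j] by (auto simp: cc_def)
    show "gen_of R z = (\<tau> - z)\<^sup>2 / (\<tau> * (\<kappa> + (\<Sum>j\<in>J. of_real (bb j) / (herg \<tau> z - cc j))))" if "z \<in> unit_disk" for z
      using q[OF that] by (simp add: gen_of_def)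
  qed (use tau \<kappa> gen_of_holomorphic[OF holR Rnn] in auto)
  then show "\<exists>\<phi>. generates \<phi> (gen_of R)" by blast
  have "\<exists>l. lam k \<le> l \<and> l \<le> 0 \<and> brfp \<phi> (\<sigma> k) l" if k: "k < n" for k
  proof -
    note sk = sigma[OF k]
    have "lam k * Re (herg (\<sigma> k) z) \<le> Re (herg_field (\<sigma> k) (gen_of R) z)" if z: "z \<in> unit_disk" for z
    proof -
      let ?v = "herg (\<sigma> k) z - herg (\<sigma> k) \<tau>" and ?d = "(cmod (\<sigma> k - \<tau>))\<^sup>2 / 2"
      have v: "Re ?v = Re (herg (\<sigma> k) z)" using Re_herg_unit[OF sk tau] by simp
      \<comment> \<open>The denominator has at least the mass \<alpha> k at \<sigma> k, and
        |\<sigma> k - \<tau>|^2 / (2 \<alpha> k) = - lam k is the resulting constant for the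
        field.\<close>
      have "Re (?v\<^sup>2 / denom_of R z) \<le> Re ?v / \<alpha> k"
      proof (rule Re_square_quotient_le[OF alpha_pos[OF k]])
        show "0 < Re ?v" unfolding v by (rule Re_herg_pos[OF sk z])
        show "\<alpha> k * Re ?v \<le> Re (denom_of R z)"
          unfolding v using Re_p_ge[OF k z] Rnn[OF z] by (simp add: denom_of_def Re_p_tau)
      qed
      then have "?d * Re (?v\<^sup>2 / denom_of R z) \<le> ?d * (Re ?v / \<alpha> k)"
        by (rule mult_left_mono) simp
      also have "\<dots> = - lam k * Re (herg (\<sigma> k) z)"
        unfolding v using lam[OF k] sigma_tau[OF k] by (simp add: alpha_def norm_minus_commute[of \<tau>] field_simps)
      finally have "?d * Re (?v\<^sup>2 / denom_of R z) \<le> - lam k * Re (herg (\<sigma> k) z)" .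
      then have "lam k * Re (herg (\<sigma> k) z) \<le> - (?d * Re (?v\<^sup>2 / denom_of R z))" by simp
      moreover have "herg_field (\<sigma> k) (gen_of R) z = - of_real ?d * ?v\<^sup>2 / denom_of R z"
        by (rule herg_field_quotient[OF sk tau sigma_tau[OF k] disk_ne_unit[OF sk z]]) (simp add: gen_of_def)
      moreover have "Re (- of_real d * y / x) = - (d * Re (y / x))" for d x y
      proof -
        have "- of_real d * y / x = - (of_real d * (y / x))" by simp
        moreover have "Re (- (of_real d * w)) = - (d * Re w)" for w by simp
        ultimately show ?thesis by (simp only:)
      qed
      ultimately show ?thesis by (simp only:)
    qed
    then obtain l where l: "l \<ge> lam k" "angular_limit (\<lambda>z. herg_field (\<sigma> k) (gen_of R) z / herg (\<sigma> k) z) (\<sigma> k) (of_real l)"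
      "brfp \<phi> (\<sigma> k) l"
      using boundary_fixed_point[OF gen sk] by blast
    \<comment> \<open>\<open>boundary_fixed_point\<close> bounds l only from below; its sign comes
      from l m <= 0 with a positive mass m.\<close>
    obtain m where m: "m > 0" "l * m = - (cmod (\<sigma> k - \<tau>))\<^sup>2 / 2"
      using spectral_value_mass[OF sk tau sigma_tau[OF k] denom_of_holomorphic[OF holR]
          less_imp_le[OF Re_denom_of_pos[of R, OF Rnn]] denom_of_nonzero[of R, OF Rnn] _ l(2)]
      by (metis gen_of_def)
    have "l * m \<le> 0" unfolding m(2) by simp
    then have "l \<le> 0" using m(1) by (simp add: mult_le_0_iff)
    then show ?thesis using l by blast
  qed
  then show "gen_of R \<in> Gen_FL \<tau> n \<sigma> lam"
    unfolding Gen_FL_def using gen dw by blast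
qed

lemma zero_generator:
  assumes "\<And>z. z \<in> unit_disk \<Longrightarrow> G z = 0"
  shows "G \<in> Gen_FL \<tau> n \<sigma> lam" and "spectral_value \<tau> G = 0"
proof -
  note gen = generates_identity[OF assms]
  have "\<exists>l. lam k \<le> l \<and> l \<le> 0 \<and> brfp (\<lambda>t z. z) (\<sigma> k) l" if "k < n" for k
    using brfp_identity[OF sigma[OF that]] lam[OF that] less_imp_le by blast
  then show "G \<in> Gen_FL \<tau> n \<sigma> lam"
    unfolding Gen_FL_def mem_Collect_eq using gen assms
    by (intro exI[of _ "\<lambda>t z. z"] conjI disjI2) auto
  have hf: "herg_field \<tau> G z = 0" if "z \<in> unit_disk" for z
    using assms[OF that] by (simp add: herg_field_def)
  have ev: "\<forall>\<^sub>F r in at_left (1::real). 0 = herg_field \<tau> G (of_real r * \<tau>) / herg \<tau> (of_real r * \<tau>)"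
    using radial_in_disk[OF tau] by (rule eventually_mono) (simp add: hf del: mem_ball)
  show "spectral_value \<tau> G = 0"
  proof (rule spectral_value_eqI[OF gen tau])
    show "0 * Re (herg \<tau> z) \<le> Re (herg_field \<tau> G z)" if "z \<in> unit_disk" for z
      using hf[OF that] by simp
    show "((\<lambda>r. herg_field \<tau> G (of_real r * \<tau>) / herg \<tau> (of_real r * \<tau>)) \<longlongrightarrow> of_real 0) (at_left (1::real))"
      using Lim_transform_eventually[OF tendsto_const ev] by simp
  qed
qed

text \<open>A generator here that is not identically 0 has no zero at 0. So G 0 = 0 singles out the
  trivial generator, and otherwise G 0 determines R 0.\<close>

lemma Gen_FL_cases:
  assumes "G \<in> Gen_FL \<tau> n \<sigma> lam"
  obtains (zero) "\<And>z. z \<in> unit_disk \<Longrightarrow> G z = 0"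
  | (nonzero) \<phi> R where "generates \<phi> G" "R holomorphic_on unit_disk"
      "\<And>z. z \<in> unit_disk \<Longrightarrow> Re (R z) \<ge> 0" "\<And>z. z \<in> unit_disk \<Longrightarrow> G z = gen_of R z"
      "G 0 \<noteq> 0" "R 0 = ell \<tau> n \<sigma> lam (G 0) + p \<tau>"
proof (cases "\<forall>z\<in>unit_disk. G z = 0")
  case True then show ?thesis using zero by blast
next
  case False
  obtain \<phi> where gen: "generates \<phi> G" and dw: "dw_point \<phi> \<tau>"
    and b: "\<And>k. k < n \<Longrightarrow> \<exists>l. lam k \<le> l \<and> l \<le> 0 \<and> brfp \<phi> (\<sigma> k) l"
    using assms False unfolding Gen_FL_def by blast
  obtain R where R: "R holomorphic_on unit_disk" "\<And>z. z \<in> unit_disk \<Longrightarrow> Re (R z) \<ge> 0"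
    "\<And>z. z \<in> unit_disk \<Longrightarrow> G z = gen_of R z"
    using generator_representation[OF gen dw b False] by blast
  have G0: "G 0 = gen_of R 0" using R(3)[of 0] by simp
  moreover have "denom_of R 0 \<noteq> 0" by (rule denom_of_nonzero) (use R(2) in auto)
  ultimately have "G 0 \<noteq> 0" using tau_0 by (simp add: gen_of_def)
  then show ?thesis using nonzero[OF gen R] R_0_eq[of R "G 0"] G0 by simp
qed

section \<open>The value region\<close>

lemma Iset_interior: "\<zeta> \<in> interior (Zset \<tau> n \<sigma> lam) \<Longrightarrow> Iset \<tau> n \<sigma> lam \<zeta> = {0 .. fw n lam (ell \<tau> n \<sigma> lam \<zeta> + p \<tau>)}"
  by (simp add: Iset_def omega_eq)

lemma Iset_boundary:
  assumes "\<zeta> \<noteq> 0" "Re (ell \<tau> n \<sigma> lam \<zeta>) = 0"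
  shows "Iset \<tau> n \<sigma> lam \<zeta> = (if ell \<tau> n \<sigma> lam \<zeta> + p \<tau> = 0 then {1 / S} else {0})"
  using assms boundary_condition[OF assms(1)] unfolding Iset_def interior_Zset_iff S_def by simp

lemma Iset_0: "Iset \<tau> n \<sigma> lam 0 = {0}"
  unfolding Iset_def interior_Zset_iff by simp

text \<open>On the boundary of \<open>Z\<close> the function \<open>R\<close> is an imaginary constant.\<close>
lemma spectral_value_boundary:
  assumes gen: "generates \<phi> G" and holR: "R holomorphic_on unit_disk"
    and R: "\<And>z. z \<in> unit_disk \<Longrightarrow> Re (R z) \<ge> 0" and G: "\<And>z. z \<in> unit_disk \<Longrightarrow> G z = gen_of R z"
    and R0: "Re (R 0) = 0"
  shows "spectral_value \<tau> G = (if R 0 = 0 then 1 / S else 0)"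
proof -
  have const: "R z = R 0" if "z \<in> unit_disk" for z
    by (rule Re_nonneg_constant[OF holR R _ R0 that]) auto
  show ?thesis
  proof (cases "R 0 = 0")
    case True
    have ev: "\<forall>\<^sub>F r in at_left (1::real). 0 = R (of_real r * \<tau>) * herg \<tau> (of_real r * \<tau>)"
      using radial_in_disk[OF tau] by (rule eventually_mono) (simp add: const True del: mem_ball)
    have "spectral_value \<tau> G = 2 / (0 + 2 * S)"
      by (rule spectral_value_of_limit[OF gen R G order_refl])
        (use Lim_transform_eventually[OF tendsto_const ev] in auto)
    then show ?thesis using True by simp
  next
    case False
    then show ?thesis using spectral_value_const[OF gen _ False const G] R0 by simp
  qed
qed

lemma V_FL_subset:
  assumes G: "G \<in> Gen_FL \<tau> n \<sigma> lam"
  shows "G 0 \<in> Zset \<tau> n \<sigma> lam \<and> spectral_value \<tau> G \<in> Iset \<tau> n \<sigma> lam (G 0)"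
  using G
proof (cases rule: Gen_FL_cases)
  case zero
  then have "G 0 = 0" by simp
  then show ?thesis using zero_generator(2)[OF zero] by (simp add: Zset_iff Iset_0)
next
  case (nonzero \<phi> R)
  have "Re (R 0) \<ge> 0" using nonzero(3)[of 0] by simp
  then have nn: "Re (ell \<tau> n \<sigma> lam (G 0)) \<ge> 0" using nonzero(6) Re_p_tau by simp
  show ?thesis
  proof (cases "Re (ell \<tau> n \<sigma> lam (G 0)) = 0")
    case True
    have "spectral_value \<tau> G = (if R 0 = 0 then 1 / S else 0)"
      by (rule spectral_value_boundary[OF nonzero(1-4)]) (use nonzero(6) True Re_p_tau in auto)
    then show ?thesis
      using Iset_boundary[OF nonzero(5) True] nonzero(6) True by (simp add: Zset_iff)
  next
    case False
    with nn have pos: "Re (ell \<tau> n \<sigma> lam (G 0)) > 0" by simp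
    have "spectral_value \<tau> G \<le> fw n lam (R 0)"
      by (rule spectral_value_bound(1)[OF nonzero(1-4)]) (use nonzero(6) pos Re_p_tau in auto)
    moreover have "spectral_value \<tau> G \<ge> 0"
      by (rule spectral_value_radial(1)[OF nonzero(1,3,4)])
    ultimately show ?thesis
      using Iset_interior[of "G 0"] nonzero(5,6) pos by (simp add: Zset_iff interior_Zset_iff)
  qed
qed

text \<open>The constant R = w realizes the boundary of Z and, inside, the spectral value 0.
  Positive spectral values inside Z come from R = B / (herg \<tau> - c), where B is fixed by
  \<omega> and c by R 0 = w.\<close>

lemma V_FL_supset:
  assumes \<zeta>: "\<zeta> \<in> Zset \<tau> n \<sigma> lam" and \<omega>: "\<omega> \<in> Iset \<tau> n \<sigma> lam \<zeta>"
  shows "\<exists>G\<in>Gen_FL \<tau> n \<sigma> lam. G 0 = \<zeta> \<and> spectral_value \<tau> G = \<omega>"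
proof (cases "\<zeta> = 0")
  case True
  then show ?thesis
    using zero_generator[of "\<lambda>_. 0"] \<omega> Iset_0 by (intro bexI[of _ "\<lambda>_. 0"]) auto
next
  case False
  define w where "w = ell \<tau> n \<sigma> lam \<zeta> + p \<tau>"
  have Re_w: "Re w = Re (ell \<tau> n \<sigma> lam \<zeta>)" by (simp add: w_def Re_p_tau)
  have nn: "Re w \<ge> 0" using \<zeta> False Re_w by (simp add: Zset_iff)
  note const = generator_exists[of w 0 1 0 "\<lambda>_. w", OF nn, simplified]
  show ?thesis
  proof (cases "\<omega> = 0 \<and> w \<noteq> 0 \<or> Re w = 0")
    case c: True
    obtain \<phi> where gen: "generates \<phi> (gen_of (\<lambda>_. w))" using const(3) by blast
    have "gen_of (\<lambda>_. w) 0 = \<zeta>" by (rule gen_of_0) (use False in \<open>simp_all add: w_def\<close>)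
    moreover have "spectral_value \<tau> (gen_of (\<lambda>_. w)) = \<omega>"
    proof (cases "Re w = 0")
      case True
      have "spectral_value \<tau> (gen_of (\<lambda>_. w)) = (if w = 0 then 1 / S else 0)"
        using spectral_value_boundary[OF gen _ _ refl] nn True by simp
      then show ?thesis using \<omega> Iset_boundary[OF False] True Re_w by (simp add: w_def split: if_splits)
    next
      case False
      then show ?thesis using c spectral_value_const[OF gen nn _ refl refl] by simp
    qed
    ultimately show ?thesis using const(4) by blast
  next
    case c: False
    then have pos: "Re w > 0" using nn by simp
    then have w0: "w \<noteq> 0" by auto
    have "\<zeta> \<in> interior (Zset \<tau> n \<sigma> lam)" using False pos Re_w by (simp add: interior_Zset_iff)
    then have "0 \<le> \<omega>" "\<omega> \<le> fw n lam w" using \<omega> Iset_interior by (auto simp: w_def)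
    with c w0 have \<omega>0: "\<omega> > 0" by simp
    have Rinv: "Re (1 / w) > 0" using pos w0 by (simp add: Re_divide')
    have D: "1 / Re (1 / w) + 2 * S > 0" using Rinv S_pos by (simp add: add_pos_pos)
    have "\<omega> * (1 / Re (1 / w) + 2 * S) \<le> 2"
      using \<open>\<omega> \<le> fw n lam w\<close> D unfolding fw_eq[OF pos] by (simp add: pos_le_divide_eq)
    then have "1 / Re (1 / w) + 2 * S \<le> 2 / \<omega>" using \<omega>0 by (simp add: pos_le_divide_eq mult.commute)
    then have B: "1 / Re (1 / w) \<le> 2 / \<omega> - 2 * S" by simp
    \<comment> \<open>The solution of 2 / (B + 2 S) = \<omega>.\<close>
    define B where "B = 2 / \<omega> - 2 * S"
    have Bge: "1 / Re (1 / w) \<le> B" unfolding B_def by (rule B)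
    have Bpos: "B > 0" using Bge Rinv by (meson order_less_le_trans zero_less_divide_1_iff)
    \<comment> \<open>R 0 = w means (1 - c) / B = 1 / w, hence c = - B b. The bound on \<omega> says
      1 / B <= Re (1 / w), which is exactly Re c <= 0.\<close>
    define b where "b = 1 / w - of_real (1 / B)"
    have "1 / B \<le> Re (1 / w)" using Bge Bpos Rinv by (simp add: field_simps)
    then have Re_b: "Re b \<ge> 0" by (simp add: b_def)
    define c where "c = - (of_real B * b)"
    have Re_c: "Re c \<le> 0" using Re_b Bpos by (simp add: c_def)
    define R where "R z = of_real B / (herg \<tau> z - c)" for z
    note ex = generator_exists[of 0 1 B c R, simplified, OF Bpos Re_c R_def]
    obtain \<phi> where gen: "generates \<phi> (gen_of R)" using ex(3) by blast
    have "1 - c = of_real B * (1 / w)"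
      using Bpos by (simp add: c_def b_def right_diff_distrib)
    then have "R 0 = w" using Bpos w0 tau by (simp add: R_def)
    then have "gen_of R 0 = \<zeta>" using False by (intro gen_of_0) (simp_all add: w_def)
    moreover have "spectral_value \<tau> (gen_of R) = 2 / (B + 2 * S)"
    proof (rule spectral_value_of_limit[OF gen _ refl less_imp_le[OF Bpos]])
      show "Re (R z) \<ge> 0" if "z \<in> unit_disk" for z using ex(2) that by simp
      let ?F = "at_left (1::real)" and ?z = "\<lambda>r. of_real r * \<tau>"
      have "((\<lambda>r. of_real B / (1 - c * inverse (herg \<tau> (?z r)))) \<longlongrightarrow> of_real B / (1 - c * 0)) ?F"
        by (intro tendsto_intros inverse_herg_radial[OF tau]) auto
      moreover have "\<forall>\<^sub>F r in ?F. of_real B / (1 - c * inverse (herg \<tau> (?z r))) = R (?z r) * herg \<tau> (?z r)"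
        using radial_in_disk[OF tau]
      proof eventually_elim
        case (elim r)
        have K: "herg \<tau> (?z r) \<noteq> 0" using Re_herg_pos[OF tau elim] by auto
        have "d / (1 - y * inverse x) = d / (x - y) * x" if "x \<noteq> 0" for d x y :: complex
          using that by (simp add: field_simps)
        from this[OF K] show ?case unfolding R_def .
      qed
      ultimately show "((\<lambda>r. R (?z r) * herg \<tau> (?z r)) \<longlongrightarrow> of_real B) ?F"
        using Lim_transform_eventually by fastforce
    qed
    moreover have "2 / (B + 2 * S) = \<omega>" using \<omega>0 by (simp add: B_def)
    ultimately show ?thesis using ex(4) by auto
  qed
qed

lemma V_FL_eq: "V_FL \<tau> n \<sigma> lam = {(\<zeta>, \<omega>). \<zeta> \<in> Zset \<tau> n \<sigma> lam \<and> \<omega> \<in> Iset \<tau> n \<sigma> lam \<zeta>}"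
proof (intro equalityI subsetI)
  fix x assume "x \<in> V_FL \<tau> n \<sigma> lam"
  then show "x \<in> {(\<zeta>, \<omega>). \<zeta> \<in> Zset \<tau> n \<sigma> lam \<and> \<omega> \<in> Iset \<tau> n \<sigma> lam \<zeta>}"
    using V_FL_subset by (auto simp: V_FL_def)
next
  fix x assume "x \<in> {(\<zeta>, \<omega>). \<zeta> \<in> Zset \<tau> n \<sigma> lam \<and> \<omega> \<in> Iset \<tau> n \<sigma> lam \<zeta>}"
  then obtain \<zeta> \<omega> where x: "x = (\<zeta>, \<omega>)" "\<zeta> \<in> Zset \<tau> n \<sigma> lam" "\<omega> \<in> Iset \<tau> n \<sigma> lam \<zeta>" by blast
  obtain G where "G \<in> Gen_FL \<tau> n \<sigma> lam" "G 0 = \<zeta>" "spectral_value \<tau> G = \<omega>"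
    using V_FL_supset[OF x(2,3)] by blast
  then show "x \<in> V_FL \<tau> n \<sigma> lam" unfolding V_FL_def x(1) by blast
qed

section \<open>The extremal generator\<close>

text \<open>As \<open>p \<tau>\<close> is imaginary it merges with Im \<open>ell\<close>, and the
  condition depends on w alone: clearing the denominator leaves s w + \<tau> cnj w = 0.\<close>

lemma denom_tau_iff:
  assumes w: "w = ell \<tau> n \<sigma> lam \<zeta> + p \<tau>" "w \<noteq> 0" and s: "s \<noteq> \<tau>"
  shows "denom \<tau> n \<sigma> lam \<zeta> s \<tau> = 0 \<longleftrightarrow> s = - \<tau> * cnj w / w"
proof -
  have d: "denom \<tau> n \<sigma> lam \<zeta> s \<tau> = (s + \<tau>) / (s - \<tau>) * of_real (Re w) + \<i> * of_real (Im w)"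
    unfolding denom_def w(1) by (simp add: complex_eq_iff Re_p_tau)
  have wc: "w = of_real (Re w) + \<i> * of_real (Im w)" "cnj w = of_real (Re w) - \<i> * of_real (Im w)"
    by (simp_all add: complex_eq_iff)
  have "denom \<tau> n \<sigma> lam \<zeta> s \<tau> = 0 \<longleftrightarrow> (s + \<tau>) * of_real (Re w) + \<i> * of_real (Im w) * (s - \<tau>) = 0"
  proof -
    have "x / d * y + c = 0 \<longleftrightarrow> x * y + c * d = 0" if "d \<noteq> 0" for x y c d :: complex
      using that by (simp add: field_simps)
    then show ?thesis unfolding d using s by simp
  qed
  also have "(s + \<tau>) * of_real (Re w) + \<i> * of_real (Im w) * (s - \<tau>) = s * w + \<tau> * cnj w"
    by (subst (3) wc(1), subst wc(2)) (simp add: algebra_simps)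
  also have "s * w + \<tau> * cnj w = 0 \<longleftrightarrow> s = - \<tau> * cnj w / w"
    using nonzero_eq_divide_eq[OF w(2), of s "- \<tau> * cnj w"] by (simp add: eq_neg_iff_add_eq_0)
  finally show ?thesis .
qed

text \<open>At s = \<tau> the quotient in \<open>denom\<close> is 0 by the convention for division,
  which would give a spurious solution when Im w = 0; hence the condition s \<noteq> \<tau>.\<close>

lemma ex1_denom:
  assumes \<zeta>: "\<zeta> \<in> interior (Zset \<tau> n \<sigma> lam)"
  shows "\<exists>!s. cmod s = 1 \<and> s \<noteq> \<tau> \<and> denom \<tau> n \<sigma> lam \<zeta> s \<tau> = 0"
proof -
  define w where "w = ell \<tau> n \<sigma> lam \<zeta> + p \<tau>"
  have pos: "Re w > 0" using \<zeta> by (simp add: w_def interior_Zset_iff Re_p_tau)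
  then have w0: "w \<noteq> 0" by auto
  note iff = denom_tau_iff[OF w_def w0]
  show ?thesis
  proof (rule ex1I[of _ "- \<tau> * cnj w / w"])
    have ne: "- \<tau> * cnj w / w \<noteq> \<tau>"
    proof
      assume "- \<tau> * cnj w / w = \<tau>"
      then have eq: "- \<tau> * cnj w = \<tau> * w" using w0 by (metis nonzero_divide_eq_eq)
      have "\<tau> * (w + cnj w) = \<tau> * w - (- \<tau> * cnj w)" by (simp add: distrib_left)
      then have "\<tau> * (w + cnj w) = 0" unfolding eq by simp
      then have "Re (w + cnj w) = 0" using tau_0 by simp
      then show False using pos by simp
    qed
    then show "cmod (- \<tau> * cnj w / w) = 1 \<and> - \<tau> * cnj w / w \<noteq> \<tau> \<and> denom \<tau> n \<sigma> lam \<zeta> (- \<tau> * cnj w / w) \<tau> = 0"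
      using iff[OF ne] w0 tau by (simp add: norm_divide norm_mult)
  qed (use iff in blast)
qed

text \<open>Equality in Julia's bound makes 1 / R affine in \<open>herg \<tau>\<close>. Its only
  zero is z = - \<tau> cnj w / w, which is s, so R is the kernel at s with weight Re w plus the
  constant i Im w.\<close>

lemma extremal_generator:
  assumes \<zeta>: "\<zeta> \<in> interior (Zset \<tau> n \<sigma> lam)"
    and s: "cmod s = 1" "s \<noteq> \<tau>" "denom \<tau> n \<sigma> lam \<zeta> s \<tau> = 0"
    and G: "G \<in> Gen_FL \<tau> n \<sigma> lam" "G 0 = \<zeta>" "spectral_value \<tau> G = omega \<tau> n \<sigma> lam \<zeta>"
    and z: "z \<in> unit_disk"
  shows "G z = (\<tau> - z) * (1 - cnj \<tau> * z) / denom \<tau> n \<sigma> lam \<zeta> s z"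
  using G(1)
proof (cases rule: Gen_FL_cases)
  case zero
  then show ?thesis using G(2) \<zeta> by (simp add: interior_Zset_iff)
next
  case (nonzero \<phi> R)
  define w where "w = ell \<tau> n \<sigma> lam \<zeta> + p \<tau>"
  have R0: "R 0 = w" using nonzero(6) G(2) by (simp add: w_def)
  have pos: "Re w > 0" using \<zeta> by (simp add: w_def interior_Zset_iff Re_p_tau)
  then have w0: "w \<noteq> 0" by auto
  have "R z * (of_real (Re (1 / w)) * herg \<tau> z + \<i> * of_real (Im (1 / w))) = 1"
    using spectral_value_bound(2)[OF nonzero(1-4) _ _ z] R0 pos G(3) by (simp add: omega_eq w_def)
  note Rz = this
  have sw: "s * w = - \<tau> * cnj w" using denom_tau_iff[OF w_def w0 s(2)] s(3) w0 by simp
  have ne: "\<tau> - z \<noteq> 0" "s - z \<noteq> 0" using disk_ne_unit[OF tau z] disk_ne_unit[OF s(1) z] by auto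
  have wc: "w = of_real (Re w) + \<i> * of_real (Im w)" "cnj w = of_real (Re w) - \<i> * of_real (Im w)"
    by (simp_all add: complex_eq_iff)
  define m where "m = complex_of_real ((cmod w)\<^sup>2)"
  have m0: "m \<noteq> 0" using w0 by (simp add: m_def)
  have m: "m = w * cnj w" unfolding m_def by (rule complex_norm_square)
  have "of_real (Re (1 / w)) * herg \<tau> z + \<i> * of_real (Im (1 / w))
      = (of_real (Re w) * herg \<tau> z - \<i> * of_real (Im w)) / m"
    by (simp add: Re_divide' Im_divide' m_def diff_divide_distrib)
  also have "of_real (Re w) * herg \<tau> z - \<i> * of_real (Im w)
      = (of_real (Re w) * (\<tau> + z) - \<i> * of_real (Im w) * (\<tau> - z)) / (\<tau> - z)"
    using ne by (simp add: herg_def field_simps)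
  also have "of_real (Re w) * (\<tau> + z) - \<i> * of_real (Im w) * (\<tau> - z) = \<tau> * cnj w + z * w"
    by (subst (3) wc(1), subst wc(2)) (simp add: algebra_simps)
  finally have R1: "R z * ((\<tau> * cnj w + z * w) / (m * (\<tau> - z))) = 1"
    using Rz by (simp add: mult.commute)
  have "denom \<tau> n \<sigma> lam \<zeta> s z = herg s z * of_real (Re w) + \<i> * of_real (Im w) + (p z - p \<tau>)"
    unfolding denom_def herg_def w_def by (simp add: complex_eq_iff Re_p_tau)
  \<comment> \<open>Multiplied by s - z, both sides become - cnj w (\<tau> - z).\<close>
  moreover have "herg s z * of_real (Re w) + \<i> * of_real (Im w) = R z"
  proof -
    have "(herg s z * of_real (Re w) + \<i> * of_real (Im w)) * (s - z)
       = (s + z) * of_real (Re w) + \<i> * of_real (Im w) * (s - z)"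
    proof -
      have "herg s z * (s - z) = s + z" using ne by (simp add: herg_def)
      moreover have "(h * x + c) * d = (h * d) * x + c * d" for h x c d :: complex
        by (simp add: algebra_simps)
      ultimately show ?thesis by (simp only:)
    qed
    also have "\<dots> = s * w + z * cnj w"
      by (subst (3) wc(1), subst wc(2)) (simp add: algebra_simps)
    also have "\<dots> = - cnj w * (\<tau> - z)" unfolding sw by (simp add: algebra_simps)
    finally have H: "(herg s z * of_real (Re w) + \<i> * of_real (Im w)) * (s - z) = - cnj w * (\<tau> - z)" .
    have "\<tau> * cnj w + z * w = - (s - z) * w"
      using sw by (simp add: algebra_simps)
    then have "R z * (- (s - z) * w) = m * (\<tau> - z)"
      using R1 m0 ne by (simp add: divide_simps)
    then have "w * (R z * (s - z)) = w * (- cnj w * (\<tau> - z))"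
      unfolding m by (simp add: algebra_simps)
    then have "R z * (s - z) = - cnj w * (\<tau> - z)" using w0 by (metis mult_left_cancel)
    with H show ?thesis using ne by (metis mult_right_cancel)
  qed
  ultimately have "denom \<tau> n \<sigma> lam \<zeta> s z = denom_of R z" by (simp add: denom_of_def)
  moreover have "(\<tau> - z) * (1 - cnj \<tau> * z) = (\<tau> - z)\<^sup>2 / \<tau>"
  proof -
    have "\<tau> * cnj \<tau> = 1" using tau by (simp add: complex_norm_square[symmetric])
    then have "\<tau> * (1 - cnj \<tau> * z) = \<tau> - z" by (simp add: right_diff_distrib mult.assoc[symmetric])
    then have "\<tau> * ((\<tau> - z) * (1 - cnj \<tau> * z)) = (\<tau> - z)\<^sup>2"
      by (metis mult.left_commute power2_eq_square)
    then show ?thesis using tau_0 by (metis nonzero_mult_div_cancel_left)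
  qed
  ultimately show ?thesis using nonzero(4)[OF z] by (simp add: gen_of_def)
qed

end

theorem theorem6p8:
  fixes \<tau> :: complex and n :: nat and \<sigma> :: "nat \<Rightarrow> complex" and lam :: "nat \<Rightarrow> real"
  assumes n_pos: "n \<ge> 1"
    and sigma_bd: "\<forall>k<n. cmod (\<sigma> k) = 1"
    and sigma_inj: "inj_on \<sigma> {..<n}"
    and lam_neg: "\<forall>k<n. lam k < 0"
    and tau_bd: "cmod \<tau> = 1"
    and tau_notin: "\<forall>k<n. \<tau> \<noteq> \<sigma> k"
  shows "V_FL \<tau> n \<sigma> lam =
           {(\<zeta>, \<omega>). \<zeta> \<in> Zset \<tau> n \<sigma> lam \<and> \<omega> \<in> Iset \<tau> n \<sigma> lam \<zeta>}
    \<and> (\<forall>\<zeta>\<in>interior (Zset \<tau> n \<sigma> lam).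
         (\<exists>!s. cmod s = 1 \<and> s \<noteq> \<tau> \<and> denom \<tau> n \<sigma> lam \<zeta> s \<tau> = 0) \<and>
         (\<forall>s. cmod s = 1 \<and> s \<noteq> \<tau> \<and> denom \<tau> n \<sigma> lam \<zeta> s \<tau> = 0 \<longrightarrow>
            (\<exists>G\<in>Gen_FL \<tau> n \<sigma> lam. G 0 = \<zeta> \<and> spectral_value \<tau> G = omega \<tau> n \<sigma> lam \<zeta>) \<and>
            (\<forall>G\<in>Gen_FL \<tau> n \<sigma> lam. G 0 = \<zeta> \<and> spectral_value \<tau> G = omega \<tau> n \<sigma> lam \<zeta> \<longrightarrow>
               (\<forall>z\<in>unit_disk. G z = (\<tau> - z) * (1 - cnj \<tau> * z) / denom \<tau> n \<sigma> lam \<zeta> s z))))"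
proof -
  interpret interpolation_data \<tau> n \<sigma> lam
    using assms by unfold_locales auto
  \<comment> \<open>Existence of the extremal G is \<open>V_FL_supset\<close> at the upper endpoint
    of the interval, which belongs to it because f is nonnegative there.\<close>
  have "omega \<tau> n \<sigma> lam \<zeta> \<in> Iset \<tau> n \<sigma> lam \<zeta>" "\<zeta> \<in> Zset \<tau> n \<sigma> lam"
    if \<zeta>: "\<zeta> \<in> interior (Zset \<tau> n \<sigma> lam)" for \<zeta>
  proof -
    have pos: "Re (ell \<tau> n \<sigma> lam \<zeta> + p0 \<tau> n \<sigma> lam \<tau>) > 0"
      using \<zeta> by (simp add: interior_Zset_iff Re_p_tau)
    then have "fw n lam (ell \<tau> n \<sigma> lam \<zeta> + p0 \<tau> n \<sigma> lam \<tau>) \<ge> 0"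
      unfolding fw_def using S_pos by (simp add: S_def[symmetric])
    then show "omega \<tau> n \<sigma> lam \<zeta> \<in> Iset \<tau> n \<sigma> lam \<zeta>"
      unfolding Iset_interior[OF \<zeta>] omega_eq by simp
    show "\<zeta> \<in> Zset \<tau> n \<sigma> lam" using \<zeta> interior_subset by blast
  qed
  then show ?thesis
    using V_FL_eq ex1_denom V_FL_supset extremal_generator by blast
qed

end
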